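(* Let $n$ and $d$ be positive integers, $p>1$ a real number and $\mu$ a partition. Then the $\mu$-moment of the distribution $P_{d;n,0}$ is $$M_{p,\mu}\big(P_{d;n,0}\big)=q^{-\sum_{i=1}^n\binom{\mu'_i}{2}}\,\frac{(q;q)_d}{(q;q)_{d-l(\mu)}},$$ and thus $$M_{p,\mu}\big(P_{\infty;n,0}\big)=p^{\sum_{i=1}^n\binom{\mu'_i}{2}}.$$
   Context: Partitions: a partition $\lambda=(\lambda_1,\lambda_2,\dots)$ is a weakly decreasing sequence of nonnegative integers with finite sum $|\lambda|$; $l(\lambda)$ is its number of positive parts; $\lambda'$ is the conjugate partition; $m_i(\lambda)=\lambda'_i-\lambda'_{i+1}$ is the number of parts equal to $i$; $n(\lambda):=\sum_{i\ge1}\binom{\lambda'_i}{2}$; $b_\lambda(q):=\prod_{i\ge1}(q;q)_{m_i(\lambda)}$. Throughout $q:=1/p\in(0,1)$, $(x;q)_\infty=\prod_{i\ge1}(1-xq^{i-1})$, $(x;q)_m=\prod_{i=1}^m(1-xq^{i-1})$ for $m\ge0$, with the convention $1/(q;q)_m=0$ for negative integers $m$; $\begin{bmatrix}m\\k\end{bmatrix}_q=\frac{(q;q)_m}{(q;q)_k(q;q)_{m-k}}$ for $0\le k\le m$, and $0$ otherwise. Define $$P_{d,1}(\lambda):=\frac{q^{2n(\lambda)+|\lambda|}}{b_\lambda(q)}(q;q)_{l(\lambda)}(q;q)_d\begin{bmatrix}d\\l(\lambda)\end{bmatrix}_q\ (\text{zero if } l(\lambda)>d),\qquad P_{\infty,1}(\lambda):=(q;q)_\infty\frac{q^{2n(\lambda)+|\lambda|}}{b_\lambda(q)},$$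 $$P_{d;n,0}(\lambda):=P_{d,1}(\lambda)\,\frac{q^{-\sum_{i=1}^n\binom{\lambda'_i}2}(q;q)_{\lambda'_n}}{(q;q)_d}\,(q;q^2)_{\lceil(d-l(\lambda))/2\rceil}\prod_{i=1}^{n-1}(q;q^2)_{\lceil m_i(\lambda)/2\rceil},$$ $$P_{\infty;n,0}(\lambda):=P_{\infty,1}(\lambda)\,\frac{q^{-\sum_{i=1}^n\binom{\lambda'_i}2}(q;q)_{\lambda'_n}}{(q^2;q^2)_\infty}\prod_{i=1}^{n-1}(q;q^2)_{\lceil m_i(\lambda)/2\rceil}.$$ Hall–Littlewood functions: for $l(\lambda)\le N$, $$P_\lambda(x_1,\dots,x_N;q)=\frac1{v_\lambda(q)}\sum_{w\in S_N}w\Big(x_1^{\lambda_1}\cdots x_N^{\lambda_N}\prod_{i<j}\frac{x_i-qx_j}{x_i-x_j}\Big),\quad v_\lambda(q)=\frac{(q;q)_{N-l(\lambda)}}{(1-q)^{N-l(\lambda)}}\prod_{i\ge1}\frac{(q;q)_{m_i(\lambda)}}{(1-q)^{m_i(\lambda)}},$$ where $S_N$ permutes the variables, extended by stability to symmetric functions in countably many variables; $Q_\lambda=b_\lambda(q)P_\lambda$. Define $g^\lambda_{\mu\nu}(q)$ by $Q_\mu Q_\nu=\sum_\lambda g^\lambda_{\mu\nu}(q)Q_\lambda$ and the skew function $P_{\lambda/\mu}:=\sum_\nu g^\lambda_{\mu\nu}(q)P_\nu$ (zero unless $\mu_i\le\lambda_i$ for all $i$). For real $p>1$ put $$|\mathrm{Sur}_p(\lambda,\mu)|:=\frac{P_{\lambda/\mu}(q,q^2,\dots;q)}{P_\lambda(q,q^2,\dots;q)\,Q_\mu(1,q,q^2,\dots;q)};$$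 when $p$ is prime this is the number of surjective homomorphisms $\bigoplus_i\mathbb Z/p^{\lambda_i}\mathbb{Z}\to\bigoplus_i\mathbb Z/p^{\mu_i}\mathbb{Z}$. The $\mu$-moment of a measure $\nu$ on partitions is $M_{p,\mu}(\nu):=\sum_\lambda\nu(\lambda)\,|\mathrm{Sur}_p(\lambda,\mu)|$. *)

theory Defs
  imports "HOL-Analysis.Analysis" "HOL-Combinatorics.Permutations"
begin

text \<open>
  All sequences are indexed from 0: a partition is a function \<open>\<lambda> :: nat \<Rightarrow> nat\<close> whose value \<open>\<lambda> i\<close> is
  the part \<open>\<lambda>\<^sub>i\<^sub>+\<^sub>1\<close>, and \<open>x i\<close> is the variable \<open>x\<^sub>i\<^sub>+\<^sub>1\<close>. The conjugate partition
  and the multiplicities keep their usual index \<open>i \<ge> 1\<close>; their values at \<open>i = 0\<close> are meaningless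
  and never used.
\<close>

definition partitions :: "(nat \<Rightarrow> nat) set" where
  "partitions = {l. antimono l \<and> finite {i. l i \<noteq> 0}}"

definition part_size :: "(nat \<Rightarrow> nat) \<Rightarrow> nat" where
  "part_size l = (\<Sum>i | l i \<noteq> 0. l i)"

definition part_len :: "(nat \<Rightarrow> nat) \<Rightarrow> nat" where
  "part_len l = card {i. l i > 0}"

definition part_conj :: "(nat \<Rightarrow> nat) \<Rightarrow> nat \<Rightarrow> nat" where
  "part_conj l i = card {j. l j \<ge> i}"

definition part_mult :: "(nat \<Rightarrow> nat) \<Rightarrow> nat \<Rightarrow> nat" where
  "part_mult l i = part_conj l i - part_conj l (Suc i)"

text \<open>
  In the sums and products over all \<open>i \<ge> 1\<close> below, the terms with \<open>i > l 0\<close> (the largest part)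
  are trivial, since there \<open>part_conj l i = 0\<close> and \<open>part_mult l i = 0\<close>.
\<close>

definition part_n :: "(nat \<Rightarrow> nat) \<Rightarrow> nat" where
  "part_n l = (\<Sum>i=1..l 0. part_conj l i choose 2)"

definition qpoch :: "real \<Rightarrow> real \<Rightarrow> nat \<Rightarrow> real" where
  "qpoch x q m = (\<Prod>i=1..m. 1 - x * q ^ (i - 1))"

definition qpoch_inf :: "real \<Rightarrow> real \<Rightarrow> real" where
  "qpoch_inf x q = (\<Prod>i. 1 - x * q ^ i)"

text \<open>\<open>1 / (q;q)\<^sub>m\<close> for an integer \<open>m\<close>, with the convention that it vanishes for \<open>m < 0\<close>.\<close>

definition inv_qpoch :: "real \<Rightarrow> int \<Rightarrow> real" where
  "inv_qpoch q m = (if m < 0 then 0 else 1 / qpoch q q (nat m))"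

definition qbinom :: "real \<Rightarrow> nat \<Rightarrow> nat \<Rightarrow> real" where
  "qbinom q m k =
     (if k \<le> m then qpoch q q m / (qpoch q q k * qpoch q q (m - k)) else 0)"

definition part_b :: "real \<Rightarrow> (nat \<Rightarrow> nat) \<Rightarrow> real" where
  "part_b q l = (\<Prod>i=1..l 0. qpoch q q (part_mult l i))"


definition P_fin :: "real \<Rightarrow> nat \<Rightarrow> (nat \<Rightarrow> nat) \<Rightarrow> real" where
  "P_fin q d l =
     q ^ (2 * part_n l + part_size l) / part_b q l
       * qpoch q q (part_len l) * qpoch q q d * qbinom q d (part_len l)"

definition P_inf :: "real \<Rightarrow> (nat \<Rightarrow> nat) \<Rightarrow> real" where
  "P_inf q l = qpoch_inf q q * (q ^ (2 * part_n l + part_size l) / part_b q l)"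

definition P_fin0 :: "real \<Rightarrow> nat \<Rightarrow> nat \<Rightarrow> (nat \<Rightarrow> nat) \<Rightarrow> real" where
  "P_fin0 q d n l =
     P_fin q d l
       * (q powi (- int (\<Sum>i=1..n. part_conj l i choose 2)) * qpoch q q (part_conj l n)
            / qpoch q q d)
       * qpoch q (q\<^sup>2) (nat \<lceil>(real d - real (part_len l)) / 2\<rceil>)
       * (\<Prod>i=1..<n. qpoch q (q\<^sup>2) (nat \<lceil>real (part_mult l i) / 2\<rceil>))"

definition P_inf0 :: "real \<Rightarrow> nat \<Rightarrow> (nat \<Rightarrow> nat) \<Rightarrow> real" where
  "P_inf0 q n l =
     P_inf q l
       * (q powi (- int (\<Sum>i=1..n. part_conj l i choose 2)) * qpoch q q (part_conj l n)
            / qpoch_inf (q\<^sup>2) (q\<^sup>2))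
       * (\<Prod>i=1..<n. qpoch q (q\<^sup>2) (nat \<lceil>real (part_mult l i) / 2\<rceil>))"


text \<open>
  A symmetric function is represented by the compatible family of its restrictions to \<open>N\<close>
  variables, \<open>f N x = f(x\<^sub>1, \<dots>, x\<^sub>N)\<close>, where only \<open>x 0, \<dots>, x (N - 1)\<close> matter. As the
  Hall--Littlewood polynomials are given by a formula with denominators \<open>x\<^sub>i - x\<^sub>j\<close>, the value
  \<open>f N x\<close> is meaningful only for pairwise distinct variables; these points are Zariski dense, so
  they determine a real polynomial. By stability, \<open>P\<^sub>\<lambda>(x\<^sub>1, \<dots>, x\<^sub>N) = 0\<close> if \<open>l(\<lambda>) > N\<close>.
\<close>

type_synonym symfun = "nat \<Rightarrow> (nat \<Rightarrow> real) \<Rightarrow> real"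

definition hl_v :: "real \<Rightarrow> nat \<Rightarrow> (nat \<Rightarrow> nat) \<Rightarrow> real" where
  "hl_v q N l =
     qpoch q q (N - part_len l) / (1 - q) ^ (N - part_len l)
       * (\<Prod>i=1..l 0. qpoch q q (part_mult l i) / (1 - q) ^ part_mult l i)"

definition hl_P :: "real \<Rightarrow> (nat \<Rightarrow> nat) \<Rightarrow> symfun" where
  "hl_P q l N x =
     (if part_len l \<le> N
      then 1 / hl_v q N l *
        (\<Sum>w | w permutes {..<N}.
           (\<Prod>i<N. x (w i) ^ l i)
             * (\<Prod>j<N. \<Prod>i<j. (x (w i) - q * x (w j)) / (x (w i) - x (w j))))
      else 0)"

definition hl_Q :: "real \<Rightarrow> (nat \<Rightarrow> nat) \<Rightarrow> symfun" where
  "hl_Q q l N x = part_b q l * hl_P q l N x"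

text \<open>
  The map \<open>\<lambda> \<mapsto> g\<^sup>\<lambda>\<^sub>\<mu>\<^sub>\<nu>(q)\<close>: the coefficients of the expansion of \<open>Q\<^sub>\<mu> Q\<^sub>\<nu>\<close> in the
  basis \<open>Q\<^sub>\<lambda>\<close> of the ring of symmetric functions, an identity in any number of variables.
\<close>

definition hl_coeffs :: "real \<Rightarrow> (nat \<Rightarrow> nat) \<Rightarrow> (nat \<Rightarrow> nat) \<Rightarrow> (nat \<Rightarrow> nat) \<Rightarrow> real" where
  "hl_coeffs q m v =
     (THE g. finite {l. g l \<noteq> 0} \<and> {l. g l \<noteq> 0} \<subseteq> partitions \<and>
        (\<forall>N x. inj_on x {..<N} \<longrightarrow>
           hl_Q q m N x * hl_Q q v N x = (\<Sum>l | g l \<noteq> 0. g l * hl_Q q l N x)))"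

text \<open>
  The sum is finite: by homogeneity only \<open>v\<close> with \<open>part_size v + part_size m = part_size l\<close>
  contribute.
\<close>

definition hl_skew_P :: "real \<Rightarrow> (nat \<Rightarrow> nat) \<Rightarrow> (nat \<Rightarrow> nat) \<Rightarrow> symfun" where
  "hl_skew_P q l m N x =
     (\<Sum>v | v \<in> partitions \<and> hl_coeffs q m v l \<noteq> 0. hl_coeffs q m v l * hl_P q v N x)"

text \<open>The value of a symmetric function at an infinite sequence of variables.\<close>

definition spec :: "symfun \<Rightarrow> (nat \<Rightarrow> real) \<Rightarrow> real" where
  "spec f x = lim (\<lambda>N. f N x)"

definition Sur :: "real \<Rightarrow> (nat \<Rightarrow> nat) \<Rightarrow> (nat \<Rightarrow> nat) \<Rightarrow> real" where
  "Sur p l m =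
     (let q = 1 / p in
      spec (hl_skew_P q l m) (\<lambda>i. q ^ Suc i)
        / (spec (hl_P q l) (\<lambda>i. q ^ Suc i) * spec (hl_Q q m) (\<lambda>i. q ^ i)))"

definition moment :: "real \<Rightarrow> (nat \<Rightarrow> nat) \<Rightarrow> ((nat \<Rightarrow> nat) \<Rightarrow> real) \<Rightarrow> real" where
  "moment p m \<nu> = (\<Sum>\<^sub>\<infinity>l\<in>partitions. \<nu> l * Sur p l m)"

text \<open>The infinite sum has the default value 0 unless it converges (absolutely).\<close>

definition moment_converges :: "real \<Rightarrow> (nat \<Rightarrow> nat) \<Rightarrow> ((nat \<Rightarrow> nat) \<Rightarrow> real) \<Rightarrow> bool" where
  "moment_converges p m \<nu> \<longleftrightarrow> (\<lambda>l. \<nu> l * Sur p l m) summable_on partitions"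

end

theory Submission
  imports Defs
begin

text \<open>
  Everything is expressed through the columns \<open>a k = \<lambda>'\<^sub>k\<^sub>+\<^sub>1\<close>. Swapping two adjacent exponents in a
  symmetrised monomial multiplies it by \<open>q\<close>; summing over the vertical strips gives the Pieri rule
  for elementary symmetric polynomials with coefficients that are products of q-binomials over
  the columns. By triangularity, this rule shows that the structure constants exist. By the q-binomial
  theorem, inverting it column by column gives the expansion of \<open>P\<^sub>\<mu> h\<^sub>r\<close>, and since
  \<open>h\<^sub>r = \<Sum>\<^sub>\<nu> q\<^bsup>n(\<nu>)\<^esup> P\<^sub>\<nu>\<close> has exactly the coefficients occurring in the principal
  specialisation of \<open>P\<^sub>\<nu>\<close>, one obtains
  \<open>|Sur(\<lambda>, \<mu>)| = \<Prod>\<^sub>i q\<^bsup>-\<lambda>'\<^sub>i \<mu>'\<^sub>i\<^esup> (q;q)\<^bsub>\<lambda>'\<^sub>i - \<mu>'\<^sub>i\<^sub>+\<^sub>1\<^esub> / (q;q)\<^bsub>\<lambda>'\<^sub>i - \<mu>'\<^sub>i\<^esub>\<close>.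

  The moment is then a sum over chains \<open>\<lambda>'\<^sub>1 \<ge> \<lambda>'\<^sub>2 \<ge> \<dots>\<close> whose summand only couples neighbours, and
  it is evaluated from the last column to the first: by a q-Vandermonde sum for the columns beyond
  \<open>n\<close>, and for the first \<open>n\<close> columns by the evaluation at \<open>-q\<close> of the Rogers--Szego polynomials.
\<close>

section \<open>Partitions and conjugation\<close>

text \<open>The Hall-Littlewood functions are given only by a symmetrisation with denominators, at
  pairwise distinct points, and the structure constants only by a definite description. So existence
  (products stay in the span) and uniqueness (linear independence) must be settled before a
  structure constant can be used at all. Individual values are never computed: the skew function
  enters only through its value at \<open>q, q^2, ...\<close>, which needs one weighted sum of
  structure constants, and this sum is a coefficient of the product with \<open>h_r\<close>. The
  polynomials \<open>h_r\<close> are not defined separately either; they arise as the dual Pieri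
  operator applied to the empty partition. The summation over the columns closes up because the
  numerator of the surjection count in one column cancels a denominator left by the next column.
  Beyond \<open>n\<close> and the support of the conjugate of \<open>\<mu>\<close> the columns never
  end, so the backward recursion has no starting point; there the closed form is identified as the
  limit of truncated sums.\<close>

definition conjugate :: "(nat \<Rightarrow> nat) \<Rightarrow> nat \<Rightarrow> nat" where
  "conjugate l k = part_conj l (Suc k)"

lemma partitionsD:
  assumes "l \<in> partitions" shows "antimono l" "finite {i. l i \<noteq> 0}"
  using assms by (auto simp: partitions_def)

lemma partitions_mono: "l \<in> partitions \<Longrightarrow> i \<le> j \<Longrightarrow> l j \<le> l i"
  by (auto simp: partitions_def antimono_def)

lemma partitionsI:
  assumes "\<And>k. l (Suc k) \<le> l k" and "\<And>k. k \<ge> L \<Longrightarrow> l k = 0"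
  shows "l \<in> partitions"
proof -
  have "i < L" if "l i \<noteq> 0" for i using assms(2)[of i] that by (cases "L \<le> i") auto
  then have "{i. l i \<noteq> 0} \<subseteq> {..<L}" by auto
  moreover have "antimono l" using assms(1) by (simp add: decseq_Suc_iff)
  ultimately show ?thesis by (auto simp: partitions_def intro: finite_subset)
qed

lemma partitions_bound:
  assumes "l \<in> partitions" obtains L where "\<And>i. i \<ge> L \<Longrightarrow> l i = 0"
proof -
  obtain L where "\<forall>i\<in>{i. l i \<noteq> 0}. i < L" using partitionsD(2)[OF assms] finite_nat_set_iff_bounded by blast
  then show ?thesis using that[of L] by fastforce
qed

lemma down_closed_eq_lessThan:
  fixes S :: "nat set"
  assumes "finite S" "\<And>i j. i \<in> S \<Longrightarrow> j < i \<Longrightarrow> j \<in> S"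
  shows "S = {..<card S}"
proof -
  obtain m where m: "m \<notin> S" "\<And>j. j < m \<Longrightarrow> j \<in> S"
    using exists_least_iff[of "\<lambda>m. m \<notin> S"] assms(1) infinite_UNIV_nat
    by (metis ex_new_if_finite)
  have "S = {..<m}" using m assms(2) by (metis lessThan_iff linorder_neqE_nat subset_antisym subsetI)
  then show ?thesis by simp
qed

text \<open>Both sides say that the cell in row \<open>i\<close> and column \<open>k\<close> lies in
  the Young diagram. The later facts on conjugates are read off from this relation.\<close>

lemma less_conjugate_iff:
  assumes "l \<in> partitions" shows "i < conjugate l k \<longleftrightarrow> k < l i"
proof -
  have "finite {j. l j \<ge> Suc k}"
    by (rule finite_subset[OF _ partitionsD(2)[OF assms]]) auto
  moreover have "i \<in> {j. l j \<ge> Suc k} \<Longrightarrow> j < i \<Longrightarrow> j \<in> {j. l j \<ge> Suc k}" for i j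
    using partitions_mono[OF assms, of j i] by simp
  ultimately have "{j. l j \<ge> Suc k} = {..<conjugate l k}"
    unfolding conjugate_def part_conj_def by (rule down_closed_eq_lessThan)
  then have "i \<in> {j. l j \<ge> Suc k} \<longleftrightarrow> i \<in> {..<conjugate l k}" by simp
  then show ?thesis by (simp add: Suc_le_eq)
qed

lemma eq_conjugateI:
  assumes "l \<in> partitions" "\<And>i k. i < a k \<longleftrightarrow> k < l i" shows "a = conjugate l"
proof
  fix k show "a k = conjugate l k"
    using less_conjugate_iff[OF assms(1), of _ k] assms(2)[of _ k] by (metis linorder_neqE_nat less_irrefl)
qed

lemma conjugate_zero_iff: "l \<in> partitions \<Longrightarrow> conjugate l k = 0 \<longleftrightarrow> l 0 \<le> k"
  using less_conjugate_iff[of l 0 k] by auto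

lemma conjugate_partitions [simp]:
  assumes "l \<in> partitions" shows "conjugate l \<in> partitions"
proof (rule partitionsI[where L = "l 0"])
  fix k show "conjugate l (Suc k) \<le> conjugate l k"
    using less_conjugate_iff[OF assms] by (metis Suc_lessD leI less_irrefl)
qed (simp add: conjugate_zero_iff assms)

lemma conjugate_conjugate [simp]: "l \<in> partitions \<Longrightarrow> conjugate (conjugate l) = l"
  by (rule eq_conjugateI[symmetric]) (auto simp: less_conjugate_iff)

lemma bij_betw_conjugate: "bij_betw conjugate partitions partitions"
  by (rule bij_betw_byWitness[where f' = conjugate]) auto

lemma part_conj_eq: "i \<ge> 1 \<Longrightarrow> part_conj l i = conjugate l (i - 1)"
  by (simp add: conjugate_def)

lemma part_len_eq: "part_len l = conjugate l 0"
  by (simp add: part_len_def conjugate_def part_conj_def Suc_le_eq)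

lemma part_mult_Suc: "part_mult l (Suc k) = conjugate l k - conjugate l (Suc k)"
  by (simp add: part_mult_def conjugate_def)

lemma part_size_eq:
  assumes "\<And>i. i \<ge> L \<Longrightarrow> l i = 0" shows "part_size l = (\<Sum>i<L. l i)"
proof -
  have "i < L" if "l i \<noteq> 0" for i using assms[of i] that by (cases "L \<le> i") auto
  then show ?thesis unfolding part_size_def by (intro sum.mono_neutral_left) auto
qed

text \<open>Cells of the diagram, each weighted by a function of its row, are counted by rows and by
  columns. Weight \<open>1\<close> gives the size, weight \<open>i\<close> the two formulas for
  \<open>n(\<lambda>)\<close>.\<close>

lemma sum_conjugate:
  fixes f :: "nat \<Rightarrow> nat"
  assumes l: "l \<in> partitions" and L: "\<And>i. i \<ge> L \<Longrightarrow> l i = 0" and K: "l 0 \<le> K"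
  shows "(\<Sum>i<L. l i * f i) = (\<Sum>k<K. \<Sum>i<conjugate l k. f i)"
proof -
  have "(\<Sum>i<L. l i * f i) = (\<Sum>i<L. \<Sum>k | k < K \<and> k < l i. f i)"
  proof (rule sum.cong)
    fix i
    have "{k. k < K \<and> k < l i} = {..<l i}" using partitions_mono[OF l, of 0 i] K by auto
    then show "l i * f i = (\<Sum>k | k < K \<and> k < l i. f i)" by simp
  qed simp
  also have "\<dots> = (\<Sum>k<K. \<Sum>i | i < L \<and> k < l i. f i)"
    using sum.swap_restrict[of "{..<L}" "{..<K}" "\<lambda>i k. f i" "\<lambda>i k. k < l i"] by simp
  also have "\<dots> = (\<Sum>k<K. \<Sum>i<conjugate l k. f i)"
  proof (rule sum.cong)
    fix k
    have L': "i < L" if "k < l i" for i using L[of i] that by (cases "L \<le> i") auto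
    have "{i. i < L \<and> k < l i} = {..<conjugate l k}"
      using L' by (auto simp: less_conjugate_iff[OF l])
    then show "(\<Sum>i | i < L \<and> k < l i. f i) = (\<Sum>i<conjugate l k. f i)" by simp
  qed simp
  finally show ?thesis .
qed

lemma part_size_conjugate [simp]:
  assumes "l \<in> partitions" shows "part_size (conjugate l) = part_size l"
proof -
  obtain L where L: "\<And>i. i \<ge> L \<Longrightarrow> l i = 0" using partitions_bound[OF assms] by blast
  have "part_size l = (\<Sum>k<l 0. conjugate l k)"
    using sum_conjugate[OF assms L order_refl, where f = "\<lambda>_. 1"] part_size_eq[OF L] by simp
  then show ?thesis using part_size_eq[of "l 0" "conjugate l"] by (simp add: conjugate_zero_iff assms)
qed

lemma part_n_eq:
  assumes "l \<in> partitions" "\<And>k. k \<ge> K \<Longrightarrow> conjugate l k = 0"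
  shows "part_n l = (\<Sum>k<K. conjugate l k choose 2)"
proof -
  have "part_n l = (\<Sum>k<l 0. conjugate l k choose 2)"
    unfolding part_n_def by (rule sum.reindex_bij_witness[of _ Suc "\<lambda>i. i - 1"]) (auto simp: part_conj_eq)
  also have "\<dots> = (\<Sum>k<K. conjugate l k choose 2)"
    by (rule sum.mono_neutral_cong)
      (use assms in \<open>auto simp: not_less conjugate_zero_iff[symmetric] binomial_eq_0\<close>)
  finally show ?thesis .
qed

text \<open>The row form of \<open>n(\<lambda>)\<close> is the exponent of \<open>q\<close> that the
  leading monomial takes at the geometric point \<open>x i = q ^ i\<close>.\<close>

lemma part_n_eq_weighted:
  assumes "l \<in> partitions" "\<And>i. i \<ge> L \<Longrightarrow> l i = 0"
  shows "part_n l = (\<Sum>i<L. l i * i)"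
proof -
  have "(\<Sum>i<m. i) = m choose 2" for m :: nat
    by (induction m) (simp_all add: numeral_2_eq_2)
  then show ?thesis
    using sum_conjugate[OF assms order_refl, where f = "\<lambda>i. i"] part_n_eq[OF assms(1), of "l 0"]
    by (simp add: conjugate_zero_iff assms)
qed

section \<open>Partitions of fixed size, and products over all columns\<close>

definition partitions_of :: "nat \<Rightarrow> (nat \<Rightarrow> nat) set" where
  "partitions_of s = {a \<in> partitions. part_size a = s}"

lemma finite_partitions_of [simp]: "finite (partitions_of s)"
proof -
  \<comment> \<open>A partition of \<open>s\<close> has at most \<open>s\<close> nonzero entries,
    and each of them is at most \<open>s\<close>.\<close>
  have "{a \<in> partitions. part_size a = s} \<subseteq> {f. \<forall>i. (i \<in> {..<s} \<longrightarrow> f i \<in> {..s}) \<and> (i \<notin> {..<s} \<longrightarrow> f i = 0)}"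
  proof (rule subsetI, elim CollectE conjE, intro CollectI allI conjI impI)
    fix a assume a: "a \<in> partitions" "part_size a = s"
    obtain L where L: "\<And>i. i \<ge> L \<Longrightarrow> a i = 0" using partitions_bound[OF a(1)] by blast
    have *: "(\<Sum>i\<in>I. a i) \<le> part_size a" if "finite I" for I
    proof -
      have "(\<Sum>i\<in>I. a i) \<le> (\<Sum>i\<in>I \<union> {..<L}. a i)" by (rule sum_mono2) (use that in auto)
      also have "\<dots> = (\<Sum>i<L. a i)"
        by (rule sum.mono_neutral_right) (use that L in \<open>auto simp: not_less\<close>)
      finally show ?thesis using part_size_eq[OF L] by simp
    qed
    show "a i \<in> {..s}" for i using *[of "{i}"] a(2) by simp
    fix i assume "i \<notin> {..<s}"
    then have "part_size a \<le> i" using a(2) by simp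
    show "a i = 0"
    proof (rule ccontr)
      assume "a i \<noteq> 0"
      then have "1 \<le> a j" if "j \<le> i" for j using partitions_mono[OF a(1) that] by simp
      then have "(\<Sum>j\<le>i. 1) \<le> (\<Sum>j\<le>i. a j)" by (intro sum_mono) auto
      then show False using *[of "{..i}"] \<open>part_size a \<le> i\<close> by simp
    qed
  qed
  then show ?thesis
    unfolding partitions_of_def by (rule finite_subset) (intro finite_set_of_finite_funs finite_lessThan finite_atMost)
qed

text \<open>A product over all columns whose factors are eventually \<open>1\<close>, so that
  coefficients carry no length bound. With infinitely many factors other than \<open>1\<close> it
  takes the default value \<open>1\<close>.\<close>

definition fprod :: "(nat \<Rightarrow> real) \<Rightarrow> real" where
  "fprod f = prod f {i. f i \<noteq> 1}"

lemma fprod_eq: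
  assumes "\<And>i. i \<ge> L \<Longrightarrow> f i = 1" shows "fprod f = (\<Prod>i<L. f i)"
proof -
  have "i < L" if "f i \<noteq> 1" for i using assms[of i] that by (cases "L \<le> i") auto
  then show ?thesis unfolding fprod_def by (intro prod.mono_neutral_left) auto
qed

lemma fprod_Suc:
  assumes "\<And>i. i \<ge> L \<Longrightarrow> f i = 1" shows "fprod f = f 0 * fprod (\<lambda>i. f (Suc i))"
  using fprod_eq[of "Suc L" f] fprod_eq[of L "\<lambda>i. f (Suc i)"] assms
  by (simp add: prod.lessThan_Suc_shift del: prod.lessThan_Suc)

lemma part_b_eq:
  assumes "l \<in> partitions"
  shows "part_b q l = fprod (\<lambda>k. qpoch q q (conjugate l k - conjugate l (Suc k)))"
proof -
  have "conjugate l k = 0" if "k \<ge> l 0" for k using that assms by (simp add: conjugate_zero_iff)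
  then have "fprod (\<lambda>k. qpoch q q (conjugate l k - conjugate l (Suc k)))
    = (\<Prod>k<l 0. qpoch q q (conjugate l k - conjugate l (Suc k)))"
    by (intro fprod_eq) (simp add: qpoch_def)
  also have "\<dots> = part_b q l"
    unfolding part_b_def
    by (rule prod.reindex_bij_witness[of _ "\<lambda>i. i - 1" Suc]) (auto simp: part_mult_Suc[symmetric])
  finally show ?thesis by simp
qed

section \<open>q-series identities\<close>

lemma qpoch_0 [simp]: "qpoch x q 0 = 1"
  by (simp add: qpoch_def)

lemma qpoch_Suc: "qpoch x q (Suc m) = qpoch x q m * (1 - x * q ^ m)"
  by (simp add: qpoch_def)

lemma qpoch_eq: "qpoch x q m = (\<Prod>i<m. 1 - x * q ^ i)"
  by (induction m) (simp_all add: qpoch_Suc)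

lemma qbinom_zero [simp]: "k > m \<Longrightarrow> qbinom q m k = 0"
  by (simp add: qbinom_def)

locale q_param =
  fixes q :: real
  assumes q_pos: "0 < q" and q_less_1: "q < 1"
begin

abbreviation qq :: "nat \<Rightarrow> real" where "qq m \<equiv> qpoch q q m"

lemma qq_Suc: "qq (Suc m) = qq m * (1 - q ^ Suc m)"
  by (simp add: qpoch_Suc)

lemma q_power_less_1: "m > 0 \<Longrightarrow> q ^ m < 1"
  using q_pos q_less_1 by (simp add: power_less_one_iff)

lemma qq_pos [simp]: "qq m > 0"
  by (induction m) (use q_power_less_1 in \<open>auto simp: qq_Suc simp del: power_Suc\<close>)

lemma qq_nonzero [simp]: "qq m \<noteq> 0"
  by (metis less_irrefl qq_pos)

lemma q_power_neq_1 [simp]: "q * q ^ m \<noteq> 1"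
  using q_power_less_1[of "Suc m"] by simp

lemma qbinom_0 [simp]: "qbinom q m 0 = 1" and qbinom_self [simp]: "qbinom q m m = 1"
  by (simp_all add: qbinom_def)

lemma qbinom_nonneg: "qbinom q m k \<ge> 0"
  by (simp add: qbinom_def less_imp_le)

lemma qbinom_Suc_Suc: "qbinom q (Suc m) (Suc k) = qbinom q m (Suc k) + q ^ (m - k) * qbinom q m k"
proof (cases "k < m")
  case True
  then obtain j where j: "m = k + Suc j" by (metis less_iff_Suc_add add_Suc_right)
  have 1: "qq (Suc m) = qq m * (1 - q ^ Suc j * q ^ Suc k)"
    by (simp add: qq_Suc j power_add)
  show ?thesis
    by (simp add: qbinom_def 1 del: power_Suc) (simp add: j qq_Suc divide_simps del: power_Suc, simp add: algebra_simps)
next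
  case False then show ?thesis by (cases "k = m") auto
qed

lemma qbinom_Suc_Suc': "qbinom q (Suc m) (Suc k) = qbinom q m k + q ^ Suc k * qbinom q m (Suc k)"
proof (cases "k < m")
  case True
  then obtain j where j: "m = k + Suc j" by (metis less_iff_Suc_add add_Suc_right)
  have 1: "qq (Suc m) = qq m * (1 - q ^ Suc j * q ^ Suc k)"
    by (simp add: qq_Suc j power_add)
  show ?thesis
    by (simp add: qbinom_def 1 del: power_Suc) (simp add: j qq_Suc divide_simps del: power_Suc, simp add: algebra_simps)
next
  case False then show ?thesis by (cases "k = m") auto
qed

lemma choose_two_Suc: "Suc k choose 2 = (k choose 2) + k"
  by (simp add: numeral_2_eq_2)

lemma choose_two_add: "(x + y) choose 2 = (x choose 2) + (y choose 2) + x * y" for x y :: nat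
  by (induction y) (simp_all add: numeral_2_eq_2)

lemma square_eq_choose_two: "x * x = 2 * (x choose 2) + x" for x :: nat
  by (induction x) (simp_all add: numeral_2_eq_2)

theorem q_binomial: "(\<Sum>k\<le>m. q ^ (k choose 2) * qbinom q m k * z ^ k) = (\<Prod>i<m. 1 + z * q ^ i)"
proof (induction m)
  case (Suc m)
  let ?f = "\<lambda>m k. q ^ (k choose 2) * qbinom q m k * z ^ k"
  have *: "?f (Suc m) (Suc k) = ?f m (Suc k) + z * q ^ m * ?f m k" if "k \<le> m" for k
  proof -
    have "q ^ m = q ^ (m - k) * q ^ k" using that by (simp flip: power_add)
    then show ?thesis by (simp add: qbinom_Suc_Suc choose_two_Suc power_add algebra_simps)
  qed
  have "(\<Sum>k\<le>Suc m. ?f (Suc m) k) = 1 + (\<Sum>k\<le>m. ?f m (Suc k) + z * q ^ m * ?f m k)"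
    using * by (subst sum.atMost_Suc_shift) (simp add: numeral_2_eq_2)
  also have "\<dots> = (\<Sum>k\<le>Suc m. ?f m k) + z * q ^ m * (\<Sum>k\<le>m. ?f m k)"
    by (subst sum.atMost_Suc_shift[of "?f m"]) (simp add: sum.distrib sum_distrib_left numeral_2_eq_2)
  also have "(\<Sum>k\<le>Suc m. ?f m k) = (\<Sum>k\<le>m. ?f m k)" by simp
  finally show ?case using Suc by (simp add: algebra_simps)
qed (simp add: numeral_2_eq_2)

lemma alternating_qbinom_sum:
  "(\<Sum>k\<le>m. (-1) ^ k * q ^ (k choose 2) * qbinom q m k) = (if m = 0 then 1 else 0)"
proof -
  have "(\<Prod>i<m. 1 + (-1) * q ^ i) = (if m = 0 then 1 else 0)"
    by (auto intro!: bexI[of _ 0])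
  then show ?thesis using q_binomial[of m "-1"] by (simp add: mult_ac)
qed

section \<open>Rogers-Szego polynomials and the one-column sums\<close>

definition rogers_szego :: "nat \<Rightarrow> real \<Rightarrow> real" where
  "rogers_szego m t = (\<Sum>k\<le>m. qbinom q m k * t ^ k)"

text \<open>Pascal's rule contributes a factor \<open>q ^ (m + 1 - k)\<close>. Written as
  \<open>1 - (1 - q ^ (m + 1 - k))\<close>, its second part is absorbed by lowering the upper index
  of the q-binomial from \<open>m + 1\<close> to \<open>m\<close>.\<close>

lemma rogers_szego_rec:
  "rogers_szego (Suc (Suc m)) t = (1 + t) * rogers_szego (Suc m) t - (1 - q ^ Suc m) * t * rogers_szego m t"
proof -
  have coeff: "qbinom q (Suc (Suc m)) (Suc k) = qbinom q (Suc m) (Suc k) + qbinom q (Suc m) k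
      - (1 - q ^ Suc m) * qbinom q m k" if "k \<le> Suc m" for k
  proof -
    have "(1 - q ^ (Suc m - k)) * qbinom q (Suc m) k = (1 - q ^ Suc m) * qbinom q m k"
    proof (cases "k \<le> m")
      case True
      then have "qq (Suc m - k) = qq (m - k) * (1 - q ^ (Suc m - k))"
        by (simp add: Suc_diff_le qq_Suc)
      moreover have "1 - q ^ (Suc m - k) \<noteq> 0" using True by (simp add: Suc_diff_le)
      ultimately show ?thesis using True
        by (simp add: qbinom_def qq_Suc divide_simps del: power_Suc)
    qed (use that in \<open>simp add: le_Suc_eq\<close>)
    then show ?thesis using qbinom_Suc_Suc[of "Suc m" k] by (simp add: algebra_simps)
  qed
  have "rogers_szego (Suc (Suc m)) t = 1 + (\<Sum>k\<le>Suc m. qbinom q (Suc (Suc m)) (Suc k) * t ^ Suc k)"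
    unfolding rogers_szego_def by (subst sum.atMost_Suc_shift) simp
  also have "\<dots> = 1 + (\<Sum>k\<le>Suc m. qbinom q (Suc m) (Suc k) * t ^ Suc k
      + t * (qbinom q (Suc m) k * t ^ k) - (1 - q ^ Suc m) * t * (qbinom q m k * t ^ k))"
    by (intro arg_cong2[where f = "(+)"] sum.cong refl, subst coeff) (simp_all add: algebra_simps)
  also have "\<dots> = (1 + (\<Sum>k\<le>Suc m. qbinom q (Suc m) (Suc k) * t ^ Suc k))
      + t * rogers_szego (Suc m) t - (1 - q ^ Suc m) * t * (\<Sum>k\<le>Suc m. qbinom q m k * t ^ k)"
    by (simp only: sum_subtractf sum.distrib sum_distrib_left rogers_szego_def)
  also have "1 + (\<Sum>k\<le>Suc m. qbinom q (Suc m) (Suc k) * t ^ Suc k) = rogers_szego (Suc m) t"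
  proof -
    have "(\<Sum>k\<le>Suc (Suc m). qbinom q (Suc m) k * t ^ k) = rogers_szego (Suc m) t"
      unfolding rogers_szego_def by simp
    then show ?thesis by (subst (asm) sum.atMost_Suc_shift) simp
  qed
  also have "(\<Sum>k\<le>Suc m. qbinom q m k * t ^ k) = rogers_szego m t"
    by (simp add: rogers_szego_def)
  finally show ?thesis by (simp add: algebra_simps)
qed

text \<open>\<open>Suc m div 2\<close> is the ceiling of \<open>m / 2\<close>, so this is the factor
  with base \<open>q^2\<close> that occurs in the densities.\<close>

definition half_qq :: "nat \<Rightarrow> real" where
  "half_qq m = qpoch q (q\<^sup>2) (Suc m div 2)"

lemma nat_ceiling_half: "nat \<lceil>real m / 2\<rceil> = Suc m div 2"
  by linarith

text \<open>At \<open>t = -q\<close> the three-term recurrence has coefficients \<open>1 - q\<close>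
  and \<open>q * (1 - q ^ (m + 1))\<close>. The product obeys the same recurrence: its new factor
  enters between \<open>m\<close> and \<open>m + 1\<close> for even \<open>m\<close>, and between
  \<open>m + 1\<close> and \<open>m + 2\<close> for odd \<open>m\<close>.\<close>

lemma half_qq_eq_rogers_szego: "half_qq m = rogers_szego m (- q)"
proof (induction m rule: induct_nat_012)
  case 0 then show ?case by (simp add: half_qq_def rogers_szego_def)
next
  case 1 then show ?case by (simp add: half_qq_def rogers_szego_def qpoch_Suc)
next
  case (ge2 m)
  have "half_qq (Suc (Suc m)) = (1 - q) * half_qq (Suc m) + q * (1 - q ^ Suc m) * half_qq m"
  proof (cases "even m")
    case True
    then obtain j where j: "m = 2 * j" by blast
    then have *: "Suc (Suc (Suc m)) div 2 = Suc j" "Suc (Suc m) div 2 = Suc j" "Suc m div 2 = j" by auto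
    have "(q\<^sup>2) ^ j = q ^ m" by (simp add: j flip: power_mult)
    then show ?thesis unfolding half_qq_def * qpoch_Suc by (simp add: algebra_simps)
  next
    case False
    then obtain j where j: "m = 2 * j + 1" by (meson oddE)
    then have *: "Suc (Suc (Suc m)) div 2 = Suc (Suc j)" "Suc (Suc m) div 2 = Suc j" "Suc m div 2 = Suc j" by auto
    have "(q\<^sup>2) ^ Suc j = q ^ Suc m" by (simp add: j power_mult power2_eq_square)
    then show ?thesis unfolding half_qq_def * qpoch_Suc[of _ _ "Suc j"] by (simp add: algebra_simps del: power_Suc)
  qed
  then show ?case unfolding rogers_szego_rec ge2 by (simp add: algebra_simps)
qed

lemma half_qq_nonneg: "half_qq m \<ge> 0"
proof -
  have "q * (q\<^sup>2) ^ i \<le> 1" for i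
    using q_pos q_less_1 by (simp add: mult_le_one power_le_one)
  then show ?thesis by (auto simp: half_qq_def qpoch_eq intro!: prod_nonneg)
qed

text \<open>Expanding \<open>half_qq\<close> as a Rogers-Szego sum and collecting the terms with
  \<open>k + i = j\<close> leaves an alternating q-binomial sum, which vanishes unless
  \<open>j = 0\<close>. This is the sum over one of the first \<open>n\<close> columns; its value
  \<open>1\<close> is why such a column contributes nothing but a power of \<open>q\<close>.\<close>

lemma sum_half_qq: "(\<Sum>k\<le>m. q ^ (Suc k choose 2) * qbinom q m k * half_qq (m - k)) = 1"
proof -
  let ?g = "\<lambda>k i. q ^ (Suc k choose 2) * qbinom q m k * (qbinom q (m - k) i * (-q) ^ i)"
  have "(\<Sum>k\<le>m. q ^ (Suc k choose 2) * qbinom q m k * half_qq (m - k)) = (\<Sum>k\<le>m. \<Sum>i\<le>m - k. ?g k i)"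
    by (simp add: half_qq_eq_rogers_szego rogers_szego_def sum_distrib_left)
  also have "\<dots> = (\<Sum>(k,i)\<in>(SIGMA k:{..m}. {..m - k}). ?g k i)"
    by (simp add: sum.Sigma)
  also have "(SIGMA k:{..m}. {..m - k}) = {(k,i). k + i \<le> m}" by auto
  also have "(\<Sum>(k,i)\<in>{(k,i). k + i \<le> m}. ?g k i) = (\<Sum>j\<le>m. \<Sum>k\<le>j. ?g k (j - k))"
    by (rule sum.triangle_reindex_eq)
  also have "\<dots> = (\<Sum>j\<le>m. qbinom q m j * (-q) ^ j * (\<Sum>k\<le>j. (-1) ^ k * q ^ (k choose 2) * qbinom q j k))"
  proof (intro sum.cong refl, unfold sum_distrib_left, intro sum.cong refl)
    fix j k assume jk: "j \<in> {..m}" "k \<in> {..j}"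
    then have 1: "qbinom q m k * qbinom q (m - k) (j - k) = qbinom q m j * qbinom q j k"
      by (simp add: qbinom_def)
    have 2: "(-q) ^ j * (-1) ^ k = (-q) ^ (j - k) * q ^ k"
    proof -
      have "(-q) ^ j = (-q) ^ (j - k) * (-q) ^ k" using jk by (simp flip: power_add)
      then show ?thesis by (simp add: power_minus[of q k] power_mult_distrib flip: power_add)
    qed
    have "?g k (j - k) = q ^ (k choose 2) * (qbinom q m k * qbinom q (m - k) (j - k)) * ((-q) ^ (j - k) * q ^ k)"
      by (simp add: choose_two_Suc power_add)
    then show "?g k (j - k) = qbinom q m j * (-q) ^ j * ((-1) ^ k * q ^ (k choose 2) * qbinom q j k)"
      unfolding 1 2[symmetric] by simp
  qed
  also have "\<dots> = (\<Sum>j\<le>m. if j = 0 then 1 else 0)"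
    by (intro sum.cong refl) (simp add: alternating_qbinom_sum)
  finally show ?thesis by simp
qed

text \<open>The limit for large \<open>B\<close> of the q-Vandermonde sum over \<open>k\<close> of
  \<open>q ^ (k * (k + s)) * [A, k] * [B, k + s]\<close>, whose value is
  \<open>[A + B, A + s]\<close>. One Pascal step trades \<open>A + 1, s\<close> for
  \<open>A, s + 1\<close>, hence the induction with \<open>s\<close> arbitrary.\<close>

lemma q_vandermonde:
  "(\<Sum>k\<le>A. q ^ (k * (k + s)) * qbinom q A k / qq (s + k)) = 1 / qq (A + s)"
proof (induction A arbitrary: s)
  case (Suc A)
  let ?f = "\<lambda>A s k. q ^ (k * (k + s)) * qbinom q A k / qq (s + k)"
  let ?g = "\<lambda>k. q ^ (k * (k + Suc s)) * qbinom q A k / qq (s + k)"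
  let ?h = "\<lambda>k. q ^ Suc s * (q ^ (k * (k + s + 2)) * qbinom q A k / qq (Suc s + k))"
  have 1: "?f (Suc A) s (Suc k) = ?g (Suc k) + ?h k" for k
  proof -
    have "Suc k * (Suc k + s) = Suc s + k * (k + s + 2)" "Suc k * (Suc k + Suc s) = Suc k * (Suc k + s) + Suc k"
      by simp_all
    then show ?thesis unfolding qbinom_Suc_Suc'
      by (simp only: power_add add_divide_distrib distrib_left distrib_right) (simp add: mult_ac)
  qed
  \<comment> \<open>Putting \<open>1 / qq (s + k)\<close> over the next denominator produces a
    subtracted term that is exactly \<open>?h k\<close>.\<close>
  have 2: "?g k + ?h k = ?f A (Suc s) k" for k
  proof -
    have "1 / qq (s + k) = (1 - q ^ (s + k + 1)) / qq (Suc s + k)"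
      by (simp add: qq_Suc)
    then have "?g k = q ^ (k * (k + Suc s)) * qbinom q A k * ((1 - q ^ (s + k + 1)) / qq (Suc s + k))"
      by (metis times_divide_eq_right mult.right_neutral)
    then show ?thesis
      by (simp add: algebra_simps power_add add_divide_distrib[symmetric] diff_divide_distrib)
  qed
  have "(\<Sum>k\<le>Suc A. ?f (Suc A) s k) = ?g 0 + (\<Sum>k\<le>A. ?g (Suc k) + ?h k)"
    by (subst sum.atMost_Suc_shift) (simp only: 1, simp)
  also have "\<dots> = (\<Sum>k\<le>Suc A. ?g k) + (\<Sum>k\<le>A. ?h k)"
    by (subst sum.atMost_Suc_shift[of ?g]) (simp add: sum.distrib)
  also have "(\<Sum>k\<le>Suc A. ?g k) = (\<Sum>k\<le>A. ?g k)" by simp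
  finally have "(\<Sum>k\<le>Suc A. ?f (Suc A) s k) = (\<Sum>k\<le>A. ?f A (Suc s) k)"
    by (simp only: sum.distrib[symmetric] 2)
  then show ?case using Suc[of "Suc s"] by simp
qed simp

section \<open>Infinite products and Euler's sum\<close>

lemma convergent_prod_one_minus:
  fixes x r :: real
  assumes "0 < r" "r < 1" shows "convergent_prod (\<lambda>i. 1 - x * r ^ i)"
proof -
  have "summable (\<lambda>i. norm ((1 - x * r ^ i) - 1))"
    using assms by (simp add: abs_mult power_abs summable_mult summable_geometric)
  then show ?thesis
    using abs_convergent_prod_conv_summable abs_convergent_prod_imp_convergent_prod by blast
qed

lemma qpoch_tendsto:
  assumes "0 < r" "r < 1" shows "(\<lambda>m. qpoch x r m) \<longlonglongrightarrow> qpoch_inf x r"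
proof -
  have "(\<lambda>m. \<Prod>i\<le>m. 1 - x * r ^ i) \<longlonglongrightarrow> qpoch_inf x r"
    unfolding qpoch_inf_def by (rule convergent_prod_LIMSEQ[OF convergent_prod_one_minus[OF assms]])
  then have "(\<lambda>m. qpoch x r (Suc m)) \<longlonglongrightarrow> qpoch_inf x r"
    by (simp add: qpoch_eq lessThan_Suc_atMost)
  then show ?thesis by (rule LIMSEQ_imp_Suc)
qed

lemma qpoch_inf_self_nonzero:
  fixes r :: real
  assumes "0 < r" "r < 1" shows "qpoch_inf r r \<noteq> 0"
proof -
  have "1 - r * r ^ i \<noteq> 0" for i
    using power_less_one_iff[of r "Suc i"] assms by simp
  then show ?thesis
    unfolding qpoch_inf_def by (intro prodinf_nonzero convergent_prod_one_minus assms) auto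
qed

lemma qpoch_inf_q_nonzero [simp]: "qpoch_inf q q \<noteq> 0"
  using qpoch_inf_self_nonzero q_pos q_less_1 by simp

lemma qq_tendsto: "qq \<longlonglongrightarrow> qpoch_inf q q"
  using qpoch_tendsto q_pos q_less_1 by simp

lemma qq_ratio_tendsto: "(\<lambda>N. qq N / qq (N - k)) \<longlonglongrightarrow> 1"
proof -
  have "(\<lambda>N. qq (N + k) / qq N) \<longlonglongrightarrow> qpoch_inf q q / qpoch_inf q q"
    by (intro tendsto_divide LIMSEQ_ignore_initial_segment qq_tendsto qpoch_inf_q_nonzero)
  then have "(\<lambda>N. qq (N + k) / qq (N + k - k)) \<longlonglongrightarrow> 1" by simp
  then show ?thesis by (rule LIMSEQ_offset)
qed

lemma qq_antimono: "m \<le> n \<Longrightarrow> qq n \<le> qq m"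
proof (induction n rule: dec_induct)
  case (step n)
  have "qq (Suc n) \<le> qq n * 1"
    unfolding qq_Suc using q_pos qq_pos[of n] by (intro mult_left_mono) (auto simp: less_imp_le)
  then show ?case using step by simp
qed simp

text \<open>The value is the product of all \<open>1 + q ^ (i + 1)\<close>. The q-binomial theorem
  expands its finite parts, and replacing \<open>qbinom q A k\<close> by its limit
  \<open>1 / qq k\<close> only enlarges the terms; the partial sums are thus squeezed between the
  finite products and their limit. The reciprocal of the value is the constant in
  \<open>P_inf0\<close>.\<close>

theorem euler_q_sum:
  "(\<lambda>k. q ^ (Suc k choose 2) / qq k) sums (qpoch_inf (q\<^sup>2) (q\<^sup>2) / qpoch_inf q q)"
  (is "?f sums ?e")
proof -
  let ?p = "\<lambda>A. \<Prod>i<A. 1 + q * q ^ i"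
  have p_eq: "?p A = qpoch (q\<^sup>2) (q\<^sup>2) A / qq A" for A
  proof -
    have "qpoch (q\<^sup>2) (q\<^sup>2) A = ?p A * qq A"
      unfolding qpoch_eq prod.distrib[symmetric]
      by (intro prod.cong refl) (simp add: algebra_simps power_mult_distrib power2_eq_square flip: power_mult_distrib)
    then show ?thesis by simp
  qed
  have q2: "0 < q\<^sup>2" "q\<^sup>2 < 1" using q_pos q_less_1 by (auto simp: power_less_one_iff)
  have p_lim: "?p \<longlonglongrightarrow> ?e"
    unfolding p_eq by (intro tendsto_divide qq_tendsto qpoch_tendsto q2 qpoch_inf_q_nonzero)
  have expand: "?p A = (\<Sum>k\<le>A. q ^ (Suc k choose 2) * qbinom q A k)" for A
    unfolding q_binomial[symmetric] by (simp add: choose_two_Suc power_add mult_ac)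
  have le: "?p A \<le> (\<Sum>k\<le>A. ?f k)" for A
    unfolding expand
  proof (intro sum_mono)
    fix k assume "k \<in> {..A}"
    then show "q ^ (Suc k choose 2) * qbinom q A k \<le> ?f k"
      using qq_antimono[of "A - k" A] q_pos
      by (simp add: qbinom_def divide_simps zero_less_mult_iff less_imp_le mult_left_mono)
  qed
  have ge: "(\<Sum>k\<le>K. ?f k) \<le> ?e" for K
  proof (rule LIMSEQ_le)
    show "(\<lambda>A. \<Sum>k\<le>K. ?f k * (qq A / qq (A - k))) \<longlonglongrightarrow> (\<Sum>k\<le>K. ?f k)"
    proof (intro tendsto_sum)
      fix k show "(\<lambda>A. ?f k * (qq A / qq (A - k))) \<longlonglongrightarrow> ?f k"
        using tendsto_mult[OF tendsto_const[of "?f k"] qq_ratio_tendsto[of k]] by simp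
    qed
    show "\<exists>N. \<forall>A\<ge>N. (\<Sum>k\<le>K. ?f k * (qq A / qq (A - k))) \<le> ?p A"
    proof (intro exI allI impI)
      fix A assume A: "K \<le> A"
      have "(\<Sum>k\<le>K. ?f k * (qq A / qq (A - k))) = (\<Sum>k\<le>K. q ^ (Suc k choose 2) * qbinom q A k)"
        using A by (intro sum.cong refl) (simp add: qbinom_def)
      also have "\<dots> \<le> ?p A"
        unfolding expand using A q_pos by (intro sum_mono2) (auto intro!: mult_nonneg_nonneg qbinom_nonneg)
      finally show "(\<Sum>k\<le>K. ?f k * (qq A / qq (A - k))) \<le> ?p A" .
    qed
  qed (rule p_lim)
  have "(\<lambda>K. \<Sum>k\<le>K. ?f k) \<longlonglongrightarrow> ?e"
    by (rule tendsto_sandwich[OF _ _ p_lim tendsto_const]) (use le ge in auto)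
  then show ?thesis by (simp add: sums_def_le)
qed

section \<open>Symmetrised monomials\<close>

definition hl_kernel :: "nat \<Rightarrow> (nat \<Rightarrow> real) \<Rightarrow> real" where
  "hl_kernel N y = (\<Prod>j<N. \<Prod>i<j. (y i - q * y j) / (y i - y j))"

definition hl_sum :: "nat \<Rightarrow> (nat \<Rightarrow> nat) \<Rightarrow> (nat \<Rightarrow> real) \<Rightarrow> real" where
  "hl_sum N \<alpha> x = (\<Sum>w | w permutes {..<N}. (\<Prod>i<N. x (w i) ^ \<alpha> i) * hl_kernel N (\<lambda>i. x (w i)))"

lemma hl_P_eq: "hl_P q l N x = (if part_len l \<le> N then hl_sum N l x / hl_v q N l else 0)"
  by (simp add: hl_P_def hl_sum_def hl_kernel_def)

text \<open>Exchanging two adjacent places permutes all other pairs \<open>i < j\<close> among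
  themselves and preserves their order, so only one factor of the kernel changes.\<close>

lemma hl_kernel_swap:
  assumes i: "Suc i < N"
  obtains R where "hl_kernel N y = (y i - q * y (Suc i)) / (y i - y (Suc i)) * R"
    and "hl_kernel N (y \<circ> Transposition.transpose i (Suc i)) = (y (Suc i) - q * y i) / (y (Suc i) - y i) * R"
proof -
  define P where "P = (SIGMA j:{..<N}. {..<j})"
  define s where "s = Transposition.transpose i (Suc i)"
  let ?f = "\<lambda>y (j, i). (y i - q * y j) / (y i - y j :: real)"
  have kernel: "hl_kernel N z = ?f z (Suc i, i) * (\<Prod>p\<in>P - {(Suc i, i)}. ?f z p)" for z
  proof -
    have "hl_kernel N z = (\<Prod>p\<in>P. ?f z p)"
      unfolding hl_kernel_def P_def by (subst prod.Sigma) auto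
    also have "\<dots> = ?f z (Suc i, i) * (\<Prod>p\<in>P - {(Suc i, i)}. ?f z p)"
      by (rule prod.remove) (use i in \<open>auto simp: P_def\<close>)
    finally show ?thesis .
  qed
  have "(\<Prod>p\<in>P - {(Suc i, i)}. ?f (y \<circ> s) p) = (\<Prod>p\<in>P - {(Suc i, i)}. ?f y p)"
    by (rule prod.reindex_bij_witness[of _ "map_prod s s" "map_prod s s"])
      (use i in \<open>auto simp: P_def s_def Transposition.transpose_def split: if_splits\<close>)
  then show ?thesis
    using that[of "\<Prod>p\<in>P - {(Suc i, i)}. ?f y p"] kernel[of y] kernel[of "y \<circ> s"]
    by (simp add: s_def)
qed

text \<open>The permutations \<open>w\<close> and \<open>w \<circ> s\<close> share all factors
  except those of two variables \<open>a\<close>, \<open>b\<close>. For these, exponents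
  \<open>(1, 0)\<close> symmetrise to \<open>a + b\<close> and exponents \<open>(0, 1)\<close> to
  \<open>q * (a + b)\<close>.\<close>

lemma hl_sum_swap:
  assumes i: "Suc i < N" and \<alpha>: "\<alpha> (Suc i) = Suc (\<alpha> i)" and x: "inj_on x {..<N}"
  shows "hl_sum N \<alpha> x = q * hl_sum N (\<alpha> \<circ> Transposition.transpose i (Suc i)) x"
proof -
  define s where "s = Transposition.transpose i (Suc i)"
  define F where "F \<beta> w = (\<Prod>j<N. x (w j) ^ \<beta> j) * hl_kernel N (\<lambda>j. x (w j))" for \<beta> and w :: "nat \<Rightarrow> nat"
  have s: "s permutes {..<N}" unfolding s_def by (rule permutes_swap_id) (use i in auto)
  have double: "2 * hl_sum N \<beta> x = (\<Sum>w | w permutes {..<N}. F \<beta> w + F \<beta> (w \<circ> s))" for \<beta>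
    using sum_permutations_compose_right[OF s, of "F \<beta>"]
    by (simp add: hl_sum_def F_def sum.distrib)
  have "F \<alpha> w + F \<alpha> (w \<circ> s) = q * (F (\<alpha> \<circ> s) w + F (\<alpha> \<circ> s) (w \<circ> s))" if w: "w permutes {..<N}" for w
  proof -
    define y where "y = (\<lambda>j. x (w j))"
    have "y i \<noteq> y (Suc i)"
      using inj_onD[OF x, of "w i" "w (Suc i)"] permutes_in_image[OF w] injD[OF permutes_inj[OF w], of i "Suc i"] i
      by (auto simp: y_def)
    obtain R where R: "hl_kernel N y = (y i - q * y (Suc i)) / (y i - y (Suc i)) * R"
      "hl_kernel N (y \<circ> s) = (y (Suc i) - q * y i) / (y (Suc i) - y i) * R"
      using hl_kernel_swap[OF i] unfolding s_def by metis
    define M where "M = (\<Prod>j\<in>{..<N} - {i} - {Suc i}. y j ^ \<alpha> j)"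
    have split: "(\<Prod>j<N. g j) = g i * (g (Suc i) * (\<Prod>j\<in>{..<N} - {i} - {Suc i}. g j))" for g :: "nat \<Rightarrow> real"
      using i by (simp add: prod.remove[of "{..<N}" i] prod.remove[of "{..<N} - {i}" "Suc i"])
    have si: "s i = Suc i" "s (Suc i) = i" by (simp_all add: s_def)
    have M: "(\<Prod>j\<in>{..<N} - {i} - {Suc i}. y j ^ \<alpha> (s j)) = M"
      "(\<Prod>j\<in>{..<N} - {i} - {Suc i}. y (s j) ^ \<alpha> j) = M"
      "(\<Prod>j\<in>{..<N} - {i} - {Suc i}. y (s j) ^ \<alpha> (s j)) = M"
      unfolding M_def by (intro prod.cong; simp add: s_def Transposition.transpose_def)+
    have F: "F \<beta> w = (\<Prod>j<N. y j ^ \<beta> j) * hl_kernel N y"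
      "F \<beta> (w \<circ> s) = (\<Prod>j<N. y (s j) ^ \<beta> j) * hl_kernel N (y \<circ> s)" for \<beta>
      by (simp_all add: F_def y_def o_def)
    show ?thesis
      unfolding F R split unfolding o_def M si \<alpha> M_def[symmetric] using \<open>y i \<noteq> y (Suc i)\<close>
      by (simp add: divide_simps) (simp add: algebra_simps)
  qed
  then have "2 * hl_sum N \<alpha> x = q * (2 * hl_sum N (\<alpha> \<circ> s) x)"
    unfolding double by (simp add: sum_distrib_left)
  then show ?thesis by (simp add: s_def)
qed

text \<open>By the swap rule each \<open>r\<close>-subset of the interval can be pushed to the
  initial segment at the price of \<open>q\<close> per step, and these powers add up to the
  q-binomial. The induction is Pascal's rule, by whether the top element belongs to the subset;
  \<open>T\<close> collects the elements fixed already.\<close>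

lemma block_sum:
  fixes G :: "nat set \<Rightarrow> real"
  assumes swap: "\<And>S i. a \<le> i \<Longrightarrow> Suc i < b \<Longrightarrow> i \<notin> S \<Longrightarrow> Suc i \<in> S \<Longrightarrow> G S = q * G (insert i (S - {Suc i}))"
    and "a \<le> b" and "T \<inter> {a..<b} = {}"
  shows "(\<Sum>S | S \<subseteq> {a..<b} \<and> card S = r. G (S \<union> T)) = qbinom q (b - a) r * G ({a..<a + r} \<union> T)"
  using assms(2,1,3)
proof (induction b arbitrary: r T rule: dec_induct)
  case base
  have "{S. S \<subseteq> {a..<a} \<and> card S = r} = (if r = 0 then {{}} else {})" by auto
  then show ?case by simp
next
  case (step b)
  show ?case
  proof (cases r)
    case 0
    have "{S. S \<subseteq> {a..<Suc b} \<and> card S = 0} = {{}}" by (auto dest: finite_subset)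
    then show ?thesis using 0 by simp
  next
    case (Suc r')
    let ?X = "\<lambda>r. {S. S \<subseteq> {a..<b} \<and> card S = r}"
    have fin: "finite S" if "S \<subseteq> {a..<b}" for S using that finite_subset by blast
    have "{S. S \<subseteq> {a..<Suc b} \<and> card S = r} = ?X r \<union> insert b ` ?X r'"
    proof (intro equalityI subsetI)
      fix S assume "S \<in> {S. S \<subseteq> {a..<Suc b} \<and> card S = r}"
      then have S: "S \<subseteq> {a..<Suc b}" "card S = r" "finite S" by (auto dest: finite_subset)
      show "S \<in> ?X r \<union> insert b ` ?X r'"
      proof (cases "b \<in> S")
        case True
        then have "S = insert b (S - {b})" "S - {b} \<in> ?X r'" using S Suc by (auto simp: less_Suc_eq)
        then show ?thesis by blast
      next
        case False
        then have "S \<subseteq> {a..<b}" using S by (force simp: less_Suc_eq)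
        then show ?thesis using S by simp
      qed
    next
      fix S assume "S \<in> ?X r \<union> insert b ` ?X r'"
      then show "S \<in> {S. S \<subseteq> {a..<Suc b} \<and> card S = r}"
      proof
        assume "S \<in> insert b ` ?X r'"
        then obtain S' where S': "S = insert b S'" "S' \<subseteq> {a..<b}" "card S' = r'" by auto
        moreover have "b \<notin> S'" using S' by auto
        ultimately show ?thesis using Suc step.hyps(1) fin[of S'] by auto
      qed auto
    qed
    moreover have "inj_on (insert b) (?X r')"
    proof (rule inj_onI)
      fix S S' assume "S \<in> ?X r'" "S' \<in> ?X r'" "insert b S = insert b S'"
      then show "S = S'" by (metis (no_types, lifting) atLeastLessThan_iff insert_ident less_irrefl mem_Collect_eq subsetD)
    qed
    moreover have "?X r \<inter> insert b ` ?X r' = {}" by auto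
    ultimately have "(\<Sum>S | S \<subseteq> {a..<Suc b} \<and> card S = r. G (S \<union> T))
        = (\<Sum>S\<in>?X r. G (S \<union> T)) + (\<Sum>S\<in>?X r'. G (S \<union> insert b T))"
      by (simp add: sum.union_disjoint sum.reindex)
    also have "(\<Sum>S\<in>?X r. G (S \<union> T)) = qbinom q (b - a) r * G ({a..<a + r} \<union> T)"
      by (rule step.IH) (use step.prems in auto)
    also have "(\<Sum>S\<in>?X r'. G (S \<union> insert b T)) = qbinom q (b - a) r' * G ({a..<a + r'} \<union> insert b T)"
      by (rule step.IH) (use step.prems in auto)
    also have "\<dots> = q ^ (b - a - r') * qbinom q (b - a) r' * G ({a..<a + r} \<union> T)"
    proof (cases "r' \<le> b - a")
      case True
      \<comment> \<open>The top element \<open>b\<close> moves down to the first free place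
        \<open>a + r'\<close> and pays \<open>q\<close> for each of the \<open>b - a - r'\<close>
        steps.\<close>
      have "G ({a..<a + r'} \<union> insert (a + r' + j) T) = q ^ j * G ({a..<a + r'} \<union> insert (a + r') T)"
        if "a + r' + j \<le> b" for j
        using that
      proof (induction j)
        case (Suc j)
        let ?S = "{a..<a + r'} \<union> insert (a + r' + Suc j) T"
        have "a + r' + j \<notin> T" "Suc (a + r' + j) \<notin> T" using step.prems(2) Suc.prems by auto
        then have "insert (a + r' + j) (?S - {Suc (a + r' + j)}) = {a..<a + r'} \<union> insert (a + r' + j) T"
          by auto
        moreover have "G ?S = q * G (insert (a + r' + j) (?S - {Suc (a + r' + j)}))"
          by (rule step.prems(1)) (use Suc.prems \<open>a + r' + j \<notin> T\<close> in auto)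
        ultimately show ?case using Suc by simp
      qed simp
      from this[of "b - a - r'"]
      have "G ({a..<a + r'} \<union> insert b T) = q ^ (b - a - r') * G ({a..<a + r'} \<union> insert (a + r') T)"
        using True step.hyps by simp
      moreover have "{a..<a + r'} \<union> insert (a + r') T = {a..<a + r} \<union> T" using Suc by auto
      ultimately show ?thesis by simp
    qed simp
    finally show ?thesis
      using Suc step.hyps by (simp add: Suc_diff_le qbinom_Suc_Suc algebra_simps)
  qed
qed

lemma sum_PiE_lessThan_Suc:
  fixes F :: "(nat \<Rightarrow> 'a) \<Rightarrow> real"
  shows "(\<Sum>c\<in>PiE {..<Suc j} A. F c) = (\<Sum>c\<in>PiE {..<j} A. \<Sum>r\<in>A j. F (c(j := r)))"
proof -
  have "inj_on (\<lambda>(y, g). g(j := y)) (A j \<times> PiE {..<j} A)"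
    using inj_combinator[of j "{..<j}" A] by simp
  then have "(\<Sum>c\<in>PiE {..<Suc j} A. F c) = (\<Sum>(y, g)\<in>A j \<times> PiE {..<j} A. F (g(j := y)))"
    unfolding lessThan_Suc PiE_insert_eq by (subst sum.reindex) (auto simp: case_prod_beta')
  also have "\<dots> = (\<Sum>r\<in>A j. \<Sum>c\<in>PiE {..<j} A. F (c(j := r)))"
    by (rule sum.cartesian_product[symmetric])
  finally show ?thesis by (simp add: sum.swap[of _ "A j"])
qed

text \<open>Swaps are possible only inside a block from \<open>B (Suc k)\<close> to
  \<open>B k\<close>. Each block is compressed on its own, beginning with the one of largest
  indices, so that only the number \<open>c k\<close> of chosen elements in block \<open>k\<close>
  is remembered.\<close>

lemma multi_block_sum:
  fixes G :: "nat set \<Rightarrow> real" and B :: "nat \<Rightarrow> nat"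
  assumes B: "\<And>k. B (Suc k) \<le> B k" and "B K = 0"
    and swap: "\<And>S i k. B (Suc k) \<le> i \<Longrightarrow> Suc i < B k \<Longrightarrow> i \<notin> S \<Longrightarrow> Suc i \<in> S \<Longrightarrow> G S = q * G (insert i (S - {Suc i}))"
  shows "(\<Sum>S | S \<subseteq> {..<B 0}. G S) = (\<Sum>c\<in>PiE {..<K} (\<lambda>k. {..B k - B (Suc k)}).
      (\<Prod>k<K. qbinom q (B k - B (Suc k)) (c k)) * G (\<Union>k<K. {B (Suc k)..<B (Suc k) + c k}))"
proof -
  let ?U = "\<lambda>j c. \<Union>k<j. {B (Suc k)..<B (Suc k) + c k}"
  let ?A = "\<lambda>k. {..B k - B (Suc k)}"
  have B': "B k \<le> B j" if "j \<le> k" for j k using lift_Suc_antimono_le[of B, OF B that] .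
  have block: "(\<Sum>S | S \<subseteq> {..<B j}. G (S \<union> T))
      = (\<Sum>r\<in>?A j. qbinom q (B j - B (Suc j)) r * (\<Sum>S | S \<subseteq> {..<B (Suc j)}. G (S \<union> ({B (Suc j)..<B (Suc j) + r} \<union> T))))"
    if T: "T \<inter> {..<B j} = {}" for j T
  proof -
    let ?I = "{B (Suc j)..<B j}"
    have "(\<Sum>S | S \<subseteq> {..<B j}. G (S \<union> T)) = (\<Sum>(S1, S2)\<in>{S. S \<subseteq> {..<B (Suc j)}} \<times> {S. S \<subseteq> ?I}. G (S2 \<union> (S1 \<union> T)))"
    proof (rule sum.reindex_bij_witness[of _ "\<lambda>(S1, S2). S1 \<union> S2" "\<lambda>S. (S \<inter> {..<B (Suc j)}, S \<inter> ?I)"])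
      fix S assume "S \<in> {S. S \<subseteq> {..<B j}}"
      then have "S \<inter> {..<B (Suc j)} \<union> S \<inter> ?I = S" by force
      then show "(case (S \<inter> {..<B (Suc j)}, S \<inter> ?I) of (S1, S2) \<Rightarrow> S1 \<union> S2) = S"
        "(case (S \<inter> {..<B (Suc j)}, S \<inter> ?I) of (S1, S2) \<Rightarrow> G (S2 \<union> (S1 \<union> T))) = G (S \<union> T)"
        by (auto simp: Un_assoc Un_commute) (metis Un_assoc Un_commute)
    qed (use B[of j] in force)+
    also have "\<dots> = (\<Sum>S1 | S1 \<subseteq> {..<B (Suc j)}. \<Sum>S2 | S2 \<subseteq> ?I. G (S2 \<union> (S1 \<union> T)))"
      by (rule sum.cartesian_product[symmetric])
    also have "\<dots> = (\<Sum>S1 | S1 \<subseteq> {..<B (Suc j)}. \<Sum>r\<in>?A j. qbinom q (B j - B (Suc j)) r * G ({B (Suc j)..<B (Suc j) + r} \<union> (S1 \<union> T)))"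
    proof (intro sum.cong refl)
      fix S1 assume S1: "S1 \<in> {S. S \<subseteq> {..<B (Suc j)}}"
      have "(\<Sum>S2 | S2 \<subseteq> ?I. G (S2 \<union> (S1 \<union> T))) = (\<Sum>r\<in>?A j. \<Sum>S2 | S2 \<in> {S. S \<subseteq> ?I} \<and> card S2 = r. G (S2 \<union> (S1 \<union> T)))"
      proof (rule sum.group[symmetric])
        show "card ` {S. S \<subseteq> ?I} \<subseteq> ?A j"
        proof (intro image_subsetI)
          fix S assume "S \<in> {S. S \<subseteq> ?I}"
          then have "card S \<le> card ?I" by (intro card_mono) auto
          then show "card S \<in> ?A j" by simp
        qed
      qed auto
      also have "\<dots> = (\<Sum>r\<in>?A j. qbinom q (B j - B (Suc j)) r * G ({B (Suc j)..<B (Suc j) + r} \<union> (S1 \<union> T)))"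
      proof (intro sum.cong refl)
        fix r
        have "(S1 \<union> T) \<inter> ?I = {}" using S1 T by auto
        from block_sum[OF swap[where k = j] B this, of r]
        show "(\<Sum>S2 | S2 \<in> {S. S \<subseteq> ?I} \<and> card S2 = r. G (S2 \<union> (S1 \<union> T)))
          = qbinom q (B j - B (Suc j)) r * G ({B (Suc j)..<B (Suc j) + r} \<union> (S1 \<union> T))" by simp
      qed
      finally show "(\<Sum>S2 | S2 \<subseteq> ?I. G (S2 \<union> (S1 \<union> T)))
        = (\<Sum>r\<in>?A j. qbinom q (B j - B (Suc j)) r * G ({B (Suc j)..<B (Suc j) + r} \<union> (S1 \<union> T)))" .
    qed
    also have "\<dots> = (\<Sum>r\<in>?A j. qbinom q (B j - B (Suc j)) r * (\<Sum>S | S \<subseteq> {..<B (Suc j)}. G (S \<union> ({B (Suc j)..<B (Suc j) + r} \<union> T))))"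
      by (subst sum.swap) (simp add: sum_distrib_left Un_left_commute)
    finally show ?thesis .
  qed
  have "(\<Sum>S | S \<subseteq> {..<B 0}. G S) = (\<Sum>c\<in>PiE {..<j} ?A.
      (\<Prod>k<j. qbinom q (B k - B (Suc k)) (c k)) * (\<Sum>S | S \<subseteq> {..<B j}. G (S \<union> ?U j c)))" for j
  proof (induction j)
    case (Suc j)
    have disj: "?U j c \<inter> {..<B j} = {}" for c
    proof (intro equals0I)
      fix i assume "i \<in> ?U j c \<inter> {..<B j}"
      then obtain k where "k < j" "B (Suc k) \<le> i" "i < B j" by auto
      then show False using B'[of "Suc k" j] by simp
    qed
    have upd: "(\<Prod>k<Suc j. qbinom q (B k - B (Suc k)) ((c(j := r)) k)) = qbinom q (B j - B (Suc j)) r * (\<Prod>k<j. qbinom q (B k - B (Suc k)) (c k))"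
      "?U (Suc j) (c(j := r)) = {B (Suc j)..<B (Suc j) + r} \<union> ?U j c" for c r
    proof -
      show "(\<Prod>k<Suc j. qbinom q (B k - B (Suc k)) ((c(j := r)) k)) = qbinom q (B j - B (Suc j)) r * (\<Prod>k<j. qbinom q (B k - B (Suc k)) (c k))"
        by simp
      show "?U (Suc j) (c(j := r)) = {B (Suc j)..<B (Suc j) + r} \<union> ?U j c"
        unfolding lessThan_Suc by auto
    qed
    show ?case
      unfolding Suc sum_PiE_lessThan_Suc upd block[OF disj] by (simp add: sum_distrib_left mult_ac)
  qed simp
  from this[of K] show ?thesis by (simp add: \<open>B K = 0\<close>)
qed

section \<open>The Pieri rule for elementary symmetric polynomials\<close>

definition e_poly :: "nat \<Rightarrow> symfun" where
  "e_poly r N x = (\<Sum>S | S \<subseteq> {..<N} \<and> card S = r. \<Prod>i\<in>S. x i)"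

lemma e_poly_permutes:
  assumes w: "w permutes {..<N}" shows "e_poly r N (\<lambda>i. x (w i)) = e_poly r N x"
  unfolding e_poly_def
proof (rule sum.reindex_bij_witness[of _ "\<lambda>S. inv w ` S" "\<lambda>S. w ` S"])
  have inj: "inj_on w S" for S using permutes_inj[OF w] by (auto intro: inj_on_subset)
  have inj': "inj_on (inv w) S" for S using permutes_inj[OF permutes_inv[OF w]] by (auto intro: inj_on_subset)
  fix S assume S: "S \<in> {S. S \<subseteq> {..<N} \<and> card S = r}"
  show "inv w ` w ` S = S" "w ` inv w ` S = S"
    using permutes_inverses[OF w] by (auto simp: image_image)
  show "w ` S \<in> {S. S \<subseteq> {..<N} \<and> card S = r}"
    using S permutes_in_image[OF w] by (auto simp: card_image[OF inj])
  show "inv w ` S \<in> {S. S \<subseteq> {..<N} \<and> card S = r}"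
    using S permutes_in_image[OF permutes_inv[OF w]] by (auto simp: card_image[OF inj'])
  show "(\<Prod>i\<in>w ` S. x i) = (\<Prod>i\<in>S. x (w i))"
    by (simp add: prod.reindex[OF inj])
qed

text \<open>By symmetry the elementary polynomial may be evaluated at the permuted variables inside
  the sum. The size condition is kept as a factor because \<open>multi_block_sum\<close> runs over
  all subsets; swaps preserve it.\<close>

lemma e_poly_mult_hl_sum:
  "e_poly r N x * hl_sum N \<alpha> x =
    (\<Sum>S | S \<subseteq> {..<N}. of_bool (card S = r) * hl_sum N (\<lambda>i. \<alpha> i + of_bool (i \<in> S)) x)"
proof -
  have "e_poly r N x * ((\<Prod>i<N. x (w i) ^ \<alpha> i) * hl_kernel N (\<lambda>i. x (w i)))
      = (\<Sum>S | S \<subseteq> {..<N} \<and> card S = r. (\<Prod>i<N. x (w i) ^ (\<alpha> i + of_bool (i \<in> S))) * hl_kernel N (\<lambda>i. x (w i)))"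
    if w: "w permutes {..<N}" for w
  proof -
    have "(\<Prod>i\<in>S. x (w i)) * (\<Prod>i<N. x (w i) ^ \<alpha> i) = (\<Prod>i<N. x (w i) ^ (\<alpha> i + of_bool (i \<in> S)))"
      if "S \<subseteq> {..<N}" for S
    proof -
      have "(\<Prod>i\<in>S. x (w i)) = (\<Prod>i<N. x (w i) ^ of_bool (i \<in> S))"
        by (rule prod.mono_neutral_cong_left) (use that in auto)
      then show ?thesis by (simp add: power_add prod.distrib mult.commute)
    qed
    moreover have "e_poly r N x = (\<Sum>S | S \<subseteq> {..<N} \<and> card S = r. \<Prod>i\<in>S. x (w i))"
      using e_poly_permutes[OF w, of r x] by (simp add: e_poly_def)
    ultimately show ?thesis
      by (simp add: sum_distrib_right mult.assoc[symmetric])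
  qed
  then have "e_poly r N x * hl_sum N \<alpha> x
      = (\<Sum>S | S \<subseteq> {..<N} \<and> card S = r. hl_sum N (\<lambda>i. \<alpha> i + of_bool (i \<in> S)) x)"
    unfolding hl_sum_def sum_distrib_left by (subst sum.swap) simp
  also have "\<dots> = (\<Sum>S | S \<subseteq> {..<N}. of_bool (card S = r) * hl_sum N (\<lambda>i. \<alpha> i + of_bool (i \<in> S)) x)"
    by (rule sum.mono_neutral_cong_left) auto
  finally show ?thesis .
qed

text \<open>From here on a Hall--Littlewood polynomial is indexed by the conjugate \<open>a\<close> of its partition,
  so that \<open>a k\<close> is \<open>\<lambda>'\<^sub>k\<^sub>+\<^sub>1\<close>: all coefficients factor over the columns.\<close>

definition HP :: "(nat \<Rightarrow> nat) \<Rightarrow> symfun" where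
  "HP a = hl_P q (conjugate a)"

text \<open>The symmetrised kernel of \<open>m\<close> places with equal exponents has this value,
  see \<open>hl_sum_zero\<close>.\<close>

definition vblock :: "nat \<Rightarrow> real" where
  "vblock m = qq m / (1 - q) ^ m"

lemma vblock_0 [simp]: "vblock 0 = 1"
  by (simp add: vblock_def)

lemma vblock_nonzero [simp]: "vblock m \<noteq> 0"
  using q_less_1 by (simp add: vblock_def)

lemma qbinom_vblock:
  assumes "k \<le> m" shows "qbinom q m k = vblock m / (vblock k * vblock (m - k))"
proof -
  have "(1 - q) ^ m = (1 - q) ^ k * (1 - q) ^ (m - k)" using assms by (simp flip: power_add)
  then show ?thesis using assms q_less_1 by (simp add: qbinom_def vblock_def)
qed

lemma hl_v_eq:
  assumes b: "b \<in> partitions" and M: "\<And>k. k \<ge> M \<Longrightarrow> b k = 0"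
  shows "hl_v q N (conjugate b) = vblock (N - b 0) * (\<Prod>k<M. vblock (b k - b (Suc k)))"
proof -
  have "(\<Prod>i=1..conjugate b 0. vblock (part_mult (conjugate b) i)) = (\<Prod>k<conjugate b 0. vblock (b k - b (Suc k)))"
    by (simp add: prod.atLeast1_atMost_eq part_mult_Suc b)
  also have "\<dots> = (\<Prod>k<M. vblock (b k - b (Suc k)))"
  proof (rule prod.mono_neutral_cong)
    fix k assume "k \<in> {..<conjugate b 0} - {..<M}"
    then show "vblock (b k - b (Suc k)) = 1" using M by simp
  next
    fix k assume "k \<in> {..<M} - {..<conjugate b 0}"
    then show "vblock (b k - b (Suc k)) = 1" using less_conjugate_iff[OF b, of k 0] by simp
  qed auto
  finally show ?thesis using b by (simp add: hl_v_def part_len_eq vblock_def)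
qed

lemma hl_v_nonzero: "b \<in> partitions \<Longrightarrow> hl_v q N (conjugate b) \<noteq> 0"
  using partitions_bound[of b] hl_v_eq[of b] by (metis (no_types, lifting) mult_eq_0_iff prod_zero_iff finite_lessThan vblock_nonzero)

lemma HP_eq: "a \<in> partitions \<Longrightarrow> HP a N x = (if a 0 \<le> N then hl_sum N (conjugate a) x / hl_v q N (conjugate a) else 0)"
  by (simp add: HP_def hl_P_eq part_len_eq)

text \<open>Read in rows, the inequalities mean that each row gains at most one box.\<close>

definition vstrips :: "(nat \<Rightarrow> nat) \<Rightarrow> nat \<Rightarrow> (nat \<Rightarrow> nat) set" where
  "vstrips a r = {b \<in> partitions. (\<forall>k. a k \<le> b k \<and> b (Suc k) \<le> a k) \<and> part_size b = part_size a + r}"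

text \<open>The number of variables does not enter: the rows of length zero, whose number depends on
  \<open>N\<close>, drop out against the normalising constants.\<close>

definition vs_coeff :: "(nat \<Rightarrow> nat) \<Rightarrow> (nat \<Rightarrow> nat) \<Rightarrow> real" where
  "vs_coeff a b = fprod (\<lambda>k. qbinom q (b k - b (Suc k)) (b k - a k))"

lemma finite_vstrips: "finite (vstrips a r)"
  by (rule finite_subset[OF _ finite_partitions_of]) (auto simp: vstrips_def partitions_of_def)

text \<open>The exponents \<open>conjugate a\<close> are constant on blocks of rows. Raising them on
  a subset and compressing each block gives a partition again, with q-binomials in the
  multiplicities of \<open>a\<close>; dividing by the normalising constants turns these into
  q-binomials in the multiplicities of \<open>b\<close>.\<close>

theorem e_pieri:
  assumes a: "a \<in> partitions" and x: "inj_on x {..<N}"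
  shows "e_poly r N x * HP a N x = (\<Sum>b\<in>vstrips a r. vs_coeff a b * HP b N x)"
proof (cases "a 0 \<le> N")
  case False
  have "HP b N x = 0" if "b \<in> vstrips a r" for b
  proof -
    have "a 0 \<le> b 0" "b \<in> partitions" using that by (auto simp: vstrips_def)
    then show ?thesis using False by (simp add: HP_eq)
  qed
  then show ?thesis using False a by (simp add: HP_eq)
next
  case True
  obtain K where K: "\<And>k. k \<ge> K \<Longrightarrow> a k = 0" using partitions_bound[OF a] by blast
  define l where "l = conjugate a"
  have less_l: "k < l i \<longleftrightarrow> i < a k" for i k by (simp add: l_def less_conjugate_iff a)
  \<comment> \<open>Block \<open>k\<close> consists of the rows of length \<open>k\<close>, from
    \<open>a k\<close> up to \<open>B k\<close>. Block \<open>0\<close> holds the rows of length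
    zero and ends at \<open>N\<close>, hence the shifted index.\<close>
  define B where "B k = (case k of 0 \<Rightarrow> N | Suc k \<Rightarrow> a k)" for k
  have B_simps [simp]: "B 0 = N" "B (Suc k) = a k" for k by (simp_all add: B_def)
  have B: "B (Suc k) \<le> B k" for k
    using True partitions_mono[OF a] by (cases k) auto
  have l_block: "l i = k \<longleftrightarrow> a k \<le> i" if "i < B k" for i k
  proof (cases k)
    case 0 then show ?thesis using less_l[of 0 i] by auto
  next
    case (Suc j) then show ?thesis using less_l[of j i] less_l[of k i] that by auto
  qed
  define m where "m k = B k - a k" for k
  define C where "C = PiE {..<Suc K} (\<lambda>k. {..m k})"
  define bf where "bf c = (\<lambda>k. if k < Suc K then a k + c k else 0)" for c :: "nat \<Rightarrow> nat"
  define U where "U c = (\<Union>k<Suc K. {a k..<a k + c k})" for c :: "nat \<Rightarrow> nat"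
  define G where "G S = of_bool (card S = r) * hl_sum N (\<lambda>i. l i + of_bool (i \<in> S)) x" for S
  \<comment> \<open>Vertical strips of every size that fit into \<open>N\<close> rows; the size
    \<open>r\<close> is selected at the end, through the factor in \<open>G\<close>.\<close>
  define W where "W = {b \<in> partitions. (\<forall>k. a k \<le> b k \<and> b (Suc k) \<le> a k) \<and> b 0 \<le> N}"
  have bf_le: "bf c k \<le> B k" if "c \<in> C" for c k
  proof (cases "k < Suc K")
    case True
    then have "c k \<le> B k - a k" using that by (auto simp: C_def m_def)
    then show ?thesis using True B[of k] by (simp add: bf_def)
  qed (simp add: bf_def)
  have bf: "bf c \<in> W" if c: "c \<in> C" for c
  proof -
    have 1: "a k \<le> bf c k" for k using K[of k] by (simp add: bf_def)
    have 2: "bf c (Suc k) \<le> a k" for k using bf_le[OF c, of "Suc k"] by simp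
    have "bf c \<in> partitions"
    proof (rule partitionsI[where L = "Suc K"])
      show "bf c (Suc k) \<le> bf c k" for k using 1[of k] 2[of k] by simp
    qed (simp add: bf_def)
    then show ?thesis using 1 2 bf_le[OF c, of 0] by (simp add: W_def)
  qed
  have U_less: "i < B k" if "c \<in> C" "k < Suc K" "i \<in> {a k..<a k + c k}" for c k i
    using bf_le[OF that(1), of k] that(2,3) by (simp add: bf_def)
  have conj_bf: "(\<lambda>i. l i + of_bool (i \<in> U c)) = conjugate (bf c)" if c: "c \<in> C" for c
  proof (rule eq_conjugateI)
    show "bf c \<in> partitions" using bf[OF c] by (simp add: W_def)
    fix i k
    show "(i < l k + of_bool (k \<in> U c)) = (k < bf c i)"
    proof (cases "k < a i")
      case True
      then have "i < Suc K" using K[of i] by (cases "i < K") auto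
      then show ?thesis using True less_l[of i k] by (simp add: bf_def)
    next
      case False
      then have li: "\<not> i < l k" using less_l by simp
      show ?thesis
      proof
        assume "i < l k + of_bool (k \<in> U c)"
        then have U: "k \<in> U c" and "l k = i" using li by (cases "k \<in> U c"; simp)+
        from U obtain j where j: "j < Suc K" "k \<in> {a j..<a j + c j}" by (auto simp: U_def)
        then have "l k = j" using l_block[OF U_less[OF c j]] by auto
        then show "k < bf c i" using j \<open>l k = i\<close> by (simp add: bf_def)
      next
        assume k: "k < bf c i"
        then have i: "i < Suc K" "k \<in> {a i..<a i + c i}" using False by (auto simp: bf_def split: if_splits)
        then have "l k = i" using l_block[OF U_less[OF c i]] by auto
        moreover have "k \<in> U c" using i by (auto simp: U_def)
        ultimately show "i < l k + of_bool (k \<in> U c)" by simp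
      qed
    qed
  qed
  have card_U: "card (U c) + part_size a = part_size (bf c)" if c: "c \<in> C" for c
  proof -
    have b: "bf c \<in> partitions" "bf c 0 \<le> N" using bf[OF c] by (auto simp: W_def)
    have "part_size (bf c) = part_size (conjugate (bf c))" using b by simp
    also have "\<dots> = (\<Sum>i<N. l i + of_bool (i \<in> U c))"
      unfolding conj_bf[OF c] by (rule part_size_eq) (use b in \<open>simp add: conjugate_zero_iff\<close>)
    also have "\<dots> = (\<Sum>i<N. l i) + card (U c)"
    proof -
      have "U c \<subseteq> {..<N}"
      proof
        fix i assume "i \<in> U c"
        then obtain k where "k < Suc K" "i \<in> {a k..<a k + c k}" by (auto simp: U_def)
        then have "i < B k" using U_less[OF c] by blast
        moreover have "B k \<le> B 0" by (rule lift_Suc_antimono_le[of B, OF B]) simp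
        ultimately show "i \<in> {..<N}" by simp
      qed
      then have "{..<N} \<inter> U c = U c" by auto
      then show ?thesis by (simp add: sum.distrib Int_def[symmetric])
    qed
    also have "(\<Sum>i<N. l i) = part_size l"
      by (rule part_size_eq[symmetric]) (use True in \<open>simp add: l_def conjugate_zero_iff a\<close>)
    finally show ?thesis by (simp add: l_def a)
  qed
  \<comment> \<open>The constant of \<open>a\<close> cancels all numerators. The denominators belong
    to \<open>c k = b k - a k\<close> and \<open>a k - b (k + 1)\<close>, where
    \<open>b = bf c\<close>; these add up to the multiplicity \<open>b k - b (k + 1)\<close>, whose
    factor is supplied by the constant of \<open>b\<close>.\<close>
  have coeff: "(\<Prod>k<Suc K. qbinom q (m k) (c k)) / hl_v q N (conjugate a) = vs_coeff a (bf c) / hl_v q N (conjugate (bf c))"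
    if c: "c \<in> C" for c
  proof -
    let ?b = "bf c"
    have b: "?b \<in> partitions" "\<And>k. a k \<le> ?b k" "\<And>k. ?b (Suc k) \<le> a k" "?b 0 \<le> N"
      using bf[OF c] by (auto simp: W_def)
    have b0: "?b k = 0" if "k \<ge> Suc K" for k using that by (simp add: bf_def)
    have cm: "c k \<le> m k" if "k < Suc K" for k using c that by (auto simp: C_def)
    have e1: "(\<Prod>k<Suc K. qbinom q (m k) (c k)) = (\<Prod>k<Suc K. vblock (m k)) / ((\<Prod>k<Suc K. vblock (c k)) * (\<Prod>k<Suc K. vblock (m k - c k)))"
      unfolding prod.distrib[symmetric] prod_dividef[symmetric]
      by (rule prod.cong) (use cm qbinom_vblock in auto)
    have e2: "hl_v q N (conjugate a) = (\<Prod>k<Suc K. vblock (m k))"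
      unfolding prod.lessThan_Suc_shift by (subst hl_v_eq[OF a K]) (auto simp: m_def)
    have e3: "(\<Prod>k<Suc K. vblock (m k - c k)) = vblock (N - ?b 0) * (\<Prod>k<Suc K. vblock (a k - ?b (Suc k)))"
    proof -
      have "(\<Prod>k<Suc K. vblock (a k - ?b (Suc k))) = (\<Prod>k<K. vblock (a k - ?b (Suc k)))"
        by (simp add: K)
      moreover have "m (Suc k) - c (Suc k) = a k - ?b (Suc k)" if "k < K" for k
        using that by (simp add: m_def bf_def)
      ultimately show ?thesis unfolding prod.lessThan_Suc_shift by (simp add: m_def bf_def del: prod.lessThan_Suc)
    qed
    have e4: "hl_v q N (conjugate ?b) = vblock (N - ?b 0) * (\<Prod>k<Suc K. vblock (?b k - ?b (Suc k)))"
      by (rule hl_v_eq[OF b(1) b0])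
    have e5: "vs_coeff a ?b = (\<Prod>k<Suc K. vblock (?b k - ?b (Suc k))) / ((\<Prod>k<Suc K. vblock (c k)) * (\<Prod>k<Suc K. vblock (a k - ?b (Suc k))))"
    proof -
      have "vs_coeff a ?b = (\<Prod>k<Suc K. qbinom q (?b k - ?b (Suc k)) (?b k - a k))"
        unfolding vs_coeff_def by (rule fprod_eq) (use b0 in \<open>simp add: qbinom_def\<close>)
      also have "\<dots> = (\<Prod>k<Suc K. vblock (?b k - ?b (Suc k)) / (vblock (c k) * vblock (a k - ?b (Suc k))))"
      proof (rule prod.cong)
        fix k assume k: "k \<in> {..<Suc K}"
        then have "?b k - a k = c k" by (simp add: bf_def)
        moreover have "?b k - a k \<le> ?b k - ?b (Suc k)" using b(3)[of k] by simp
        moreover have "?b k - ?b (Suc k) - (?b k - a k) = a k - ?b (Suc k)" using b(2,3)[of k] by simp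
        ultimately show "qbinom q (?b k - ?b (Suc k)) (?b k - a k) = vblock (?b k - ?b (Suc k)) / (vblock (c k) * vblock (a k - ?b (Suc k)))"
          using qbinom_vblock by metis
      qed simp
      finally show ?thesis by (simp only: prod.distrib prod_dividef)
    qed
    have alg: "Q / va = vs / vb"
      if "Q = A / (C * D)" "va = A" "D = n * E" "vb = n * F" "vs = F / (C * E)"
        "A \<noteq> 0" "C \<noteq> 0" "n \<noteq> 0" "E \<noteq> 0" "F \<noteq> 0"
      for Q va vs vb A C D n E F :: real
      using that by simp
    show ?thesis by (rule alg[OF e1 e2 e3 e4 e5]) simp_all
  qed
  have bij: "bij_betw bf C W"
  proof (rule bij_betw_byWitness[where f' = "\<lambda>b. restrict (\<lambda>k. b k - a k) {..<Suc K}"])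
    show "\<forall>c\<in>C. restrict (\<lambda>k. bf c k - a k) {..<Suc K} = c"
      by (auto simp: C_def bf_def fun_eq_iff PiE_def extensional_def)
    show "\<forall>b\<in>W. bf (restrict (\<lambda>k. b k - a k) {..<Suc K}) = b"
    proof (intro ballI ext)
      fix b k assume "b \<in> W"
      then have b: "\<And>k. a k \<le> b k" "\<And>k. b (Suc k) \<le> a k" by (auto simp: W_def)
      show "bf (restrict (\<lambda>k. b k - a k) {..<Suc K}) k = b k"
      proof (cases "k < Suc K")
        case False
        then obtain j where "k = Suc j" "j \<ge> K" by (cases k) auto
        then show ?thesis using b(2)[of j] K[of j] by (simp add: bf_def)
      qed (use b(1)[of k] in \<open>simp add: bf_def\<close>)
    qed
    show "bf ` C \<subseteq> W" using bf by blast
    show "(\<lambda>b. restrict (\<lambda>k. b k - a k) {..<Suc K}) ` W \<subseteq> C"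
    proof (intro image_subsetI)
      fix b assume "b \<in> W"
      then have b: "\<And>k. a k \<le> b k" "\<And>k. b (Suc k) \<le> a k" "b 0 \<le> N" by (auto simp: W_def)
      have "b k \<le> B k" for k using b by (cases k) auto
      then show "restrict (\<lambda>k. b k - a k) {..<Suc K} \<in> C"
        by (auto simp: C_def m_def diff_le_mono)
    qed
  qed
  have "finite W" using bij_betw_finite[OF bij] by (simp add: C_def finite_PiE)
  have "e_poly r N x * hl_sum N l x = (\<Sum>S | S \<subseteq> {..<B 0}. G S)"
    unfolding e_poly_mult_hl_sum G_def by simp
  also have "\<dots> = (\<Sum>c\<in>C. (\<Prod>k<Suc K. qbinom q (B k - B (Suc k)) (c k)) * G (\<Union>k<Suc K. {B (Suc k)..<B (Suc k) + c k}))"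
    unfolding C_def m_def B_simps(2)[symmetric]
  proof (rule multi_block_sum[of B "Suc K" G, OF B])
    show "B (Suc K) = 0" by (simp add: K)
    fix S i k assume *: "B (Suc k) \<le> i" "Suc i < B k" "i \<notin> S" "Suc i \<in> S"
    have "B k \<le> B 0" by (rule lift_Suc_antimono_le[of B, OF B]) simp
    then have "Suc i < N" using * by simp
    have li: "l i = k" "l (Suc i) = k" using l_block * by auto
    let ?S' = "insert i (S - {Suc i})"
    have "card ?S' = card S"
    proof (cases "finite S")
      case True
      then have "card ?S' = Suc (card S - 1)" using * by (simp add: card_insert_disjoint)
      moreover have "card S > 0" using True * card_gt_0_iff by blast
      ultimately show ?thesis by simp
    next
      case False then show ?thesis by (simp add: card.infinite)
    qed
    moreover have "(\<lambda>j. l j + of_bool (j \<in> S)) \<circ> Transposition.transpose i (Suc i) = (\<lambda>j. l j + of_bool (j \<in> ?S'))"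
      using li * by (auto simp: fun_eq_iff Transposition.transpose_def)
    ultimately show "G S = q * G ?S'"
      using hl_sum_swap[OF \<open>Suc i < N\<close> _ x, of "\<lambda>j. l j + of_bool (j \<in> S)"] li * by (simp add: G_def)
  qed
  also have "\<dots> = (\<Sum>c\<in>C. (\<Prod>k<Suc K. qbinom q (m k) (c k)) * G (U c))"
    by (simp only: m_def U_def B_simps)
  finally have "e_poly r N x * HP a N x = (\<Sum>c\<in>C. (\<Prod>k<Suc K. qbinom q (m k) (c k)) / hl_v q N (conjugate a) * G (U c))"
    using True a by (simp add: HP_eq l_def sum_divide_distrib del: prod.lessThan_Suc)
  also have "\<dots> = (\<Sum>c\<in>C. vs_coeff a (bf c) * (of_bool (part_size (bf c) = part_size a + r) * HP (bf c) N x))"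
  proof (intro sum.cong refl)
    fix c assume c: "c \<in> C"
    have b: "bf c \<in> partitions" "bf c 0 \<le> N" using bf[OF c] by (auto simp: W_def)
    have "card (U c) = r \<longleftrightarrow> part_size (bf c) = part_size a + r" using card_U[OF c] by linarith
    then show "(\<Prod>k<Suc K. qbinom q (m k) (c k)) / hl_v q N (conjugate a) * G (U c)
        = vs_coeff a (bf c) * (of_bool (part_size (bf c) = part_size a + r) * HP (bf c) N x)"
      unfolding coeff[OF c] G_def conj_bf[OF c] using b by (simp add: HP_eq)
  qed
  also have "\<dots> = (\<Sum>b\<in>W. vs_coeff a b * (of_bool (part_size b = part_size a + r) * HP b N x))"
    by (rule sum.reindex_bij_betw[OF bij])
  also have "\<dots> = (\<Sum>b\<in>W \<inter> vstrips a r. vs_coeff a b * HP b N x)"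
    by (rule sum.mono_neutral_cong_right) (use \<open>finite W\<close> in \<open>auto simp: vstrips_def W_def\<close>)
  also have "\<dots> = (\<Sum>b\<in>vstrips a r. vs_coeff a b * HP b N x)"
    by (rule sum.mono_neutral_left) (use finite_vstrips[of a r] in \<open>auto simp: vstrips_def W_def HP_eq\<close>)
  finally show ?thesis .
qed

end

section \<open>The constant term\<close>

text \<open>Partial fractions in \<open>z\<close>: the product tends to \<open>1\<close> at infinity
  and has simple poles at the points of \<open>A\<close>. When a pole \<open>y\<close> is added, its
  residue is rewritten by the induction hypothesis at \<open>z = y\<close>.\<close>

lemma partial_fractions_ratio:
  fixes A :: "real set"
  assumes "finite A" "z \<notin> A"
  shows "(\<Prod>a\<in>A. (z - c * a) / (z - a)) =
    1 + (\<Sum>k\<in>A. (1 - c) * k / (z - k) * (\<Prod>j\<in>A - {k}. (k - c * j) / (k - j)))"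
  using assms
proof (induction A arbitrary: z rule: finite_induct)
  case (insert y A)
  let ?C = "\<lambda>k. \<Prod>j\<in>A - {k}. (k - c * j) / (k - j)"
  let ?L = "\<lambda>z. \<Prod>a\<in>A. (z - c * a) / (z - a)"
  have C': "(\<Prod>j\<in>insert y A - {k}. (k - c * j) / (k - j)) = (k - c * y) / (k - y) * ?C k" if "k \<in> A" for k
  proof -
    have "insert y A - {k} = insert y (A - {k})" using insert.hyps that by auto
    then show ?thesis using insert.hyps by simp
  qed
  have "insert y A - {y} = A" using insert.hyps by simp
  then have "(\<Sum>k\<in>insert y A. (1 - c) * k / (z - k) * (\<Prod>j\<in>insert y A - {k}. (k - c * j) / (k - j)))
      = (1 - c) * y / (z - y) * ?L y + (\<Sum>k\<in>A. (1 - c) * k / (z - k) * ((k - c * y) / (k - y) * ?C k))"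
    using insert.hyps C' by (simp add: mult_ac)
  also have "(1 - c) * y / (z - y) * ?L y = (1 - c) * y / (z - y) +
      (\<Sum>k\<in>A. (1 - c) * y / (z - y) * ((1 - c) * k / (y - k) * ?C k))"
    using insert.IH[of y] insert.hyps by (simp add: distrib_left sum_distrib_left)
  finally have 1: "(\<Sum>k\<in>insert y A. (1 - c) * k / (z - k) * (\<Prod>j\<in>insert y A - {k}. (k - c * j) / (k - j)))
      = (1 - c) * y / (z - y) + (\<Sum>k\<in>A. (1 - c) * y / (z - y) * ((1 - c) * k / (y - k) * ?C k)
          + (1 - c) * k / (z - k) * ((k - c * y) / (k - y) * ?C k))"
    by (simp add: sum.distrib)
  have 2: "(\<Prod>a\<in>insert y A. (z - c * a) / (z - a)) = (1 + (1 - c) * y / (z - y)) * ?L z"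
    using insert by (simp add: divide_simps) (simp add: algebra_simps)
  have 3: "(1 + (1 - c) * y / (z - y)) * ((1 - c) * k / (z - k) * ?C k)
      = (1 - c) * y / (z - y) * ((1 - c) * k / (y - k) * ?C k)
          + (1 - c) * k / (z - k) * ((k - c * y) / (k - y) * ?C k)" if "k \<in> A" for k
  proof -
    have "y \<noteq> k" "z \<noteq> k" "z \<noteq> y" using that insert by auto
    then have "(1 + (1 - c) * y / (z - y)) * ((1 - c) * k / (z - k))
      = (1 - c) * y / (z - y) * ((1 - c) * k / (y - k)) + (1 - c) * k / (z - k) * ((k - c * y) / (k - y))"
      by (simp add: divide_simps) (simp add: algebra_simps)
    from arg_cong[OF this, of "\<lambda>u. u * ?C k"] show ?thesis by (simp only: distrib_right mult.assoc)
  qed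
  have "(1 + (1 - c) * y / (z - y)) * ?L z = 1 + (1 - c) * y / (z - y)
      + (\<Sum>k\<in>A. (1 + (1 - c) * y / (z - y)) * ((1 - c) * k / (z - k) * ?C k))"
    using insert by (subst insert.IH) (auto simp: distrib_left sum_distrib_left)
  also have "(\<Sum>k\<in>A. (1 + (1 - c) * y / (z - y)) * ((1 - c) * k / (z - k) * ?C k))
     = (\<Sum>k\<in>A. (1 - c) * y / (z - y) * ((1 - c) * k / (y - k) * ?C k)
          + (1 - c) * k / (z - k) * ((k - c * y) / (k - y) * ?C k))"
    using 3 by (intro sum.cong) auto
  finally show ?case unfolding 1 2 by simp
qed simp

text \<open>At \<open>z = 0\<close> every factor on the left of the partial fractions becomes
  \<open>c\<close>, and \<open>k / (z - k)\<close> becomes \<open>-1\<close>. If \<open>0\<close>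
  belongs to \<open>A\<close>, it is a pole and has to be split off.\<close>

lemma sum_prod_ratio:
  fixes A :: "real set"
  assumes A: "finite A" and c: "c \<noteq> 1"
  shows "(\<Sum>k\<in>A. \<Prod>j\<in>A - {k}. (k - c * j) / (k - j)) = (1 - c ^ card A) / (1 - c)"
proof -
  have nonzero: "(\<Sum>k\<in>A. \<Prod>j\<in>A - {k}. (k - c * j) / (k - j)) = (1 - c ^ card A) / (1 - c)"
    if "finite A" "0 \<notin> A" for A :: "real set"
  proof -
    have "(\<Prod>a\<in>A. (0 - c * a) / (0 - a)) = (\<Prod>a\<in>A. c)"
      by (rule prod.cong) (use that in auto)
    moreover have "(\<Sum>k\<in>A. (1 - c) * k / (0 - k) * (\<Prod>j\<in>A - {k}. (k - c * j) / (k - j)))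
        = (\<Sum>k\<in>A. - (1 - c) * (\<Prod>j\<in>A - {k}. (k - c * j) / (k - j)))"
      by (rule sum.cong) (use that in \<open>auto simp: divide_simps algebra_simps\<close>)
    ultimately have "c ^ card A = 1 + (\<Sum>k\<in>A. - (1 - c) * (\<Prod>j\<in>A - {k}. (k - c * j) / (k - j)))"
      using partial_fractions_ratio[OF that, of c] by (simp only: prod_constant)
    also have "\<dots> = 1 - (1 - c) * (\<Sum>k\<in>A. \<Prod>j\<in>A - {k}. (k - c * j) / (k - j))"
      unfolding sum_distrib_left[symmetric] by (simp add: left_diff_distrib)
    finally have "c ^ card A = 1 - (1 - c) * (\<Sum>k\<in>A. \<Prod>j\<in>A - {k}. (k - c * j) / (k - j))" .
    then show ?thesis using c by (simp add: divide_simps)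
  qed
  show ?thesis
  proof (cases "0 \<in> A")
    case True
    \<comment> \<open>The summand for \<open>k = 0\<close> is \<open>c ^ card A'\<close>, and in the
      other summands the factor for \<open>j = 0\<close> equals \<open>1\<close>.\<close>
    define A' where "A' = A - {0}"
    have A': "finite A'" "0 \<notin> A'" "A = insert 0 A'" using A True by (auto simp: A'_def)
    have "(\<Prod>j\<in>A'. (0 - c * j) / (0 - j)) = (\<Prod>j\<in>A'. c)"
      by (rule prod.cong) (use A' in auto)
    moreover have "(\<Prod>j\<in>A - {k}. (k - c * j) / (k - j)) = (\<Prod>j\<in>A' - {k}. (k - c * j) / (k - j))" if "k \<in> A'" for k
    proof -
      have "A - {k} = insert 0 (A' - {k})" "k \<noteq> 0" using A' that by auto
      then show ?thesis using A' by simp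
    qed
    ultimately have "(\<Sum>k\<in>A. \<Prod>j\<in>A - {k}. (k - c * j) / (k - j)) = c ^ card A' + (1 - c ^ card A') / (1 - c)"
      using A' nonzero[OF A'(1,2)] by simp
    then show ?thesis using c A' by (simp add: divide_simps) (simp add: algebra_simps)
  qed (use nonzero A in blast)
qed

context q_param
begin

lemma hl_kernel_permutes_eq:
  assumes w: "w permutes {..<N}"
  shows "hl_kernel (Suc N) (\<lambda>i. y (w i)) = hl_kernel N (\<lambda>i. y (w i)) * (\<Prod>i<N. (y i - q * y N) / (y i - y N))"
proof -
  have "w N = N" using w by (simp add: permutes_def)
  moreover have "(\<Prod>i<N. (y (w i) - q * y N) / (y (w i) - y N)) = (\<Prod>i<N. (y i - q * y N) / (y i - y N))"
    using prod.permute[OF w, of "\<lambda>i. (y i - q * y N) / (y i - y N)"] by (simp add: o_def)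
  ultimately show ?thesis by (simp add: hl_kernel_def)
qed

text \<open>The permutations are sorted by the variable \<open>b\<close> in the last place; the
  kernel splits off the factors against it. Since that variable is the second one in each factor,
  the sum over \<open>b\<close> is \<open>sum_prod_ratio\<close> with \<open>c = 1 / q\<close>, up
  to \<open>q ^ N\<close>.\<close>

theorem hl_sum_zero:
  assumes "inj_on x {..<N}" shows "hl_sum N (\<lambda>_. 0) x = vblock N"
  using assms
proof (induction N arbitrary: x)
  case 0 then show ?case by (simp add: hl_sum_def hl_kernel_def)
next
  case (Suc N)
  let ?t = "\<lambda>b. Transposition.transpose N b"
  let ?r = "\<lambda>b. \<Prod>j\<in>{..<Suc N} - {b}. (x j - q * x b) / (x j - x b)"
  have "hl_sum (Suc N) (\<lambda>_. 0) x = (\<Sum>w | w permutes insert N {..<N}. hl_kernel (Suc N) (\<lambda>i. x (w i)))"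
    by (simp add: hl_sum_def lessThan_Suc)
  also have "\<dots> = (\<Sum>b\<in>insert N {..<N}. \<Sum>w | w permutes {..<N}. hl_kernel (Suc N) (\<lambda>i. x ((?t b \<circ> w) i)))"
    by (rule sum_over_permutations_insert) auto
  also have "\<dots> = (\<Sum>b\<in>insert N {..<N}. vblock N * ?r b)"
  proof (rule sum.cong)
    fix b assume "b \<in> insert N {..<N}"
    then have b: "b < Suc N" by auto
    define y where "y = (\<lambda>i. x (?t b i))"
    have t: "?t b permutes {..<Suc N}" by (rule permutes_swap_id) (use b in auto)
    have "inj_on y {..<N}"
    proof (rule inj_onI)
      fix i j assume ij: "i \<in> {..<N}" "j \<in> {..<N}" "y i = y j"
      then have "?t b i = ?t b j"
        using inj_onD[OF Suc.prems, of "?t b i" "?t b j"] permutes_in_image[OF t] by (simp add: y_def)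
      then show "i = j" by (rule injD[OF permutes_inj[OF t]])
    qed
    have "(\<Sum>w | w permutes {..<N}. hl_kernel (Suc N) (\<lambda>i. x ((?t b \<circ> w) i)))
        = (\<Sum>w | w permutes {..<N}. hl_kernel N (\<lambda>i. y (w i)) * (\<Prod>i<N. (y i - q * y N) / (y i - y N)))"
      by (rule sum.cong) (use hl_kernel_permutes_eq[of _ N y] in \<open>auto simp: y_def\<close>)
    also have "\<dots> = hl_sum N (\<lambda>_. 0) y * (\<Prod>i<N. (y i - q * y N) / (y i - y N))"
      by (simp add: hl_sum_def sum_distrib_right)
    also have "(\<Prod>i<N. (y i - q * y N) / (y i - y N)) = ?r b"
      by (rule prod.reindex_bij_witness[of _ "?t b" "?t b"])
        (use b in \<open>auto simp: y_def Transposition.transpose_def less_Suc_eq split: if_splits\<close>)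
    finally show "(\<Sum>w | w permutes {..<N}. hl_kernel (Suc N) (\<lambda>i. x ((?t b \<circ> w) i))) = vblock N * ?r b"
      using Suc.IH[OF \<open>inj_on y {..<N}\<close>] by simp
  qed simp
  also have "\<dots> = vblock N * (\<Sum>b<Suc N. ?r b)"
    by (simp add: sum_distrib_left distrib_left lessThan_Suc)
  also have "(\<Sum>b<Suc N. ?r b) = (1 - q ^ Suc N) / (1 - q)"
  proof -
    define A where "A = x ` {..<Suc N}"
    have cardA: "card A = Suc N" "finite A" using Suc.prems by (auto simp: A_def card_image)
    have "?r b = q ^ N * (\<Prod>j\<in>A - {x b}. (x b - 1 / q * j) / (x b - j))" if "b < Suc N" for b
    proof -
      have "A - {x b} = x ` ({..<Suc N} - {b})"
        unfolding A_def using that inj_on_image_set_diff[OF Suc.prems, of "{..<Suc N}" "{b}"] by simp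
      moreover have "inj_on x ({..<Suc N} - {b})" using Suc.prems by (rule inj_on_subset) auto
      ultimately have "(\<Prod>j\<in>A - {x b}. (x b - 1 / q * j) / (x b - j))
        = (\<Prod>j\<in>{..<Suc N} - {b}. (x b - 1 / q * x j) / (x b - x j))"
        by (simp add: prod.reindex)
      moreover have "q ^ N = (\<Prod>j\<in>{..<Suc N} - {b}. q)" using that by simp
      moreover have "(x j - q * x b) / (x j - x b) = q * ((x b - 1 / q * x j) / (x b - x j))"
        if "j \<in> {..<Suc N} - {b}" for j
      proof -
        have "x j \<noteq> x b" using inj_onD[OF Suc.prems, of j b] that \<open>b < Suc N\<close> by auto
        then show ?thesis using q_pos by (simp add: divide_simps) (simp add: algebra_simps)
      qed
      ultimately show ?thesis by (simp only: prod.distrib[symmetric]) simp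
    qed
    then have "(\<Sum>b<Suc N. ?r b) = q ^ N * (\<Sum>b<Suc N. \<Prod>j\<in>A - {x b}. (x b - 1 / q * j) / (x b - j))"
      unfolding sum_distrib_left by (intro sum.cong) auto
    also have "(\<Sum>b<Suc N. \<Prod>j\<in>A - {x b}. (x b - 1 / q * j) / (x b - j)) = (\<Sum>k\<in>A. \<Prod>j\<in>A - {k}. (k - 1 / q * j) / (k - j))"
      unfolding A_def by (subst sum.reindex[OF Suc.prems]) simp
    also have "\<dots> = (1 - (1 / q) ^ Suc N) / (1 - 1 / q)"
      using sum_prod_ratio[of A "1 / q"] cardA q_pos q_less_1 by simp
    finally show ?thesis using q_pos q_less_1 by (simp add: divide_simps power_divide) (simp add: algebra_simps)
  qed
  finally show ?case by (simp add: vblock_def qq_Suc)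
qed

lemma HP_zero [simp]: "inj_on x {..<N} \<Longrightarrow> HP (\<lambda>_. 0) N x = 1"
proof -
  have z: "(\<lambda>_. 0) \<in> partitions" by (simp add: partitions_def antimono_def)
  then have "conjugate (\<lambda>_. 0) = (\<lambda>_. 0)"
    using less_conjugate_iff[OF z] by (auto simp: fun_eq_iff)
  then show "inj_on x {..<N} \<Longrightarrow> HP (\<lambda>_. 0) N x = 1"
    using HP_eq[OF z] hl_v_eq[OF z, of 0] by (simp add: hl_sum_zero)
qed

section \<open>Specialisation and linear independence\<close>

text \<open>Unless \<open>w\<close> is the identity, some value \<open>v + 1\<close> stands before
  \<open>v\<close>, and the numerator for these two places is
  \<open>c * q ^ (v + 1) - q * (c * q ^ v) = 0\<close>.\<close>

lemma hl_kernel_geometric_eq_0: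
  assumes w: "w permutes {..<N}" "w \<noteq> id"
  shows "hl_kernel N (\<lambda>i. c * q ^ w i) = 0"
proof -
  define u where "u = inv w"
  have u: "u permutes {..<N}" using permutes_inv[OF w(1)] by (simp add: u_def)
  have wu: "w (u v) = v" for v using permutes_inverses(1)[OF w(1)] by (simp add: u_def)
  have "\<exists>v. Suc v < N \<and> u (Suc v) < u v"
  proof (rule ccontr)
    assume "\<nexists>v. Suc v < N \<and> u (Suc v) < u v"
    moreover have "u (Suc v) \<noteq> u v" for v using wu by (metis n_not_Suc_n)
    ultimately have step: "u v < u (Suc v)" if "Suc v < N" for v using that by (metis linorder_neqE_nat)
    have "v \<le> u v" if "v < N" for v
      using that
    proof (induction v)
      case (Suc v) then show ?case using step[of v] by simp
    qed simp
    then have "u = id" using permutes_natset_ge[OF u] by auto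
    then show False using w(2) wu by (auto simp: fun_eq_iff)
  qed
  then obtain v where v: "Suc v < N" "u (Suc v) < u v" by blast
  have "u v < N" using permutes_in_image[OF u, of v] v by simp
  moreover have "(\<Prod>i<u v. (c * q ^ w i - q * (c * q ^ w (u v))) / (c * q ^ w i - c * q ^ w (u v))) = 0"
    by (rule prod_zero) (use v(2) wu in \<open>auto intro!: bexI[of _ "u (Suc v)"]\<close>)
  ultimately show ?thesis unfolding hl_kernel_def by (intro prod_zero) auto
qed

lemma inj_on_geometric:
  assumes "c \<noteq> 0" shows "inj_on (\<lambda>i. c * q ^ i) A"
proof (rule inj_onI)
  fix i j assume "c * q ^ i = c * q ^ j"
  then have "q ^ i = q ^ j" using assms by simp
  then show "i = j" using power_inject_exp'[of q i j] q_pos q_less_1 by simp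
qed

text \<open>Only the identity permutation survives. Its kernel is read off from the case of zero
  exponents, where the whole sum is known.\<close>

lemma hl_sum_geometric:
  assumes "c \<noteq> 0"
  shows "hl_sum N \<alpha> (\<lambda>i. c * q ^ i) = (\<Prod>i<N. (c * q ^ i) ^ \<alpha> i) * vblock N"
proof -
  have id: "hl_sum N \<beta> (\<lambda>i. c * q ^ i) = (\<Prod>i<N. (c * q ^ i) ^ \<beta> i) * hl_kernel N (\<lambda>i. c * q ^ i)" for \<beta>
  proof -
    have "hl_sum N \<beta> (\<lambda>i. c * q ^ i) = (\<Sum>w\<in>{id}. (\<Prod>i<N. (c * q ^ w i) ^ \<beta> i) * hl_kernel N (\<lambda>i. c * q ^ w i))"
      unfolding hl_sum_def
      by (rule sum.mono_neutral_right) (auto simp: finite_permutations permutes_id hl_kernel_geometric_eq_0)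
    then show ?thesis by simp
  qed
  have "hl_kernel N (\<lambda>i. c * q ^ i) = vblock N"
    using id[of "\<lambda>_. 0"] hl_sum_zero[OF inj_on_geometric[OF assms, of "{..<N}"]] by simp
  then show ?thesis using id by simp
qed

text \<open>In \<open>N\<close> variables, once \<open>N\<close> is at least \<open>b 0\<close>, the
  value differs from the limit only by the factor \<open>qq N / qq (N - b 0)\<close>.\<close>

lemma HP_geometric_tendsto:
  assumes b: "b \<in> partitions" and c: "c \<noteq> 0"
  shows "(\<lambda>N. HP b N (\<lambda>i. c * q ^ i)) \<longlonglongrightarrow>
    c ^ part_size b * q ^ part_n (conjugate b) / part_b q (conjugate b)"
proof -
  obtain M where M: "\<And>k. k \<ge> M \<Longrightarrow> b k = 0" using partitions_bound[OF b] by blast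
  have "HP b N (\<lambda>i. c * q ^ i) = c ^ part_size b * q ^ part_n (conjugate b) / part_b q (conjugate b)
      * (qq N / qq (N - b 0))" if N: "b 0 \<le> N" for N
  proof -
    have l0: "conjugate b i = 0" if "N \<le> i" for i using that N by (simp add: conjugate_zero_iff b)
    have "(\<Prod>i<N. (c * q ^ i) ^ conjugate b i) = c ^ part_size b * q ^ part_n (conjugate b)"
    proof -
      have "part_size b = (\<Sum>i<N. conjugate b i)"
        using part_size_eq[of N "conjugate b"] l0 b by simp
      moreover have "part_n (conjugate b) = (\<Sum>i<N. conjugate b i * i)"
        by (rule part_n_eq_weighted) (use l0 b in auto)
      ultimately show ?thesis
        by (simp add: power_mult_distrib prod.distrib power_sum mult.commute flip: power_mult)
    qed
    moreover have "vblock N / hl_v q N (conjugate b) = qq N / qq (N - b 0) / part_b q (conjugate b)"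
    proof -
      have tel: "(\<Sum>k<m. b k - b (Suc k)) + b m = b 0" for m
      proof (induction m)
        case (Suc m) then show ?case using partitions_mono[OF b, of m "Suc m"] by simp
      qed simp
      have "part_b q (conjugate b) = (\<Prod>k<M. qq (b k - b (Suc k)))"
        using part_b_eq[of "conjugate b" q] b fprod_eq[of M "\<lambda>k. qq (b k - b (Suc k))"] by (simp add: M)
      moreover have "(1 - q) ^ N = (1 - q) ^ (N - b 0) * (\<Prod>k<M. (1 - q) ^ (b k - b (Suc k)))"
        using tel[of M] N by (simp add: M flip: power_sum power_add)
      moreover have "hl_v q N (conjugate b) = vblock (N - b 0) * (\<Prod>k<M. vblock (b k - b (Suc k)))"
        by (rule hl_v_eq[OF b M])
      ultimately show ?thesis
        using q_less_1 by (simp add: vblock_def prod_dividef)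
    qed
    moreover have "HP b N (\<lambda>i. c * q ^ i) = (\<Prod>i<N. (c * q ^ i) ^ conjugate b i) * (vblock N / hl_v q N (conjugate b))"
      using N b by (simp add: HP_eq hl_sum_geometric[OF c])
    ultimately show ?thesis by (simp only:) simp
  qed
  then have ev: "eventually (\<lambda>N. c ^ part_size b * q ^ part_n (conjugate b) / part_b q (conjugate b)
      * (qq N / qq (N - b 0)) = HP b N (\<lambda>i. c * q ^ i)) sequentially"
    by (intro eventually_sequentiallyI[of "b 0"]) simp
  have "(\<lambda>N. c ^ part_size b * q ^ part_n (conjugate b) / part_b q (conjugate b)
      * (qq N / qq (N - b 0))) \<longlonglongrightarrow> c ^ part_size b * q ^ part_n (conjugate b) / part_b q (conjugate b) * 1"
    by (intro tendsto_mult tendsto_const qq_ratio_tendsto)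
  from Lim_transform_eventually[OF this ev] show ?thesis by simp
qed

end

section \<open>Linear independence of the Hall-Littlewood polynomials\<close>

lemma base_digits_unique:
  fixes \<alpha> \<beta> :: "nat \<Rightarrow> nat"
  assumes "\<And>j. j < N \<Longrightarrow> \<alpha> j < B" "\<And>j. j < N \<Longrightarrow> \<beta> j < B"
    and "(\<Sum>j<N. B ^ j * \<alpha> j) = (\<Sum>j<N. B ^ j * \<beta> j)" and "j < N"
  shows "\<alpha> j = \<beta> j"
  using assms
proof (induction N arbitrary: \<alpha> \<beta> j)
  case (Suc N)
  have split: "(\<Sum>j<Suc N. B ^ j * \<gamma> j) = \<gamma> 0 + B * (\<Sum>j<N. B ^ j * \<gamma> (Suc j))" for \<gamma> :: "nat \<Rightarrow> nat"
    by (subst sum.lessThan_Suc_shift) (simp add: sum_distrib_left mult_ac)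
  have "\<alpha> 0 < B" "\<beta> 0 < B" using Suc.prems by auto
  have eq: "\<alpha> 0 + B * (\<Sum>j<N. B ^ j * \<alpha> (Suc j)) = \<beta> 0 + B * (\<Sum>j<N. B ^ j * \<beta> (Suc j))"
    using Suc.prems(3) unfolding split .
  from arg_cong[OF eq, of "\<lambda>x. x mod B"] have 0: "\<alpha> 0 = \<beta> 0"
    using \<open>\<alpha> 0 < B\<close> \<open>\<beta> 0 < B\<close> by simp
  moreover have "\<alpha> (Suc i) = \<beta> (Suc i)" if "i < N" for i
    by (rule Suc.IH[of "\<lambda>j. \<alpha> (Suc j)" "\<lambda>j. \<beta> (Suc j)"]) (use Suc.prems eq 0 that \<open>\<alpha> 0 < B\<close> in auto)
  ultimately show ?case using Suc.prems(4) by (cases j) auto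
qed simp

context q_param
begin

text \<open>At \<open>x\<^sub>j = s\<^bsup>B^j\<^esup>\<close> with a large base \<open>B\<close> the exponents of the monomials of all the
  given functions encode their digit sequences, so for \<open>s \<rightarrow> 0\<close> a single function dominates.\<close>

theorem HP_independent:
  assumes S: "finite S" "S \<subseteq> partitions"
    and zero: "\<And>N x. inj_on x {..<N} \<Longrightarrow> (\<Sum>a\<in>S. c a * HP a N x) = 0"
    and "a \<in> S"
  shows "c a = 0"
proof (rule ccontr)
  assume "c a \<noteq> 0"
  define S' where "S' = {a \<in> S. c a \<noteq> 0}"
  have S': "finite S'" "S' \<subseteq> partitions" "S' \<noteq> {}" using S \<open>a \<in> S\<close> \<open>c a \<noteq> 0\<close> by (auto simp: S'_def)
  \<comment> \<open>Enough variables that the length condition holds for every function in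
    \<open>S'\<close>; the base \<open>B\<close> below exceeds all parts, so that the parts are
    digits.\<close>
  define N where "N = Max ((\<lambda>a. a 0) ` S')"
  define B where "B = Suc (Suc (Max ((\<lambda>a. conjugate a 0) ` S')))"
  have N: "b 0 \<le> N" if "b \<in> S'" for b using that S'(1) by (auto simp: N_def)
  have B: "conjugate b j < B" if "b \<in> S'" for b j
  proof -
    have "conjugate b 0 \<le> Max ((\<lambda>a. conjugate a 0) ` S')" using that S'(1) by auto
    moreover have "conjugate b j \<le> conjugate b 0"
      using partitions_mono[of "conjugate b" 0 j] that S'(2) by auto
    ultimately show ?thesis by (simp add: B_def)
  qed
  have "B \<ge> 2" by (simp add: B_def)
  define perms where "perms = {w. w permutes {..<N}}"
  have "id \<in> perms" unfolding perms_def using permutes_id by blast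
  moreover have "finite perms" by (simp add: perms_def finite_permutations)
  ultimately have perms: "finite perms" "perms \<noteq> {}" by auto
  define D where "D b w = (\<Sum>i<N. B ^ w i * conjugate b i)" for b and w :: "nat \<Rightarrow> nat"
  \<comment> \<open>The lowest exponent of \<open>s\<close> over all functions and permutations;
    \<open>s ^ M\<close> is divided out before the limit.\<close>
  define M where "M = Min ((\<lambda>(b, w). D b w) ` (S' \<times> perms))"
  have M_le: "M \<le> D b w" if "b \<in> S'" "w \<in> perms" for b w
    unfolding M_def using that S'(1) perms by (intro Min_le) auto
  have "M \<in> (\<lambda>(b, w). D b w) ` (S' \<times> perms)"
    unfolding M_def using S' perms by (intro Min_in) auto
  then obtain b0 w0 where bw0: "b0 \<in> S'" "w0 \<in> perms" "D b0 w0 = M" by auto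
  have D_eq: "D b w = (\<Sum>j<N. B ^ j * conjugate b (inv w j))" if "w \<in> perms" for b w
  proof -
    have w: "w permutes {..<N}" using that by (simp add: perms_def)
    show ?thesis unfolding D_def
      by (rule sum.reindex_bij_witness[of _ "inv w" w])
        (use permutes_inverses[OF w] permutes_in_image[OF w] permutes_in_image[OF permutes_inv[OF w]] in auto)
  qed
  \<comment> \<open>Several permutations may attain the minimum, but only for one partition: equal
    digits make the two sequences of parts rearrangements of each other.\<close>
  have unique: "b = b0" if "b \<in> S'" "w \<in> perms" "D b w = M" for b w
  proof
    fix k
    have count: "b k = card {j \<in> {..<N}. k < conjugate b (inv w j)}" if "b \<in> S'" "w \<in> perms" for b w
    proof -
      have w: "w permutes {..<N}" and b: "b \<in> partitions" using that S'(2) by (auto simp: perms_def)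
      have lt: "i < b k \<longleftrightarrow> k < conjugate b i" for i by (simp add: less_conjugate_iff b)
      have "b k \<le> N" using N[OF that(1)] partitions_mono[OF b, of 0 k] by simp
      have "{j \<in> {..<N}. k < conjugate b (inv w j)} = w ` {..<b k}"
      proof (intro equalityI subsetI)
        fix j assume "j \<in> {j \<in> {..<N}. k < conjugate b (inv w j)}"
        then have "inv w j \<in> {..<b k}" by (simp add: lt)
        moreover have "j = w (inv w j)" using permutes_inverses(1)[OF w] by simp
        ultimately show "j \<in> w ` {..<b k}" by blast
      next
        fix j assume "j \<in> w ` {..<b k}"
        then obtain i where i: "j = w i" "i < b k" by auto
        then have "w i < N" using permutes_in_image[OF w, of i] \<open>b k \<le> N\<close> by simp
        then show "j \<in> {j \<in> {..<N}. k < conjugate b (inv w j)}"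
          using i permutes_inverses(2)[OF w] by (simp add: lt[symmetric])
      qed
      then show ?thesis using permutes_inj[OF w] by (simp add: card_image inj_on_subset)
    qed
    have "conjugate b (inv w j) = conjugate b0 (inv w0 j)" if "j < N" for j
      by (rule base_digits_unique[OF _ _ _ that, where B = B])
        (use B \<open>b \<in> S'\<close> \<open>w \<in> perms\<close> \<open>D b w = M\<close> bw0 D_eq in auto)
    then show "b k = b0 k"
      using count[OF that(1,2)] count[OF bw0(1,2)] by (metis (mono_tags, lifting) Collect_cong lessThan_iff)
  qed
  \<comment> \<open>The limit of the kernel: in each factor the variable with the smaller exponent
    dominates, which leaves \<open>1\<close> or \<open>q\<close>. As all these limits are positive,
    the permutations attaining the minimum cannot cancel each other.\<close>
  define L where "L w = (\<Prod>j<N. \<Prod>i<j. if w i < w j then 1 else q)" for w :: "nat \<Rightarrow> nat"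
  have L_pos: "L w > 0" for w unfolding L_def using q_pos by (intro prod_pos) auto
  define F where "F b s = (\<Sum>w\<in>perms. s ^ (D b w - M) * hl_kernel N (\<lambda>i. s ^ (B ^ w i)))" for b and s :: real
  have kernel_lim: "((\<lambda>s::real. hl_kernel N (\<lambda>i. s ^ (B ^ w i))) \<longlongrightarrow> L w) (at_right 0)"
    if "w \<in> perms" for w
    unfolding hl_kernel_def L_def
  proof (intro tendsto_prod)
    fix i j assume "j \<in> {..<N}" "i \<in> {..<j}"
    have "w i \<noteq> w j"
      using that \<open>i \<in> {..<j}\<close> permutes_inj[of w "{..<N}"] by (auto simp: perms_def dest: injD)
    have pos: "eventually (\<lambda>s::real. s \<in> {0<..<1}) (at_right 0)"
      by (rule eventually_at_right_real) simp
    have *: "((\<lambda>s::real. (1 - q * s ^ n) / (1 - s ^ n)) \<longlongrightarrow> 1) (at_right 0)"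
      "((\<lambda>s::real. (s ^ n - q) / (s ^ n - 1)) \<longlongrightarrow> q) (at_right 0)" if "n > 0" for n
    proof -
      have "((\<lambda>s::real. (1 - q * s ^ n) / (1 - s ^ n)) \<longlongrightarrow> (1 - q * 0 ^ n) / (1 - 0 ^ n)) (at_right 0)"
        "((\<lambda>s::real. (s ^ n - q) / (s ^ n - 1)) \<longlongrightarrow> (0 ^ n - q) / (0 ^ n - 1)) (at_right 0)"
        using that by (intro tendsto_intros; simp add: zero_power)+
      then show "((\<lambda>s::real. (1 - q * s ^ n) / (1 - s ^ n)) \<longlongrightarrow> 1) (at_right 0)"
        "((\<lambda>s::real. (s ^ n - q) / (s ^ n - 1)) \<longlongrightarrow> q) (at_right 0)" using that by (simp_all add: zero_power)
    qed
    show "((\<lambda>s::real. (s ^ B ^ w i - q * s ^ B ^ w j) / (s ^ B ^ w i - s ^ B ^ w j))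
        \<longlongrightarrow> (if w i < w j then 1 else q)) (at_right 0)"
    proof (cases "w i < w j")
      case True
      then have "B ^ w i < B ^ w j" using \<open>B \<ge> 2\<close> by simp
      then obtain n where n: "B ^ w j = B ^ w i + n" "n > 0" using less_imp_add_positive by metis
      have "eventually (\<lambda>s::real. (1 - q * s ^ n) / (1 - s ^ n) =
          (s ^ B ^ w i - q * s ^ B ^ w j) / (s ^ B ^ w i - s ^ B ^ w j)) (at_right 0)"
        using pos
      proof eventually_elim
        case (elim s)
        have "s ^ B ^ w i - q * s ^ B ^ w j = s ^ B ^ w i * (1 - q * s ^ n)"
          "s ^ B ^ w i - s ^ B ^ w j = s ^ B ^ w i * (1 - s ^ n)"
          by (simp_all add: n power_add algebra_simps)
        then show ?case using elim by simp
      qed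
      then show ?thesis using *(1)[OF n(2)] True by (simp cong: tendsto_cong)
    next
      case False
      then have "B ^ w j < B ^ w i" using \<open>B \<ge> 2\<close> \<open>w i \<noteq> w j\<close> by simp
      then obtain n where n: "B ^ w i = B ^ w j + n" "n > 0" using less_imp_add_positive by metis
      have "eventually (\<lambda>s::real. (s ^ n - q) / (s ^ n - 1) =
          (s ^ B ^ w i - q * s ^ B ^ w j) / (s ^ B ^ w i - s ^ B ^ w j)) (at_right 0)"
        using pos
      proof eventually_elim
        case (elim s)
        have "s ^ B ^ w i - q * s ^ B ^ w j = s ^ B ^ w j * (s ^ n - q)"
          "s ^ B ^ w i - s ^ B ^ w j = s ^ B ^ w j * (s ^ n - 1)"
          by (simp_all add: n power_add algebra_simps)
        then show ?case using elim by simp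
      qed
      then show ?thesis using *(2)[OF n(2)] False by (simp cong: tendsto_cong)
    qed
  qed
  have F_lim: "(F b \<longlongrightarrow> (\<Sum>w\<in>perms. 0 ^ (D b w - M) * L w)) (at_right 0)" for b
    unfolding F_def by (intro tendsto_sum tendsto_mult kernel_lim tendsto_power tendsto_ident_at)
  have "eventually (\<lambda>s::real. s \<in> {0<..<1}) (at_right 0)"
    by (rule eventually_at_right_real) simp
  then have "eventually (\<lambda>s. (\<Sum>b\<in>S'. c b / hl_v q N (conjugate b) * F b s) = 0) (at_right 0)"
  proof eventually_elim
    case (elim s)
    define x where "x i = s ^ (B ^ i)" for i :: nat
    have x: "inj_on x {..<N}"
    proof (rule inj_onI)
      fix i j assume "x i = x j"
      then have "B ^ i = B ^ j" using power_inject_exp'[of s "B ^ i" "B ^ j"] elim by (simp add: x_def)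
      then show "i = j" using \<open>B \<ge> 2\<close> power_inject_exp[of B i j] by simp
    qed
    have "hl_sum N (conjugate b) x = s ^ M * F b s" if "b \<in> S'" for b
    proof -
      have "(\<Prod>i<N. x (w i) ^ conjugate b i) = s ^ M * s ^ (D b w - M)" if "w \<in> perms" for w
      proof -
        have "(\<Prod>i<N. x (w i) ^ conjugate b i) = s ^ D b w"
          by (simp add: x_def D_def power_sum flip: power_mult)
        also have "\<dots> = s ^ M * s ^ (D b w - M)" using M_le[OF \<open>b \<in> S'\<close> that] by (simp flip: power_add)
        finally show ?thesis .
      qed
      then show ?thesis unfolding F_def hl_sum_def sum_distrib_left perms_def[symmetric]
        by (intro sum.cong) (simp_all add: x_def mult.assoc)
    qed
    then have "HP b N x = s ^ M * F b s / hl_v q N (conjugate b)" if "b \<in> S'" for b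
      using N[OF that] S'(2) that by (auto simp: HP_eq)
    moreover have "(\<Sum>b\<in>S'. c b * HP b N x) = 0"
    proof -
      have "(\<Sum>b\<in>S'. c b * HP b N x) = (\<Sum>b\<in>S. c b * HP b N x)"
        by (rule sum.mono_neutral_left) (auto simp: S'_def S(1))
      then show ?thesis using zero[OF x] by simp
    qed
    ultimately have "s ^ M * (\<Sum>b\<in>S'. c b / hl_v q N (conjugate b) * F b s) = 0"
      by (simp add: sum_distrib_left mult_ac)
    then show ?case using elim by simp
  qed
  then have "((\<lambda>s. \<Sum>b\<in>S'. c b / hl_v q N (conjugate b) * F b s) \<longlongrightarrow> 0) (at_right 0)"
    by (rule tendsto_eventually)
  moreover have "((\<lambda>s. \<Sum>b\<in>S'. c b / hl_v q N (conjugate b) * F b s) \<longlongrightarrow>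
      (\<Sum>b\<in>S'. c b / hl_v q N (conjugate b) * (\<Sum>w\<in>perms. 0 ^ (D b w - M) * L w))) (at_right 0)"
    by (intro tendsto_sum tendsto_mult F_lim tendsto_const)
  ultimately have "0 = (\<Sum>b\<in>S'. c b / hl_v q N (conjugate b) * (\<Sum>w\<in>perms. 0 ^ (D b w - M) * L w))"
    using tendsto_unique trivial_limit_at_right_real by blast
  also have "\<dots> = (\<Sum>b\<in>{b0}. c b / hl_v q N (conjugate b) * (\<Sum>w\<in>perms. 0 ^ (D b w - M) * L w))"
  proof (rule sum.mono_neutral_right)
    show "\<forall>b\<in>S' - {b0}. c b / hl_v q N (conjugate b) * (\<Sum>w\<in>perms. 0 ^ (D b w - M) * L w) = 0"
    proof
      fix b assume b: "b \<in> S' - {b0}"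
      have "(0::real) ^ (D b w - M) * L w = 0" if "w \<in> perms" for w
        using unique[of b w] M_le[of b w] b that by (auto simp: zero_power)
      then have "(\<Sum>w\<in>perms. (0::real) ^ (D b w - M) * L w) = 0" by (intro sum.neutral ballI)
      then show "c b / hl_v q N (conjugate b) * (\<Sum>w\<in>perms. 0 ^ (D b w - M) * L w) = 0"
        by (simp only: mult_zero_right)
    qed
  qed (use S' bw0 in auto)
  finally have "c b0 / hl_v q N (conjugate b0) * (\<Sum>w\<in>perms. 0 ^ (D b0 w - M) * L w) = 0" by simp
  moreover have "(\<Sum>w\<in>perms. 0 ^ (D b0 w - M) * L w) > 0"
    by (rule sum_pos2[of _ w0]) (use perms bw0 L_pos in \<open>auto simp: less_imp_le\<close>)
  moreover have "b0 \<in> partitions" "c b0 \<noteq> 0"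
    using bw0(1) S'(2) by (auto simp: S'_def)
  moreover from this have "hl_v q N (conjugate b0) \<noteq> 0" by (intro hl_v_nonzero)
  ultimately show False by simp
qed

end

section \<open>Structure constants\<close>

lemma part_size_mono:
  assumes "b \<in> partitions" "\<And>k. a k \<le> b k"
  shows "part_size a \<le> part_size b" and "part_size a = part_size b \<Longrightarrow> a = b"
proof -
  obtain L where L: "\<And>i. i \<ge> L \<Longrightarrow> b i = 0" using partitions_bound[OF assms(1)] by blast
  have La: "a i = 0" if "i \<ge> L" for i using L[OF that] assms(2)[of i] by simp
  have size: "part_size a = (\<Sum>i<L. a i)" "part_size b = (\<Sum>i<L. b i)"
    by (rule part_size_eq, fact La) (rule part_size_eq, fact L)
  show "part_size a \<le> part_size b"
    unfolding size by (intro sum_mono assms)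
  assume "part_size a = part_size b"
  then have "(\<Sum>i<L. a i) = (\<Sum>i<L. b i)" by (simp add: size)
  then have "a i = b i" if "i < L" for i
    using sum_mono_inv[of a "{..<L}" b i] assms(2) that by auto
  then have "a i = b i" for i using L[of i] La[of i] by (cases "i < L") auto
  then show "a = b" by auto
qed

lemma zero_partitions [simp]: "(\<lambda>_. 0) \<in> partitions"
  by (simp add: partitions_def antimono_def)

lemma part_size_zero [simp]: "part_size (\<lambda>_. 0) = 0"
  by (simp add: part_size_def)

context q_param
begin

text \<open>One family of coefficients serves all numbers of variables; this stands for a
  homogeneous element of degree \<open>s\<close> in the ring of symmetric functions.\<close>

definition hl_span :: "nat \<Rightarrow> symfun \<Rightarrow> bool" where
  "hl_span s f \<longleftrightarrow> (\<exists>c. \<forall>N x. inj_on x {..<N} \<longrightarrow> f N x = (\<Sum>b\<in>partitions_of s. c b * HP b N x))"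

text \<open>Having this for each \<open>HP b\<close> amounts to the existence of structure
  constants. Unlike membership in the span, the property is immediately closed under products, which
  suits the induction from elementary polynomials.\<close>

definition hl_multiplier :: "nat \<Rightarrow> symfun \<Rightarrow> bool" where
  "hl_multiplier r f \<longleftrightarrow> (\<forall>s g. hl_span s g \<longrightarrow> hl_span (r + s) (\<lambda>N x. f N x * g N x))"

lemma hl_span_cong:
  assumes "\<And>N x. inj_on x {..<N} \<Longrightarrow> f N x = g N x" shows "hl_span s f \<longleftrightarrow> hl_span s g"
  unfolding hl_span_def by (intro ex_cong1 all_cong1 imp_cong) (simp_all add: assms)

lemma hl_span_HP:
  assumes "b \<in> partitions" shows "hl_span (part_size b) (HP b)"
proof -
  have "partitions_of (part_size b) \<inter> {c. c = b} = {b}" using assms by (auto simp: partitions_of_def)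
  then have *: "HP b N x = (\<Sum>c\<in>partitions_of (part_size b). of_bool (c = b) * HP c N x)" for N x
    by (simp add: sum_of_bool_mult_eq)
  show ?thesis
    unfolding hl_span_def by (rule exI[of _ "\<lambda>c. of_bool (c = b)"]) (intro allI impI, rule * )
qed

lemma hl_span_sum:
  assumes "\<And>i. i \<in> I \<Longrightarrow> hl_span s (f i)"
  shows "hl_span s (\<lambda>N x. \<Sum>i\<in>I. k i * f i N x)"
proof -
  have "\<forall>i\<in>I. \<exists>c. \<forall>N x. inj_on x {..<N} \<longrightarrow> f i N x = (\<Sum>b\<in>partitions_of s. c b * HP b N x)"
    using assms unfolding hl_span_def by blast
  then obtain c where c: "\<And>i N x. i \<in> I \<Longrightarrow> inj_on x {..<N} \<Longrightarrow> f i N x = (\<Sum>b\<in>partitions_of s. c i b * HP b N x)"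
    by metis
  have "(\<Sum>i\<in>I. k i * f i N x) = (\<Sum>b\<in>partitions_of s. (\<Sum>i\<in>I. k i * c i b) * HP b N x)" if "inj_on x {..<N}" for N x
    using c[OF _ that] by (simp add: sum_distrib_left sum_distrib_right mult.assoc sum.swap[of _ I])
  then show ?thesis unfolding hl_span_def by (intro exI[of _ "\<lambda>b. \<Sum>i\<in>I. k i * c i b"]) simp
qed

lemma hl_multiplier_cong:
  assumes "\<And>N x. inj_on x {..<N} \<Longrightarrow> f N x = g N x" shows "hl_multiplier r f \<longleftrightarrow> hl_multiplier r g"
proof -
  have "hl_span s (\<lambda>N x. f N x * h N x) \<longleftrightarrow> hl_span s (\<lambda>N x. g N x * h N x)" for s h
    by (rule hl_span_cong) (simp add: assms)
  then show ?thesis by (simp add: hl_multiplier_def)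
qed

lemma hl_multiplierI:
  assumes "\<And>a. a \<in> partitions \<Longrightarrow> hl_span (r + part_size a) (\<lambda>N x. f N x * HP a N x)"
  shows "hl_multiplier r f"
  unfolding hl_multiplier_def
proof (intro allI impI)
  fix s g assume "hl_span s g"
  then obtain c where c: "\<And>N x. inj_on x {..<N} \<Longrightarrow> g N x = (\<Sum>b\<in>partitions_of s. c b * HP b N x)"
    unfolding hl_span_def by blast
  have "hl_span (r + s) (\<lambda>N x. \<Sum>b\<in>partitions_of s. c b * (f N x * HP b N x))"
    by (rule hl_span_sum) (use assms in \<open>auto simp: partitions_of_def\<close>)
  moreover have "hl_span (r + s) (\<lambda>N x. \<Sum>b\<in>partitions_of s. c b * (f N x * HP b N x))
      \<longleftrightarrow> hl_span (r + s) (\<lambda>N x. f N x * g N x)"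
    by (rule hl_span_cong) (simp add: c sum_distrib_left mult_ac)
  ultimately show "hl_span (r + s) (\<lambda>N x. f N x * g N x)" by blast
qed

lemma hl_multiplier_e_poly: "hl_multiplier r (e_poly r)"
proof (rule hl_multiplierI)
  fix a :: "nat \<Rightarrow> nat" assume a: "a \<in> partitions"
  have "hl_span (r + part_size a) (\<lambda>N x. \<Sum>b\<in>vstrips a r. vs_coeff a b * HP b N x)"
  proof (rule hl_span_sum)
    fix b assume "b \<in> vstrips a r"
    then have "b \<in> partitions" "part_size b = r + part_size a" by (auto simp: vstrips_def)
    then show "hl_span (r + part_size a) (HP b)" using hl_span_HP by metis
  qed
  moreover have "hl_span (r + part_size a) (\<lambda>N x. e_poly r N x * HP a N x)
      \<longleftrightarrow> hl_span (r + part_size a) (\<lambda>N x. \<Sum>b\<in>vstrips a r. vs_coeff a b * HP b N x)"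
    by (rule hl_span_cong) (rule e_pieri[OF a])
  ultimately show "hl_span (r + part_size a) (\<lambda>N x. e_poly r N x * HP a N x)" by blast
qed

lemma hl_multiplier_mult:
  assumes "hl_multiplier r f" "hl_multiplier r' f'"
  shows "hl_multiplier (r + r') (\<lambda>N x. f N x * f' N x)"
  using assms unfolding hl_multiplier_def by (simp add: mult.assoc add.assoc)

lemma hl_multiplier_sum:
  assumes "\<And>i. i \<in> I \<Longrightarrow> hl_multiplier r (f i)"
  shows "hl_multiplier r (\<lambda>N x. \<Sum>i\<in>I. k i * f i N x)"
  unfolding hl_multiplier_def
proof (intro allI impI)
  fix s g assume "hl_span s g"
  then have "hl_span (r + s) (\<lambda>N x. \<Sum>i\<in>I. k i * (f i N x * g N x))"
    using assms by (intro hl_span_sum) (auto simp: hl_multiplier_def)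
  then show "hl_span (r + s) (\<lambda>N x. (\<Sum>i\<in>I. k i * f i N x) * g N x)"
    by (simp add: sum_distrib_right mult.assoc)
qed

lemma vs_coeff_nonzero:
  assumes b: "b \<in> vstrips a r" shows "vs_coeff a b \<noteq> 0"
proof -
  have "b k - a k \<le> b k - b (Suc k)" for k
    by (rule diff_le_mono2) (use b in \<open>auto simp: vstrips_def\<close>)
  then have "qbinom q (b k - b (Suc k)) (b k - a k) \<noteq> 0" for k by (simp add: qbinom_def)
  \<comment> \<open>The default \<open>1\<close> of an infinite product is nonzero as well.\<close>
  then show ?thesis unfolding vs_coeff_def fprod_def by (metis (mono_tags, lifting) prod_zero_iff prod.infinite zero_neq_one)
qed

text \<open>Induction on the size and then downwards on the first entry \<open>b 0\<close>: by the Pieri rule, the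
  product of the elementary polynomial of degree \<open>b 0\<close> with the function of \<open>\<lambda>k. b (Suc k)\<close>
  contains \<open>HP b\<close>, and its other terms have the same size and a larger first entry.\<close>

theorem hl_multiplier_HP:
  assumes "b \<in> partitions" shows "hl_multiplier (part_size b) (HP b)"
  using assms
proof (induction "part_size b" arbitrary: b rule: less_induct)
  case outer: less
  from outer.prems outer.hyps show ?case
  proof (induction "part_size b - b 0" arbitrary: b rule: less_induct)
    case (less b)
    have size_shift: "part_size c = c 0 + part_size (\<lambda>k. c (Suc k))" if c: "c \<in> partitions" for c
    proof -
      obtain L where L: "\<And>i. i \<ge> L \<Longrightarrow> c i = 0" using partitions_bound[OF c] by blast
      have "part_size c = (\<Sum>i<Suc L. c i)" by (rule part_size_eq) (simp add: L)
      moreover have "part_size (\<lambda>k. c (Suc k)) = (\<Sum>i<L. c (Suc i))" by (rule part_size_eq) (simp add: L)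
      ultimately show ?thesis by (simp add: sum.lessThan_Suc_shift del: sum.lessThan_Suc)
    qed
    have shift: "(\<lambda>k. c (Suc k)) \<in> partitions" if c: "c \<in> partitions" for c
    proof -
      obtain L where L: "\<And>i. i \<ge> L \<Longrightarrow> c i = 0" using partitions_bound[OF c] by blast
      show ?thesis by (rule partitionsI[where L = L]) (use L partitions_mono[OF c] in auto)
    qed
    define a where "a = (\<lambda>k. b (Suc k))"
    have a: "a \<in> partitions" "part_size b = b 0 + part_size a"
      using shift size_shift less.prems(1) by (auto simp: a_def)
    show ?case
    proof (cases "b 0 = 0")
      case True
      then have "b = (\<lambda>_. 0)" using partitions_mono[OF less.prems(1), of 0] by (auto simp: fun_eq_iff)
      moreover have "hl_multiplier 0 (HP (\<lambda>_. 0)) \<longleftrightarrow> hl_multiplier 0 (\<lambda>N x. 1)"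
        by (rule hl_multiplier_cong) simp
      ultimately show ?thesis by (simp add: hl_multiplier_def)
    next
      case False
      have b: "b \<in> vstrips a (b 0)"
        using less.prems(1) a partitions_mono[OF less.prems(1)] by (simp add: vstrips_def a_def)
      let ?V = "vstrips a (b 0) - {b}"
      have "hl_multiplier (part_size b) (HP c)" if c: "c \<in> ?V" for c
      proof -
        have c': "c \<in> partitions" "part_size c = part_size b" "\<And>k. c (Suc k) \<le> b (Suc k)" "c \<noteq> b"
          using c a by (auto simp: vstrips_def a_def)
        \<comment> \<open>Otherwise \<open>c\<close> would lie below \<open>b\<close> in every entry
          and, having the same size, coincide with it.\<close>
        have "c 0 > b 0"
        proof (rule ccontr)
          assume "\<not> c 0 > b 0"
          then have "c k \<le> b k" for k using c'(3) by (cases k) auto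
          then show False using part_size_mono(2)[OF less.prems(1)] c' by auto
        qed
        moreover have "c 0 \<le> part_size c" using size_shift[OF c'(1)] by simp
        ultimately have "part_size c - c 0 < part_size b - b 0" using c'(2) by linarith
        then have "hl_multiplier (part_size c) (HP c)"
          using less.hyps c'(1,2) less.prems(2) by metis
        then show ?thesis using c'(2) by simp
      qed
      then have V: "hl_multiplier (part_size b) (\<lambda>N x. \<Sum>c\<in>?V. vs_coeff a c * HP c N x)"
        by (rule hl_multiplier_sum)
      have "hl_multiplier (part_size a) (HP a)"
        by (rule less.prems(2)) (use a False in auto)
      from hl_multiplier_mult[OF hl_multiplier_e_poly this]
      have E: "hl_multiplier (part_size b) (\<lambda>N x. e_poly (b 0) N x * HP a N x)"
        using a(2) by simp
      \<comment> \<open>A difference of two multipliers, written as a sum over the booleans so that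
        \<open>hl_multiplier_sum\<close> applies.\<close>
      define f where "f i = (if i then (\<lambda>N x. e_poly (b 0) N x * HP a N x) else (\<lambda>N x. \<Sum>c\<in>?V. vs_coeff a c * HP c N x))" for i
      define k where "k i = (if i then 1 / vs_coeff a b else - 1 / vs_coeff a b)" for i
      have "hl_multiplier (part_size b) (\<lambda>N x. \<Sum>i\<in>UNIV. k i * f i N x)"
        by (rule hl_multiplier_sum) (use E V in \<open>simp add: f_def\<close>)
      moreover have "hl_multiplier (part_size b) (\<lambda>N x. \<Sum>i\<in>UNIV. k i * f i N x) \<longleftrightarrow> hl_multiplier (part_size b) (HP b)"
      proof (rule hl_multiplier_cong)
        fix N and x :: "nat \<Rightarrow> real" assume x: "inj_on x {..<N}"
        have "e_poly (b 0) N x * HP a N x = vs_coeff a b * HP b N x + (\<Sum>c\<in>?V. vs_coeff a c * HP c N x)"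
          unfolding e_pieri[OF a(1) x] by (rule sum.remove[OF finite_vstrips b])
        then show "(\<Sum>i\<in>UNIV. k i * f i N x) = HP b N x"
          using vs_coeff_nonzero[OF b] by (simp add: UNIV_bool k_def f_def field_simps)
      qed
      ultimately show ?thesis by blast
    qed
  qed
qed

lemma hl_Q_conjugate: "hl_Q q (conjugate b) N x = part_b q (conjugate b) * HP b N x"
  by (simp add: hl_Q_def HP_def)

lemma part_b_pos: "part_b q l > 0"
  unfolding part_b_def by (intro prod_pos) simp

lemma part_b_nonzero [simp]: "part_b q l \<noteq> 0"
  using part_b_pos[of l] by simp

lemma sum_partitions_of_conjugate:
  "(\<Sum>l\<in>partitions_of s. f (conjugate l)) = (\<Sum>b\<in>partitions_of s. f b)"
  by (rule sum.reindex_bij_witness[of _ conjugate conjugate]) (auto simp: partitions_of_def)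

lemma hl_Q_independent:
  assumes S: "finite S" "S \<subseteq> partitions"
    and zero: "\<And>N x. inj_on x {..<N} \<Longrightarrow> (\<Sum>l\<in>S. g l * hl_Q q l N x) = 0"
    and "l \<in> S"
  shows "g l = 0"
proof -
  have inj: "inj_on conjugate S" using S(2) by (intro inj_on_inverseI[of _ conjugate]) auto
  have "g (conjugate (conjugate l)) * part_b q (conjugate (conjugate l)) = 0"
  proof (rule HP_independent[where S = "conjugate ` S" and c = "\<lambda>a. g (conjugate a) * part_b q (conjugate a)"])
    fix N and x :: "nat \<Rightarrow> real" assume x: "inj_on x {..<N}"
    have "(\<Sum>a\<in>conjugate ` S. g (conjugate a) * part_b q (conjugate a) * HP a N x) = (\<Sum>l\<in>S. g l * hl_Q q l N x)"
      unfolding sum.reindex[OF inj]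
    proof (rule sum.cong)
      fix l assume "l \<in> S"
      then have "conjugate (conjugate l) = l" using S(2) by auto
      then show "((\<lambda>a. g (conjugate a) * part_b q (conjugate a) * HP a N x) \<circ> conjugate) l = g l * hl_Q q l N x"
        using hl_Q_conjugate[of "conjugate l" N x] by simp
    qed simp
    then show "(\<Sum>a\<in>conjugate ` S. g (conjugate a) * part_b q (conjugate a) * HP a N x) = 0"
      using zero[OF x] by simp
  qed (use S \<open>l \<in> S\<close> in auto)
  then show ?thesis using S(2) \<open>l \<in> S\<close> by auto
qed

text \<open>The definite description has to be shown to denote. Existence of a finite expansion
  comes from \<open>hl_multiplier_HP\<close>, uniqueness from \<open>hl_Q_independent\<close> on the
  union of two supports.\<close>

theorem hl_coeffs_props:
  assumes m: "m \<in> partitions" and v: "v \<in> partitions"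
  shows "hl_coeffs q m v l \<noteq> 0 \<Longrightarrow> l \<in> partitions_of (part_size m + part_size v)" (is "_ \<Longrightarrow> l \<in> ?PS")
    and "inj_on x {..<N} \<Longrightarrow> hl_Q q m N x * hl_Q q v N x =
      (\<Sum>l\<in>partitions_of (part_size m + part_size v). hl_coeffs q m v l * hl_Q q l N x)"
proof -
  define P where "P g \<longleftrightarrow> finite {l. g l \<noteq> 0} \<and> {l. g l \<noteq> 0} \<subseteq> partitions \<and>
        (\<forall>N x. inj_on x {..<N} \<longrightarrow>
           hl_Q q m N x * hl_Q q v N x = (\<Sum>l | g l \<noteq> 0. g l * hl_Q q l N x))" for g
  have PD: "hl_Q q m N x * hl_Q q v N x = (\<Sum>l | g l \<noteq> 0. g l * hl_Q q l N x)" if "P g" "inj_on x {..<N}" for g N x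
    using that by (simp add: P_def)
  define a b where "a = conjugate m" and "b = conjugate v"
  have ab: "a \<in> partitions" "b \<in> partitions" "part_size a = part_size m" "part_size b = part_size v"
    "conjugate a = m" "conjugate b = v"
    using m v by (auto simp: a_def b_def)
  have "hl_span (part_size a + part_size b) (\<lambda>N x. HP a N x * HP b N x)"
    using hl_multiplier_HP[OF ab(1)] hl_span_HP[OF ab(2)] by (simp add: hl_multiplier_def)
  then obtain c where c: "\<And>N x. inj_on x {..<N} \<Longrightarrow> HP a N x * HP b N x = (\<Sum>d\<in>?PS. c d * HP d N x)"
    unfolding hl_span_def ab by blast
  define g where "g l = (if l \<in> ?PS then part_b q m * part_b q v * c (conjugate l) / part_b q l else 0)" for l
  have g: "{l. g l \<noteq> 0} \<subseteq> ?PS" by (auto simp: g_def)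
  have expand: "hl_Q q m N x * hl_Q q v N x = (\<Sum>l\<in>?PS. g l * hl_Q q l N x)" if x: "inj_on x {..<N}" for N x
  proof -
    have "hl_Q q m N x * hl_Q q v N x = part_b q m * part_b q v * (HP a N x * HP b N x)"
      using hl_Q_conjugate[of a N x] hl_Q_conjugate[of b N x] by (simp add: ab)
    also have "\<dots> = (\<Sum>d\<in>?PS. part_b q m * part_b q v * (c d * HP d N x))"
      unfolding c[OF x] by (simp add: sum_distrib_left)
    also have "\<dots> = (\<Sum>l\<in>?PS. part_b q m * part_b q v * (c (conjugate l) * HP (conjugate l) N x))"
      by (rule sum_partitions_of_conjugate[symmetric])
    also have "\<dots> = (\<Sum>l\<in>?PS. g l * hl_Q q l N x)"
    proof (rule sum.cong)
      fix l assume l: "l \<in> ?PS"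
      then have "hl_Q q l N x = part_b q l * HP (conjugate l) N x"
        using hl_Q_conjugate[of "conjugate l" N x] by (simp add: partitions_of_def)
      then show "part_b q m * part_b q v * (c (conjugate l) * HP (conjugate l) N x) = g l * hl_Q q l N x"
        using l by (simp add: g_def)
    qed simp
    finally show ?thesis .
  qed
  have Pg: "P g"
    unfolding P_def
  proof (intro conjI allI impI)
    show "finite {l. g l \<noteq> 0}" using g by (rule finite_subset) simp
    show "{l. g l \<noteq> 0} \<subseteq> partitions" using g by (auto simp: partitions_of_def)
    fix N and x :: "nat \<Rightarrow> real" assume x: "inj_on x {..<N}"
    have "(\<Sum>l\<in>?PS. g l * hl_Q q l N x) = (\<Sum>l | g l \<noteq> 0. g l * hl_Q q l N x)"
      by (rule sum.mono_neutral_right) (use g in auto)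
    then show "hl_Q q m N x * hl_Q q v N x = (\<Sum>l | g l \<noteq> 0. g l * hl_Q q l N x)"
      using expand[OF x] by simp
  qed
  have unique: "h = g" if h: "P h" for h
  proof
    fix l
    define S where "S = {l. h l \<noteq> 0} \<union> {l. g l \<noteq> 0}"
    have S: "finite S" "S \<subseteq> partitions" using h Pg by (auto simp: P_def S_def)
    have "h l - g l = 0" if "l \<in> S"
    proof (rule hl_Q_independent[OF S _ that])
      fix N and x :: "nat \<Rightarrow> real" assume x: "inj_on x {..<N}"
      have "(\<Sum>l\<in>S. h l * hl_Q q l N x) = (\<Sum>l | h l \<noteq> 0. h l * hl_Q q l N x)"
        "(\<Sum>l\<in>S. g l * hl_Q q l N x) = (\<Sum>l | g l \<noteq> 0. g l * hl_Q q l N x)"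
        by (intro sum.mono_neutral_right; use S in \<open>auto simp: S_def\<close>)+
      moreover have "(\<Sum>l | h l \<noteq> 0. h l * hl_Q q l N x) = (\<Sum>l | g l \<noteq> 0. g l * hl_Q q l N x)"
        using PD[OF h x] PD[OF Pg x] by simp
      ultimately show "(\<Sum>l\<in>S. (h l - g l) * hl_Q q l N x) = 0"
        by (simp add: left_diff_distrib sum_subtractf)
    qed
    then show "h l = g l" by (cases "l \<in> S") (auto simp: S_def)
  qed
  have "hl_coeffs q m v = g"
    unfolding hl_coeffs_def P_def[symmetric] by (rule the_equality[of P, OF Pg unique])
  then show "hl_coeffs q m v l \<noteq> 0 \<Longrightarrow> l \<in> ?PS"
    and "inj_on x {..<N} \<Longrightarrow> hl_Q q m N x * hl_Q q v N x = (\<Sum>l\<in>?PS. hl_coeffs q m v l * hl_Q q l N x)"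
    using g expand by auto
qed

section \<open>The dual Pieri rule and surjection numbers\<close>

text \<open>The coefficient of \<open>HP d\<close> when \<open>HP a\<close> is multiplied by
  \<open>h_r\<close> with \<open>r = part_size d - part_size a\<close>. Only containment is
  required, in contrast to \<open>vs_coeff\<close>, since \<open>h_r\<close> involves all partitions
  of \<open>r\<close>.\<close>

definition sk_coeff :: "(nat \<Rightarrow> nat) \<Rightarrow> (nat \<Rightarrow> nat) \<Rightarrow> real" where
  "sk_coeff a d = (if \<forall>k. a k \<le> d k
    then fprod (\<lambda>k. q ^ ((d k - a k) choose 2) * qbinom q (d k - a (Suc k)) (a k - a (Suc k))) else 0)"

text \<open>The dual Pieri rule: \<open>sk_op r a\<close> equals \<open>h\<^sub>r P\<^sub>\<lambda>\<close> for the partition \<open>\<lambda>\<close> with columns \<open>a\<close>.\<close>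

definition sk_op :: "nat \<Rightarrow> (nat \<Rightarrow> nat) \<Rightarrow> symfun" where
  "sk_op r a N x = (\<Sum>d\<in>partitions_of (part_size a + r). sk_coeff a d * HP d N x)"

definition interlacing :: "(nat \<Rightarrow> nat) \<Rightarrow> (nat \<Rightarrow> nat) \<Rightarrow> (nat \<Rightarrow> nat) set" where
  "interlacing a d = {b \<in> partitions. \<forall>k. a k \<le> b k \<and> b (Suc k) \<le> a k \<and> b k \<le> d k}"

lemma alternating_qq_sum:
  assumes "n > 0"
  shows "(\<Sum>t\<in>{m..m + n}. (-1) ^ (t - m) * (q ^ ((m + n - t) choose 2) / (qq (t - m) * qq (m + n - t)))) = 0"
proof -
  have "(\<Sum>t\<in>{m..m + n}. (-1) ^ (t - m) * (q ^ ((m + n - t) choose 2) / (qq (t - m) * qq (m + n - t))))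
      = (\<Sum>k\<le>n. (-1) ^ (n - k) * (q ^ (k choose 2) / (qq (n - k) * qq k)))"
    by (rule sum.reindex_bij_witness[of _ "\<lambda>k. m + n - k" "\<lambda>t. m + n - t"]) auto
  also have "\<dots> = (\<Sum>k\<le>n. (-1) ^ n / qq n * ((-1) ^ k * q ^ (k choose 2) * qbinom q n k))"
  proof (rule sum.cong)
    fix k assume "k \<in> {..n}"
    then have sgn: "(-1 :: real) ^ n * (-1) ^ k = (-1) ^ (n - k)"
      by (simp add: minus_one_power_iff)
    then show "(-1) ^ (n - k) * (q ^ (k choose 2) / (qq (n - k) * qq k)) = (-1) ^ n / qq n * ((-1) ^ k * q ^ (k choose 2) * qbinom q n k)"
      unfolding sgn[symmetric] using \<open>k \<in> {..n}\<close> by (simp add: qbinom_def mult_ac)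
  qed simp
  also have "\<dots> = 0"
    unfolding sum_distrib_left[symmetric] using assms by (simp add: alternating_qbinom_sum)
  finally show ?thesis .
qed

text \<open>The factors \<open>qq (b k - b (Suc k))\<close>, which couple neighbouring entries of
  \<open>b\<close>, cancel between the two coefficients. Every remaining factor contains a single
  entry of \<open>b\<close>, so one entry can be summed while the others are fixed.\<close>

lemma vs_sk_factor:
  assumes b: "b \<in> interlacing a d" and d: "\<And>k. k \<ge> L \<Longrightarrow> d k = 0"
  shows "vs_coeff a b * sk_coeff b d =
    (\<Prod>k<L. qq (d k - b (Suc k)) / qq (a k - b (Suc k))) *
    (\<Prod>k<L. q ^ ((d k - b k) choose 2) / (qq (b k - a k) * qq (d k - b k)))"
proof -
  have b': "a k \<le> b k" "b (Suc k) \<le> a k" "b k \<le> d k" for k using b by (auto simp: interlacing_def)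
  have b0: "b k = 0" "a k = 0" if "k \<ge> L" for k using b'(1,3)[of k] d[OF that] by auto
  have "vs_coeff a b = (\<Prod>k<L. qbinom q (b k - b (Suc k)) (b k - a k))"
    unfolding vs_coeff_def by (rule fprod_eq) (simp add: b0)
  moreover have "sk_coeff b d = (\<Prod>k<L. q ^ ((d k - b k) choose 2) * qbinom q (d k - b (Suc k)) (b k - b (Suc k)))"
    unfolding sk_coeff_def using b' by (auto intro!: fprod_eq simp: b0 d numeral_2_eq_2)
  moreover have "qbinom q (b k - b (Suc k)) (b k - a k) * (q ^ ((d k - b k) choose 2) * qbinom q (d k - b (Suc k)) (b k - b (Suc k)))
    = qq (d k - b (Suc k)) / qq (a k - b (Suc k)) * (q ^ ((d k - b k) choose 2) / (qq (b k - a k) * qq (d k - b k)))" for k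
  proof -
    have "b k - a k \<le> b k - b (Suc k)" "b k - b (Suc k) \<le> d k - b (Suc k)"
      "b k - b (Suc k) - (b k - a k) = a k - b (Suc k)" "d k - b (Suc k) - (b k - b (Suc k)) = d k - b k"
      using b'[of k] by auto
    then show ?thesis by (simp add: qbinom_def mult_ac)
  qed
  ultimately show ?thesis by (simp add: prod.distrib[symmetric])
qed

text \<open>If \<open>j\<close> is the first column where \<open>a\<close> and \<open>d\<close> differ, the entry \<open>b j\<close> runs freely through
  \<open>{a j..d j}\<close>, and the alternating sum over it vanishes by the q-binomial theorem.\<close>

lemma vs_sk_inverse:
  assumes a: "a \<in> partitions" and d: "d \<in> partitions"
  shows "(\<Sum>b\<in>interlacing a d. (-1) ^ (part_size b - part_size a) * (vs_coeff a b * sk_coeff b d)) = of_bool (a = d)"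
proof -
  obtain L where L: "\<And>k. k \<ge> L \<Longrightarrow> d k = 0" using partitions_bound[OF d] by blast
  consider "\<not> (\<forall>k. a k \<le> d k)" | "a = d" | "\<forall>k. a k \<le> d k" "a \<noteq> d" by blast
  then show ?thesis
  proof cases
    case 1
    then have "interlacing a d = {}" by (auto simp: interlacing_def dest: order_trans)
    moreover have "a \<noteq> d" using 1 by auto
    ultimately show ?thesis by simp
  next
    case 2
    have "b = a" if b: "b \<in> interlacing a d" for b
    proof
      fix k
      have "a k \<le> b k" "b k \<le> d k" using b by (auto simp: interlacing_def)
      then show "b k = a k" using 2 by simp
    qed
    moreover have "a \<in> interlacing a d"
      unfolding interlacing_def 2[symmetric] using partitions_mono[OF a] a by simp
    ultimately have "interlacing a d = {a}" by blast
    then show ?thesis using 2 vs_sk_factor[of a a d L] L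
      by (simp add: numeral_2_eq_2)
  next
    case 3
    define j where "j = (LEAST j. a j \<noteq> d j)"
    have "\<exists>j. a j \<noteq> d j" using 3(2) ext[of a d] by blast
    then have aj: "a j \<noteq> d j" unfolding j_def by (rule LeastI_ex)
    have before: "a k = d k" if "k < j" for k using not_less_Least[of k "\<lambda>j. a j \<noteq> d j"] that by (auto simp: j_def)
    obtain n where n: "d j = a j + n" "n > 0" using 3(1) aj by (metis le_neq_implies_less less_imp_add_positive)
    have jL: "j < L" using n L[of j] by (cases "j < L") auto
    \<comment> \<open>Representatives with the value at \<open>j\<close> normalised to
      \<open>a j\<close>; the value at \<open>j\<close> is then added back as a free
      parameter.\<close>
    define W0 where "W0 = {b \<in> interlacing a d. b j = a j}"
    define f where "f b = (-1) ^ (part_size b - part_size a) * (vs_coeff a b * sk_coeff b d)" for b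
    have upd: "b(j := t) \<in> interlacing a d" if b: "b \<in> W0" and t: "t \<in> {a j..d j}" for b t
    proof -
      have b': "a k \<le> b k" "b (Suc k) \<le> a k" "b k \<le> d k" for k using b by (auto simp: W0_def interlacing_def)
      have 1: "a k \<le> (b(j := t)) k" "(b(j := t)) k \<le> d k" for k using b'(1,3)[of k] t by auto
      \<comment> \<open>Only the column before \<open>j\<close> matters: there \<open>a\<close> and
        \<open>d\<close> still agree, so the bound by \<open>a\<close> is implied by the
        monotonicity of \<open>d\<close>.\<close>
      have 2: "(b(j := t)) (Suc k) \<le> a k" for k
      proof (cases "Suc k = j")
        case True
        then have "d j \<le> a k" using before[of k] partitions_mono[OF d, of k j] by simp
        then show ?thesis using True t by auto
      qed (use b'(2) in simp)
      have "b(j := t) \<in> partitions"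
      proof (rule partitionsI[where L = L])
        show "(b(j := t)) (Suc k) \<le> (b(j := t)) k" for k using 1(1)[of k] 2[of k] by linarith
        show "(b(j := t)) k = 0" if "k \<ge> L" for k using 1(2)[of k] L[OF that] by simp
      qed
      then show ?thesis using 1 2 by (simp add: interlacing_def)
    qed
    have inner: "(\<Sum>t\<in>{a j..d j}. f (b(j := t))) = 0" if b: "b \<in> W0" for b
    proof -
      have b': "a k \<le> b k" "b (Suc k) \<le> a k" "b k \<le> d k" "b j = a j" for k
        using b by (auto simp: W0_def interlacing_def)
      define Y where "Y = (\<Prod>k<L. qq (d k - b (Suc k)) / qq (a k - b (Suc k)))"
      define Z where "Z = (\<Prod>k\<in>{..<L} - {j}. q ^ ((d k - b k) choose 2) / (qq (b k - a k) * qq (d k - b k)))"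
      have "f (b(j := t)) = (-1) ^ (part_size b - part_size a) * Y * Z *
          ((-1) ^ (t - a j) * (q ^ ((a j + n - t) choose 2) / (qq (t - a j) * qq (a j + n - t))))"
        if t: "t \<in> {a j..d j}" for t
      proof -
        let ?b = "b(j := t)"
        \<comment> \<open>The value \<open>t\<close> enters only for \<open>Suc k = j\<close>, where
          \<open>a k = d k\<close> makes the quotient \<open>1\<close>.\<close>
        have "(\<Prod>k<L. qq (d k - ?b (Suc k)) / qq (a k - ?b (Suc k))) = Y"
          unfolding Y_def
        proof (rule prod.cong)
          fix k show "qq (d k - ?b (Suc k)) / qq (a k - ?b (Suc k)) = qq (d k - b (Suc k)) / qq (a k - b (Suc k))"
            using before[of k] by (cases "Suc k = j") auto
        qed simp
        moreover have "(\<Prod>k<L. q ^ ((d k - ?b k) choose 2) / (qq (?b k - a k) * qq (d k - ?b k)))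
            = q ^ ((a j + n - t) choose 2) / (qq (t - a j) * qq (a j + n - t)) * Z"
          using jL by (simp add: prod.remove[of "{..<L}" j] Z_def n)
        moreover have "part_size ?b - part_size a = (part_size b - part_size a) + (t - a j)"
        proof -
          have bL: "b k = 0" "?b k = 0" "a k = 0" if "k \<ge> L" for k
            using b'(3)[of k] b'(1)[of k] L[OF that] jL that by auto
          have "part_size b = (\<Sum>k<L. b k)" by (rule part_size_eq) (rule bL)
          moreover have "part_size ?b = (\<Sum>k<L. ?b k)" by (rule part_size_eq) (rule bL)
          moreover have "part_size a = (\<Sum>k<L. a k)" by (rule part_size_eq) (rule bL)
          moreover have "(\<Sum>k<L. ?b k) = t + (\<Sum>k\<in>{..<L} - {j}. b k)" "(\<Sum>k<L. b k) = a j + (\<Sum>k\<in>{..<L} - {j}. b k)"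
            using jL b'(4) by (simp_all add: sum.remove[of "{..<L}" j])
          moreover have "(\<Sum>k<L. a k) \<le> (\<Sum>k<L. b k)" by (intro sum_mono b')
          ultimately show ?thesis using t by auto
        qed
        moreover have "vs_coeff a ?b * sk_coeff ?b d = (\<Prod>k<L. qq (d k - ?b (Suc k)) / qq (a k - ?b (Suc k))) *
            (\<Prod>k<L. q ^ ((d k - ?b k) choose 2) / (qq (?b k - a k) * qq (d k - ?b k)))"
          by (rule vs_sk_factor[OF upd[OF b t]]) (rule L)
        ultimately show ?thesis
          unfolding f_def by (simp only: power_add mult_ac)
      qed
      then have "(\<Sum>t\<in>{a j..d j}. f (b(j := t))) = (-1) ^ (part_size b - part_size a) * Y * Z *
          (\<Sum>t\<in>{a j..a j + n}. (-1) ^ (t - a j) * (q ^ ((a j + n - t) choose 2) / (qq (t - a j) * qq (a j + n - t))))"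
        unfolding sum_distrib_left n(1) by (rule sum.cong[OF refl])
      then show ?thesis using alternating_qq_sum[OF n(2)] by simp
    qed
    have "(\<Sum>b\<in>interlacing a d. f b) = (\<Sum>(b, t)\<in>W0 \<times> {a j..d j}. f (b(j := t)))"
    proof (rule sum.reindex_bij_witness[of _ "\<lambda>(b, t). b(j := t)" "\<lambda>b. (b(j := a j), b j)"])
      fix b assume b: "b \<in> interlacing a d"
      have b': "a k \<le> b k" "b (Suc k) \<le> a k" "b k \<le> d k" for k using b by (auto simp: interlacing_def)
      have "b(j := a j) \<in> partitions"
      proof (rule partitionsI[where L = L])
        show "(b(j := a j)) (Suc k) \<le> (b(j := a j)) k" for k
          using b'(1)[of k] b'(2)[of k] partitions_mono[OF a, of k "Suc k"] by auto
        show "(b(j := a j)) k = 0" if "k \<ge> L" for k using b'(3)[of k] L[OF that] jL that by auto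
      qed
      then have "b(j := a j) \<in> W0"
        using b' n partitions_mono[OF a, of _ j] by (auto simp: W0_def interlacing_def)
      then show "(b(j := a j), b j) \<in> W0 \<times> {a j..d j}" using b' by auto
    next
      fix p assume "p \<in> W0 \<times> {a j..d j}"
      then show "(case p of (b, t) \<Rightarrow> b(j := t)) \<in> interlacing a d" using upd by auto
      show "((case p of (b, t) \<Rightarrow> b(j := t))(j := a j), (case p of (b, t) \<Rightarrow> b(j := t)) j) = p"
        using \<open>p \<in> _\<close> by (auto simp: W0_def fun_eq_iff)
    qed auto
    also have "\<dots> = (\<Sum>b\<in>W0. \<Sum>t\<in>{a j..d j}. f (b(j := t)))"
      by (rule sum.cartesian_product[symmetric])
    also have "\<dots> = 0" using inner by simp
    finally show ?thesis using 3 by (simp add: f_def)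
  qed
qed

text \<open>The operator form of \<open>vs_sk_inverse\<close>. It mirrors the vanishing of the
  alternating sum of \<open>e_i * h_(r - i)\<close> for \<open>r > 0\<close>.\<close>

lemma vs_sk_op:
  assumes a: "a \<in> partitions"
  shows "(\<Sum>i\<le>r. (-1) ^ i * (\<Sum>b\<in>vstrips a i. vs_coeff a b * sk_op (r - i) b N x)) = of_bool (r = 0) * HP a N x"
proof -
  let ?PS = "partitions_of (part_size a + r)"
  define V where "V = (\<Union>i\<le>r. vstrips a i)"
  have "sk_op (r - i) b N x = (\<Sum>d\<in>?PS. sk_coeff b d * HP d N x)" if "i \<le> r" "b \<in> vstrips a i" for i b
    using that by (simp add: sk_op_def vstrips_def)
  then have "(\<Sum>i\<le>r. (-1) ^ i * (\<Sum>b\<in>vstrips a i. vs_coeff a b * sk_op (r - i) b N x))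
      = (\<Sum>i\<le>r. \<Sum>b\<in>vstrips a i. (-1) ^ (part_size b - part_size a) * (vs_coeff a b * (\<Sum>d\<in>?PS. sk_coeff b d * HP d N x)))"
    unfolding sum_distrib_left[of _ _ "vstrips a _"] by (intro sum.cong refl) (auto simp: vstrips_def)
  also have "\<dots> = (\<Sum>b\<in>V. (-1) ^ (part_size b - part_size a) * (vs_coeff a b * (\<Sum>d\<in>?PS. sk_coeff b d * HP d N x)))"
    unfolding V_def by (rule sum.UNION_disjoint[symmetric]) (auto simp: finite_vstrips, auto simp: vstrips_def)
  also have "\<dots> = (\<Sum>d\<in>?PS. (\<Sum>b\<in>V. (-1) ^ (part_size b - part_size a) * (vs_coeff a b * sk_coeff b d)) * HP d N x)"
    by (simp add: sum_distrib_left sum_distrib_right mult.assoc sum.swap[of _ V])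
  also have "\<dots> = (\<Sum>d\<in>?PS. of_bool (a = d) * HP d N x)"
  proof (intro sum.cong refl)
    fix d assume d: "d \<in> ?PS"
    then have d': "d \<in> partitions" "part_size d = part_size a + r" by (auto simp: partitions_of_def)
    have "interlacing a d \<subseteq> V"
    proof
      fix b assume "b \<in> interlacing a d"
      then have b: "b \<in> partitions" "\<And>k. a k \<le> b k" "\<And>k. b (Suc k) \<le> a k" "\<And>k. b k \<le> d k"
        by (auto simp: interlacing_def)
      have "part_size a \<le> part_size b" by (rule part_size_mono(1)[OF b(1,2)])
      moreover have "part_size b \<le> part_size a + r" using part_size_mono(1)[OF d'(1) b(4)] d'(2) by simp
      ultimately have "b \<in> vstrips a (part_size b - part_size a)" "part_size b - part_size a \<le> r"
        using b by (auto simp: vstrips_def)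
      then show "b \<in> V" by (auto simp: V_def)
    qed
    moreover have "sk_coeff b d = 0" if "b \<in> V - interlacing a d" for b
      using that by (auto simp: V_def vstrips_def interlacing_def sk_coeff_def)
    moreover have "finite V" by (simp add: V_def finite_vstrips)
    ultimately have "(\<Sum>b\<in>V. (-1) ^ (part_size b - part_size a) * (vs_coeff a b * sk_coeff b d))
        = (\<Sum>b\<in>interlacing a d. (-1) ^ (part_size b - part_size a) * (vs_coeff a b * sk_coeff b d))"
      by (intro sum.mono_neutral_right) auto
    then show "(\<Sum>b\<in>V. (-1) ^ (part_size b - part_size a) * (vs_coeff a b * sk_coeff b d)) * HP d N x = of_bool (a = d) * HP d N x"
      by (simp only: vs_sk_inverse[OF a d'(1)])
  qed
  also have "\<dots> = of_bool (r = 0) * HP a N x"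
  proof -
    have "?PS \<inter> {d. a = d} = (if r = 0 then {a} else {})" using a by (auto simp: partitions_of_def)
    then show ?thesis by (simp add: sum_of_bool_mult_eq)
  qed
  finally show ?thesis .
qed

lemma vstrips_0:
  assumes "c \<in> partitions" shows "vstrips c 0 = {c}"
proof -
  have "b = c" if "b \<in> vstrips c 0" for b
    using that part_size_mono(2)[of b c] by (auto simp: vstrips_def)
  moreover have "c \<in> vstrips c 0" using assms partitions_mono[OF assms] by (auto simp: vstrips_def)
  ultimately show ?thesis by blast
qed

lemma vs_coeff_self: "vs_coeff c c = 1"
  by (simp add: vs_coeff_def fprod_def)

text \<open>By \<open>vs_sk_op\<close>, the induction hypothesis and \<open>e_pieri\<close>, both
  sides obey the same recursion in \<open>r\<close>, whose terms contain \<open>e_poly i\<close> and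
  the operator of degree \<open>r - i\<close> at the empty partition. In this way the latter takes
  the role of \<open>h_r\<close>.\<close>

theorem sk_op_mult:
  assumes a: "a \<in> partitions" and x: "inj_on x {..<N}"
  shows "sk_op r a N x = sk_op r (\<lambda>_. 0) N x * HP a N x"
  using a
proof (induction r arbitrary: a rule: less_induct)
  case (less r)
  show ?case
  proof (cases "r = 0")
    case True
    then show ?thesis
      using vs_sk_op[OF less.prems, of 0 N x] vs_sk_op[OF zero_partitions, of 0 N x] x less.prems
      by (simp add: vstrips_0 vs_coeff_self)
  next
    case False
    have rec: "sk_op r c N x = - (\<Sum>i=1..r. (-1) ^ i * (sk_op (r - i) (\<lambda>_. 0) N x * (e_poly i N x * HP c N x)))"
      if c: "c \<in> partitions" for c
    proof -
      have "(\<Sum>i\<le>r. (-1) ^ i * (\<Sum>b\<in>vstrips c i. vs_coeff c b * sk_op (r - i) b N x)) = 0"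
        using vs_sk_op[OF c, of r N x] False by simp
      moreover have "{..r} = insert 0 {1..r}" by auto
      ultimately have "sk_op r c N x = - (\<Sum>i=1..r. (-1) ^ i * (\<Sum>b\<in>vstrips c i. vs_coeff c b * sk_op (r - i) b N x))"
        by (simp add: vstrips_0 vs_coeff_self c)
      also have "(\<Sum>i=1..r. (-1) ^ i * (\<Sum>b\<in>vstrips c i. vs_coeff c b * sk_op (r - i) b N x))
          = (\<Sum>i=1..r. (-1) ^ i * (sk_op (r - i) (\<lambda>_. 0) N x * (e_poly i N x * HP c N x)))"
      proof (intro sum.cong refl)
        fix i assume i: "i \<in> {1..r}"
        have "(\<Sum>b\<in>vstrips c i. vs_coeff c b * sk_op (r - i) b N x)
            = (\<Sum>b\<in>vstrips c i. vs_coeff c b * (sk_op (r - i) (\<lambda>_. 0) N x * HP b N x))"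
        proof (intro sum.cong refl)
          fix b assume "b \<in> vstrips c i"
          then have "b \<in> partitions" by (simp add: vstrips_def)
          moreover have "r - i < r" using i False by simp
          ultimately show "vs_coeff c b * sk_op (r - i) b N x = vs_coeff c b * (sk_op (r - i) (\<lambda>_. 0) N x * HP b N x)"
            using less.IH[of "r - i" b] by simp
        qed
        also have "\<dots> = sk_op (r - i) (\<lambda>_. 0) N x * (e_poly i N x * HP c N x)"
          unfolding e_pieri[OF c x] by (simp add: sum_distrib_left mult_ac)
        finally show "(-1) ^ i * (\<Sum>b\<in>vstrips c i. vs_coeff c b * sk_op (r - i) b N x)
          = (-1) ^ i * (sk_op (r - i) (\<lambda>_. 0) N x * (e_poly i N x * HP c N x))" by simp
      qed
      finally show ?thesis .
    qed
    show ?thesis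
      unfolding rec[OF less.prems] rec[OF zero_partitions] using x
      by (simp add: sum_distrib_right mult.assoc)
  qed
qed

lemma sk_coeff_zero:
  assumes "b \<in> partitions" shows "sk_coeff (\<lambda>_. 0) b = q ^ part_n (conjugate b)"
proof -
  obtain L where L: "\<And>k. k \<ge> L \<Longrightarrow> b k = 0" using partitions_bound[OF assms] by blast
  have "sk_coeff (\<lambda>_. 0) b = (\<Prod>k<L. q ^ (b k choose 2))"
    unfolding sk_coeff_def using L by (auto intro!: fprod_eq simp: numeral_2_eq_2)
  moreover have "part_n (conjugate b) = (\<Sum>k<L. b k choose 2)"
    using part_n_eq[of "conjugate b" L] assms L by simp
  ultimately show ?thesis by (simp add: power_sum)
qed

text \<open>Compares the coefficients of \<open>HP d\<close> in the product of
  \<open>sk_op r (\<lambda>_. 0)\<close> with \<open>HP a\<close>, once from the dual Pieri rule and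
  once from the structure constants. The factors \<open>part_b\<close> convert between
  \<open>P\<close> and \<open>Q\<close>.\<close>

theorem sum_hl_coeffs:
  assumes a: "a \<in> partitions" and d: "d \<in> partitions_of (part_size a + r)"
  shows "(\<Sum>b\<in>partitions_of r. hl_coeffs q (conjugate a) (conjugate b) (conjugate d) *
      (q ^ part_n (conjugate b) / part_b q (conjugate b))) =
    sk_coeff a d * part_b q (conjugate a) / part_b q (conjugate d)"
proof -
  let ?PS = "partitions_of (part_size a + r)"
  let ?g = "\<lambda>b d. hl_coeffs q (conjugate a) (conjugate b) (conjugate d)"
  define c where "c d = (\<Sum>b\<in>partitions_of r. ?g b d * (q ^ part_n (conjugate b) / part_b q (conjugate b)))
      * part_b q (conjugate d) / part_b q (conjugate a) - sk_coeff a d" for d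
  have "c d = 0"
  proof (rule HP_independent[where S = ?PS and c = c])
    fix N and x :: "nat \<Rightarrow> real" assume x: "inj_on x {..<N}"
    have prod: "HP b N x * HP a N x = (\<Sum>d\<in>?PS. ?g b d * part_b q (conjugate d) * HP d N x) / (part_b q (conjugate a) * part_b q (conjugate b))"
      if b: "b \<in> partitions_of r" for b
    proof -
      have b': "b \<in> partitions" "part_size b = r" using b by (auto simp: partitions_of_def)
      have "hl_Q q (conjugate a) N x * hl_Q q (conjugate b) N x = (\<Sum>l\<in>?PS. hl_coeffs q (conjugate a) (conjugate b) l * hl_Q q l N x)"
        using hl_coeffs_props(2)[of "conjugate a" "conjugate b" x N] a b' x by simp
      also have "\<dots> = (\<Sum>l\<in>?PS. ?g b (conjugate l) * hl_Q q (conjugate (conjugate l)) N x)"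
        by (rule sum.cong) (auto simp: partitions_of_def)
      also have "\<dots> = (\<Sum>d\<in>?PS. ?g b d * hl_Q q (conjugate d) N x)"
        by (rule sum_partitions_of_conjugate)
      finally show ?thesis by (simp add: hl_Q_conjugate field_simps)
    qed
    have "sk_op r (\<lambda>_. 0) N x = (\<Sum>b\<in>partitions_of r. q ^ part_n (conjugate b) * HP b N x)"
      unfolding sk_op_def by (rule sum.cong) (auto simp: sk_coeff_zero partitions_of_def)
    then have "sk_op r a N x = (\<Sum>b\<in>partitions_of r. q ^ part_n (conjugate b) * (HP b N x * HP a N x))"
      using sk_op_mult[OF a x, of r] by (simp add: sum_distrib_right mult.assoc)
    also have "\<dots> = (\<Sum>b\<in>partitions_of r. \<Sum>d\<in>?PS. ?g b d * (q ^ part_n (conjugate b) / part_b q (conjugate b)) * part_b q (conjugate d) / part_b q (conjugate a) * HP d N x)"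
      by (rule sum.cong) (simp_all add: prod sum_distrib_left sum_divide_distrib mult_ac)
    also have "\<dots> = (\<Sum>d\<in>?PS. (c d + sk_coeff a d) * HP d N x)"
      by (subst sum.swap) (simp add: c_def sum_distrib_right sum_divide_distrib)
    finally show "(\<Sum>d\<in>?PS. c d * HP d N x) = 0"
      by (simp add: sk_op_def distrib_right sum.distrib)
  next
    show "?PS \<subseteq> partitions" by (auto simp: partitions_of_def)
  qed (simp_all add: d)
  then show ?thesis by (simp add: c_def field_simps)
qed

lemma spec_HP:
  assumes "b \<in> partitions" "c \<noteq> 0"
  shows "spec (HP b) (\<lambda>i. c * q ^ i) = c ^ part_size b * q ^ part_n (conjugate b) / part_b q (conjugate b)"
  unfolding spec_def by (rule limI[OF HP_geometric_tendsto[OF assms]])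

text \<open>The leading power of \<open>q\<close> reflects homogeneity, as the variables start with
  \<open>q\<close> instead of \<open>1\<close>. If \<open>a\<close> is larger than \<open>d\<close>,
  the subtraction is truncated, but then both sides vanish.\<close>

lemma spec_hl_skew_P:
  assumes a: "a \<in> partitions" and d: "d \<in> partitions"
  shows "spec (hl_skew_P q (conjugate d) (conjugate a)) (\<lambda>i. q * q ^ i) =
    q ^ (part_size d - part_size a) * sk_coeff a d * part_b q (conjugate a) / part_b q (conjugate d)"
proof (cases "part_size a \<le> part_size d")
  case False
  then have "\<not> (\<forall>k. a k \<le> d k)" using part_size_mono(1)[OF d, of a] by auto
  then have "sk_coeff a d = 0" by (simp only: sk_coeff_def if_False)
  moreover have "{v. v \<in> partitions \<and> hl_coeffs q (conjugate a) v (conjugate d) \<noteq> 0} = {}"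
    using hl_coeffs_props(1)[of "conjugate a" _ "conjugate d"] a d False by (fastforce simp: partitions_of_def)
  then have "hl_skew_P q (conjugate d) (conjugate a) N x = 0" for N x
    unfolding hl_skew_P_def by simp
  then have "spec (hl_skew_P q (conjugate d) (conjugate a)) (\<lambda>i. q * q ^ i) = 0"
    by (simp add: spec_def)
  ultimately show ?thesis by simp
next
  case True
  define r where "r = part_size d - part_size a"
  have d': "d \<in> partitions_of (part_size a + r)" using d True by (simp add: partitions_of_def r_def)
  let ?g = "\<lambda>b. hl_coeffs q (conjugate a) (conjugate b) (conjugate d)"
  have skew: "hl_skew_P q (conjugate d) (conjugate a) N x = (\<Sum>b\<in>partitions_of r. ?g b * HP b N x)" for N x
  proof -
    have "hl_skew_P q (conjugate d) (conjugate a) N x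
        = (\<Sum>v\<in>partitions_of r. hl_coeffs q (conjugate a) v (conjugate d) * hl_P q v N x)"
      unfolding hl_skew_P_def
    proof (rule sum.mono_neutral_left)
      show "{v. v \<in> partitions \<and> hl_coeffs q (conjugate a) v (conjugate d) \<noteq> 0} \<subseteq> partitions_of r"
        using hl_coeffs_props(1)[of "conjugate a" _ "conjugate d"] a d by (fastforce simp: partitions_of_def r_def)
    qed (use finite_partitions_of[of r] in \<open>auto simp: partitions_of_def\<close>)
    also have "\<dots> = (\<Sum>v\<in>partitions_of r. ?g (conjugate v) * HP (conjugate v) N x)"
      by (rule sum.cong) (auto simp: HP_def partitions_of_def)
    also have "\<dots> = (\<Sum>b\<in>partitions_of r. ?g b * HP b N x)"
      by (rule sum_partitions_of_conjugate[where f = "\<lambda>b. ?g b * HP b N x"])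
    finally show ?thesis .
  qed
  have "(\<lambda>N. hl_skew_P q (conjugate d) (conjugate a) N (\<lambda>i. q * q ^ i)) \<longlonglongrightarrow>
      (\<Sum>b\<in>partitions_of r. ?g b * (q ^ part_size b * q ^ part_n (conjugate b) / part_b q (conjugate b)))"
    unfolding skew using q_pos
    by (intro tendsto_sum tendsto_mult tendsto_const HP_geometric_tendsto) (auto simp: partitions_of_def)
  then have "spec (hl_skew_P q (conjugate d) (conjugate a)) (\<lambda>i. q * q ^ i) =
      (\<Sum>b\<in>partitions_of r. ?g b * (q ^ part_size b * q ^ part_n (conjugate b) / part_b q (conjugate b)))"
    unfolding spec_def by (rule limI)
  also have "\<dots> = q ^ r * (\<Sum>b\<in>partitions_of r. ?g b * (q ^ part_n (conjugate b) / part_b q (conjugate b)))"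
    unfolding sum_distrib_left by (rule sum.cong) (auto simp: partitions_of_def)
  finally show ?thesis unfolding sum_hl_coeffs[OF a d'] by (simp add: r_def)
qed

text \<open>The constant \<open>part_b\<close> of \<open>d\<close> cancels in the quotient, and that
  of \<open>a\<close> cancels the denominators \<open>qq (a k - a (Suc k))\<close> in
  \<open>sk_coeff\<close>; a product over columns remains.\<close>

theorem Sur_eq:
  assumes a: "a \<in> partitions" and d: "d \<in> partitions"
  shows "Sur (1 / q) (conjugate d) (conjugate a) = (if \<forall>k. a k \<le> d k
    then fprod (\<lambda>k. qq (d k - a (Suc k)) / qq (d k - a k) / q ^ (d k * a k)) else 0)"
proof -
  have "part_b q (conjugate a) * (q ^ part_n (conjugate a) / part_b q (conjugate a)) = spec (hl_Q q (conjugate a)) (\<lambda>i. q ^ i)"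
  proof -
    have "(\<lambda>N. hl_Q q (conjugate a) N (\<lambda>i. q ^ i)) \<longlonglongrightarrow> part_b q (conjugate a) * (q ^ part_n (conjugate a) / part_b q (conjugate a))"
      unfolding hl_Q_conjugate using HP_geometric_tendsto[OF a, of 1]
      by (intro tendsto_mult tendsto_const) simp
    then show ?thesis unfolding spec_def by (rule limI[symmetric])
  qed
  then have Qa: "spec (hl_Q q (conjugate a)) (\<lambda>i. q ^ i) = q ^ part_n (conjugate a)" by simp
  have Sur: "Sur (1 / q) (conjugate d) (conjugate a) =
     (q ^ (part_size d - part_size a) * sk_coeff a d * part_b q (conjugate a) / part_b q (conjugate d))
      / (q ^ part_size d * q ^ part_n (conjugate d) / part_b q (conjugate d) * q ^ part_n (conjugate a))"
    using spec_hl_skew_P[OF a d] spec_HP[OF d, of q] q_pos Qa by (simp add: Sur_def HP_def)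
  show ?thesis
  proof (cases "\<forall>k. a k \<le> d k")
    case True
    obtain L where L: "\<And>k. k \<ge> L \<Longrightarrow> d k = 0" using partitions_bound[OF d] by blast
    have La: "a k = 0" if "k \<ge> L" for k using L[OF that] True by (metis le_zero_eq)
    have size: "part_size a \<le> part_size d" using part_size_mono(1)[OF d] True by blast
    have "part_size a = (\<Sum>k<L. a k)" by (rule part_size_eq) (rule La)
    moreover have "part_n (conjugate a) = (\<Sum>k<L. a k choose 2)" "part_n (conjugate d) = (\<Sum>k<L. d k choose 2)"
      using part_n_eq[of "conjugate a" L] part_n_eq[of "conjugate d" L] a d La L by simp_all
    moreover have "sk_coeff a d = (\<Prod>k<L. q ^ ((d k - a k) choose 2) * qbinom q (d k - a (Suc k)) (a k - a (Suc k)))"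
      unfolding sk_coeff_def using True by (auto intro!: fprod_eq simp: La L numeral_2_eq_2)
    moreover have "part_b q (conjugate a) = (\<Prod>k<L. qq (a k - a (Suc k)))"
      using part_b_eq[of "conjugate a" q] a fprod_eq[of L "\<lambda>k. qq (a k - a (Suc k))"] by (simp add: La)
    moreover have "q ^ part_size d = q ^ (part_size d - part_size a) * q ^ part_size a"
      using size by (simp flip: power_add)
    ultimately have "Sur (1 / q) (conjugate d) (conjugate a) =
      (\<Prod>k<L. q ^ ((d k - a k) choose 2) * qbinom q (d k - a (Suc k)) (a k - a (Suc k))) * (\<Prod>k<L. qq (a k - a (Suc k)))
       / ((\<Prod>k<L. q ^ a k) * (\<Prod>k<L. q ^ (d k choose 2)) * (\<Prod>k<L. q ^ (a k choose 2)))"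
      unfolding Sur using q_pos by (simp add: power_sum)
    also have "\<dots> = (\<Prod>k<L. qq (d k - a (Suc k)) / qq (d k - a k) / q ^ (d k * a k))"
      unfolding prod.distrib[symmetric] prod_dividef[symmetric]
    proof (rule prod.cong)
      fix k
      have le: "a (Suc k) \<le> a k" "a k \<le> d k" using partitions_mono[OF a] True by auto
      then have "d k - a (Suc k) - (a k - a (Suc k)) = d k - a k" by simp
      then have 1: "qbinom q (d k - a (Suc k)) (a k - a (Suc k)) * qq (a k - a (Suc k)) = qq (d k - a (Suc k)) / qq (d k - a k)"
        using le by (simp add: qbinom_def)
      \<comment> \<open>The powers of \<open>q\<close> from the dual Pieri rule and from the three
        specialisations combine within each column to \<open>1 / q ^ (d k * a k)\<close>.\<close>
      have "((d k - a k) choose 2) + d k * a k = a k + (d k choose 2) + (a k choose 2)"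
      proof -
        obtain m where m: "d k = a k + m" using le(2) le_Suc_ex by blast
        show ?thesis
          using square_eq_choose_two[of "a k"] by (simp add: m choose_two_add algebra_simps)
      qed
      then have 2: "q ^ ((d k - a k) choose 2) * q ^ (d k * a k) = q ^ a k * q ^ (d k choose 2) * q ^ (a k choose 2)"
        by (simp flip: power_add)
      have "X * B * B' / (E * F * G) = Q / C / P" if "B * B' = Q / C" "X * P = E * F * G" "E \<noteq> 0" "F \<noteq> 0" "G \<noteq> 0" "P \<noteq> 0"
        for X B B' E F G Q C P :: real
        proof -
        have "X * B * B' = X * (Q / C)" using that(1) by (simp add: mult.assoc)
        moreover have "X = E * F * G / P" using that by (simp add: field_simps)
        ultimately show ?thesis using that by simp
      qed
      from this[OF 1 2] show "q ^ ((d k - a k) choose 2) * qbinom q (d k - a (Suc k)) (a k - a (Suc k)) * qq (a k - a (Suc k)) /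
         (q ^ a k * q ^ (d k choose 2) * q ^ (a k choose 2)) = qq (d k - a (Suc k)) / qq (d k - a k) / q ^ (d k * a k)"
        using q_pos by simp
    qed simp
    also have "\<dots> = fprod (\<lambda>k. qq (d k - a (Suc k)) / qq (d k - a k) / q ^ (d k * a k))"
      by (rule fprod_eq[symmetric]) (simp add: La L)
    finally show ?thesis using True by simp
  next
    case False
    then have "sk_coeff a d = 0" by (simp only: sk_coeff_def if_False)
    then show ?thesis unfolding Sur if_not_P[OF False] by simp
  qed
qed

end

section \<open>Summation over columns\<close>

lemma finite_subset_incseq:
  assumes "finite X" "incseq F" "X \<subseteq> (\<Union>L. F L)"
  shows "\<exists>L. X \<subseteq> F L"
  using assms(1,3)
proof (induction X rule: finite_induct)
  case (insert x X)
  then obtain L M where "X \<subseteq> F L" "x \<in> F M" by auto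
  moreover have "F L \<subseteq> F (max L M)" "F M \<subseteq> F (max L M)" using assms(2) by (auto simp: incseq_def)
  ultimately show ?case by blast
qed simp

text \<open>For nonnegative terms, convergence along one increasing exhaustion by finite sets bounds
  all finite sums and determines the unordered sum.\<close>

lemma has_sum_exhaustion:
  fixes f :: "'a \<Rightarrow> real"
  assumes nonneg: "\<And>x. x \<in> S \<Longrightarrow> f x \<ge> 0" and fin: "\<And>L. finite (F L)" and inc: "incseq F"
    and S: "(\<Union>L. F L) = S" and lim: "(\<lambda>L. sum f (F L)) \<longlonglongrightarrow> l"
  shows "(f has_sum l) S"
proof -
  have sub: "F L \<subseteq> S" for L using S by auto
  have "incseq (\<lambda>L. sum f (F L))"
    using inc fin sub nonneg by (auto simp: incseq_def subset_iff intro!: sum_mono2)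
  then have le: "sum f (F L) \<le> l" for L using incseq_le[OF _ lim] by blast
  have "f summable_on S"
  proof (rule nonneg_bdd_above_summable_on)
    show "bdd_above (sum f ` {X. X \<subseteq> S \<and> finite X})"
    proof (rule bdd_aboveI2)
      fix X assume X: "X \<in> {X. X \<subseteq> S \<and> finite X}"
      then obtain L where "X \<subseteq> F L" using finite_subset_incseq[of X F] inc S by auto
      then have "sum f X \<le> sum f (F L)" using fin by (intro sum_mono2) (auto intro: nonneg subsetD[OF sub])
      then show "sum f X \<le> l" using le[of L] by simp
    qed
  qed (rule nonneg)
  then have "(f has_sum infsum f S) S" by simp
  moreover have "filterlim F (finite_subsets_at_top S) sequentially"
    unfolding filterlim_iff eventually_finite_subsets_at_top
  proof (intro allI impI)
    fix P assume "\<exists>X. finite X \<and> X \<subseteq> S \<and> (\<forall>Y. finite Y \<and> X \<subseteq> Y \<and> Y \<subseteq> S \<longrightarrow> P Y)"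
    then obtain X where X: "finite X" "X \<subseteq> S" "\<And>Y. finite Y \<Longrightarrow> X \<subseteq> Y \<Longrightarrow> Y \<subseteq> S \<Longrightarrow> P Y" by metis
    obtain L where "X \<subseteq> F L" using finite_subset_incseq[OF X(1) inc] X(2) S by auto
    then have "P (F M)" if "L \<le> M" for M
      using X(3)[OF fin _ sub] incseqD[OF inc that] by blast
    then show "eventually (\<lambda>L. P (F L)) sequentially" by (auto simp: eventually_sequentially)
  qed
  ultimately have "(\<lambda>L. sum f (F L)) \<longlonglongrightarrow> infsum f S"
    unfolding has_sum_def by (rule filterlim_compose)
  then show ?thesis using LIMSEQ_unique[OF lim] \<open>(f has_sum infsum f S) S\<close> by simp
qed

definition parts_le :: "nat \<Rightarrow> (nat \<Rightarrow> nat) set" where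
  "parts_le A = {a \<in> partitions. a 0 \<le> A}"

abbreviation tail :: "(nat \<Rightarrow> nat) \<Rightarrow> nat \<Rightarrow> nat" where
  "tail a \<equiv> \<lambda>k. a (Suc k)"

lemma tail_parts_le: "a \<in> partitions \<Longrightarrow> tail a \<in> parts_le (a 0)"
proof -
  assume a: "a \<in> partitions"
  obtain L where L: "\<And>i. i \<ge> L \<Longrightarrow> a i = 0" using partitions_bound[OF a] by blast
  have "tail a \<in> partitions"
    by (rule partitionsI[where L = L]) (use L partitions_mono[OF a] in auto)
  then show ?thesis using partitions_mono[OF a, of 0 1] by (simp add: parts_le_def)
qed

lemma case_nat_partitions: "a \<in> parts_le b \<Longrightarrow> case_nat b a \<in> partitions"
proof -
  assume "a \<in> parts_le b"
  then have a: "a \<in> partitions" "a 0 \<le> b" by (auto simp: parts_le_def)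
  obtain L where L: "\<And>i. i \<ge> L \<Longrightarrow> a i = 0" using partitions_bound[OF a(1)] by blast
  show ?thesis
  proof (rule partitionsI[where L = "Suc L"])
    show "case_nat b a (Suc k) \<le> case_nat b a k" for k
      using partitions_mono[OF a(1), of _ "Suc _"] a(2) by (cases k) auto
    show "case_nat b a k = 0" if "k \<ge> Suc L" for k using that L by (cases k) auto
  qed
qed

lemma bij_betw_tail:
  "bij_betw (\<lambda>(b, a). case_nat b a) (SIGMA b:S. parts_le b) {a \<in> partitions. a 0 \<in> S}"
proof (rule bij_betw_byWitness[where f' = "\<lambda>a. (a 0, tail a)"])
  show "\<forall>a\<in>{a \<in> partitions. a 0 \<in> S}. (case (a 0, tail a) of (b, a) \<Rightarrow> case_nat b a) = a"
    by (auto simp: fun_eq_iff split: nat.split)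
qed (auto simp: case_nat_partitions tail_parts_le)

section \<open>Column weights and the sums over tails of columns\<close>

locale moment_sum = q_param +
  fixes n :: nat and u :: "nat \<Rightarrow> nat"
  assumes n: "n \<ge> 1" and u: "u \<in> partitions"
begin

text \<open>With \<open>b = \<lambda>'\<^sub>k\<^sub>+\<^sub>1\<close> and \<open>m = \<lambda>'\<^sub>k - \<lambda>'\<^sub>k\<^sub>+\<^sub>1\<close> (where \<open>\<lambda>'\<^sub>0\<close> is read as \<open>d\<close>), column \<open>k + 1\<close>
  contributes the factor \<open>gap_weight k m * col_weight k b\<close> to the summand of the moment, up to the
  global constant \<open>(q;q)\<^sub>d\<close>.\<close>

definition col_weight :: "nat \<Rightarrow> nat \<Rightarrow> real" where
  "col_weight k b = (if u k \<le> b then q ^ (b * b) / q ^ (b * u k) * (qq (b - u (Suc k)) / qq (b - u k))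
     * (if k < n then 1 / q ^ (b choose 2) else 1) * (if Suc k = n then qq b else 1) else 0)"

definition gap_weight :: "nat \<Rightarrow> nat \<Rightarrow> real" where
  "gap_weight k m = (if k < n then half_qq m else 1) / qq m"

text \<open>\<open>A\<close> is the length of the column just before those listed in
  \<open>a\<close>, which \<open>case_nat\<close> puts in front to form the gaps.\<close>

definition tail_weight :: "nat \<Rightarrow> nat \<Rightarrow> (nat \<Rightarrow> nat) \<Rightarrow> real" where
  "tail_weight k A a = fprod (\<lambda>i. gap_weight (k + i) (case_nat A a i - a i) * col_weight (k + i) (a i))"

text \<open>The closed form of the sum of \<open>tail_weight k A\<close> over
  \<open>parts_le A\<close>. The extra denominator \<open>qq A\<close> for \<open>k \<ge> n\<close>
  disappears at the column with \<open>Suc k = n\<close>, whose weight contains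
  \<open>qq b\<close>.\<close>

definition tail_value :: "nat \<Rightarrow> nat \<Rightarrow> real" where
  "tail_value k A = (if u k \<le> A then (\<Prod>j\<in>{k..<n}. 1 / q ^ (u j choose 2)) / (qq (A - u k) * (if k < n then 1 else qq A)) else 0)"

lemma col_weight_nonneg: "col_weight k b \<ge> 0"
  using q_pos by (simp add: col_weight_def less_imp_le)

lemma gap_weight_nonneg: "gap_weight k m \<ge> 0"
  using half_qq_nonneg by (simp add: gap_weight_def less_imp_le)

lemma tail_weight_nonneg: "tail_weight k A a \<ge> 0"
  unfolding tail_weight_def fprod_def by (intro prod_nonneg mult_nonneg_nonneg ballI gap_weight_nonneg col_weight_nonneg)

text \<open>From such a \<open>J\<close> on, the weights no longer depend on the position of the
  column.\<close>

lemma u_bound: obtains J where "J \<ge> n" "\<And>k. k \<ge> J \<Longrightarrow> u k = 0"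
proof -
  obtain J where "\<And>k. k \<ge> J \<Longrightarrow> u k = 0" using partitions_bound[OF u] by blast
  then show ?thesis using that[of "max J n"] by simp
qed

lemma half_qq_0 [simp]: "half_qq 0 = 1"
  by (simp add: half_qq_def)

lemma trivial_weight: "gap_weight k 0 = 1" "u k = 0 \<Longrightarrow> u (Suc k) = 0 \<Longrightarrow> col_weight k 0 = 1"
  by (simp_all add: gap_weight_def col_weight_def numeral_2_eq_2)

lemma tail_weight_eventually:
  assumes a: "a \<in> partitions"
  obtains L where "\<And>i. i \<ge> L \<Longrightarrow> gap_weight (k + i) (case_nat A a i - a i) * col_weight (k + i) (a i) = 1"
proof -
  obtain L where L: "\<And>i. i \<ge> L \<Longrightarrow> a i = 0" using partitions_bound[OF a] by blast
  obtain J where J: "\<And>i. i \<ge> J \<Longrightarrow> u i = 0" using u_bound by blast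
  have "gap_weight (k + i) (case_nat A a i - a i) * col_weight (k + i) (a i) = 1" if i: "i \<ge> Suc (max L J)" for i
  proof -
    obtain i' where i': "i = Suc i'" using i by (cases i) auto
    have "a i = 0" "a i' = 0" "u (k + i) = 0" "u (Suc (k + i)) = 0" using i i' L J by auto
    then show ?thesis using i' by (simp add: trivial_weight)
  qed
  then show ?thesis by (rule that)
qed

lemma tail_weight_Suc:
  assumes "a \<in> partitions"
  shows "tail_weight k A a = gap_weight k (A - a 0) * col_weight k (a 0) * tail_weight (Suc k) (a 0) (tail a)"
proof -
  obtain L where L: "\<And>i. i \<ge> L \<Longrightarrow> gap_weight (k + i) (case_nat A a i - a i) * col_weight (k + i) (a i) = 1"
    using tail_weight_eventually[OF assms, of k A] by blast
  define f where "f i = gap_weight (k + i) (case_nat A a i - a i) * col_weight (k + i) (a i)" for i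
  have "f (Suc i) = gap_weight (Suc k + i) (case_nat (a 0) (tail a) i - tail a i) * col_weight (Suc k + i) (tail a i)" for i
    by (cases i) (simp_all add: f_def)
  then have "tail_weight (Suc k) (a 0) (tail a) = fprod (\<lambda>i. f (Suc i))"
    by (simp only: tail_weight_def)
  moreover have "fprod f = f 0 * fprod (\<lambda>i. f (Suc i))"
    by (rule fprod_Suc[where L = L]) (simp only: f_def L)
  moreover have "tail_weight k A a = fprod f"
    unfolding tail_weight_def f_def ..
  ultimately show ?thesis by (simp add: f_def)
qed

text \<open>The numerator \<open>qq (b - u (Suc k))\<close> of the column weight cancels the
  denominator of the next tail value. What is left no longer involves \<open>u (Suc k)\<close>
  through the current column length, so the sum over \<open>b\<close> is a standard
  q-series.\<close>

lemma tail_value_mult: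
  assumes "u k \<le> b"
  shows "col_weight k b * tail_value (Suc k) b =
    (if k < n then (\<Prod>j\<in>{k..<n}. 1 / q ^ (u j choose 2)) * (q ^ (Suc (b - u k) choose 2) / qq (b - u k))
     else q ^ ((b - u k) * b) / (qq (b - u k) * qq b))"
proof -
  have le: "u (Suc k) \<le> b" using partitions_mono[OF u, of k "Suc k"] assms by simp
  obtain j where j: "b = u k + j" using assms le_Suc_ex by blast
  have 1: "q ^ (b * b) / q ^ (b * u k) = q ^ (j * b)"
    using q_pos by (simp add: j add_mult_distrib add_mult_distrib2 power_add mult.commute)
  show ?thesis
  proof (cases "k < n")
    case True
    have "j * b + (u k choose 2) = (Suc j choose 2) + (b choose 2)"
      using square_eq_choose_two[of j] by (simp add: j choose_two_add choose_two_Suc algebra_simps)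
    then have "q ^ (j * b) * q ^ (u k choose 2) = q ^ (Suc j choose 2) * q ^ (b choose 2)"
      by (simp flip: power_add)
    then have 2: "q ^ (j * b) / q ^ (b choose 2) = q ^ (Suc j choose 2) / q ^ (u k choose 2)"
      using q_pos by (simp add: field_simps)
    have "{k..<n} = insert k {Suc k..<n}" using True by auto
    then have p: "(\<Prod>j\<in>{k..<n}. 1 / q ^ (u j choose 2)) = 1 / q ^ (u k choose 2) * (\<Prod>j\<in>{Suc k..<n}. 1 / q ^ (u j choose 2))"
      by simp
    have "col_weight k b * tail_value (Suc k) b =
      (q ^ (j * b) / q ^ (b choose 2)) * (\<Prod>j\<in>{Suc k..<n}. 1 / q ^ (u j choose 2)) / qq (b - u k)"
      using assms le True by (auto simp: col_weight_def tail_value_def 1)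
    then show ?thesis unfolding 2 p using True j by simp
  next
    case False
    then show ?thesis using assms le 1 j by (simp add: col_weight_def tail_value_def)
  qed
qed

text \<open>With \<open>b = u k + j\<close> this is \<open>sum_half_qq\<close> for the first
  \<open>n\<close> columns and \<open>q_vandermonde\<close> with \<open>s = u k\<close>
  afterwards.\<close>

lemma sum_tail_value:
  "(\<Sum>b\<le>A. gap_weight k (A - b) * col_weight k b * tail_value (Suc k) b) = tail_value k A"
proof (cases "u k \<le> A")
  case False
  then have "col_weight k b = 0" if "b \<le> A" for b using that by (simp add: col_weight_def)
  then show ?thesis using False by (simp add: tail_value_def)
next
  case True
  define m where "m = A - u k"
  have A: "A = u k + m" using True by (simp add: m_def)
  have "(\<Sum>b\<le>A. gap_weight k (A - b) * col_weight k b * tail_value (Suc k) b)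
      = (\<Sum>b\<in>{u k..A}. gap_weight k (A - b) * (col_weight k b * tail_value (Suc k) b))"
    by (rule sum.mono_neutral_cong_right) (auto simp: col_weight_def)
  also have "\<dots> = (\<Sum>j\<le>m. gap_weight k (m - j) * (col_weight k (u k + j) * tail_value (Suc k) (u k + j)))"
    by (rule sum.reindex_bij_witness[of _ "\<lambda>j. u k + j" "\<lambda>b. b - u k"]) (use True in \<open>auto simp: m_def\<close>)
  also have "\<dots> = tail_value k A"
  proof (cases "k < n")
    case True
    let ?C = "\<Prod>j\<in>{k..<n}. 1 / q ^ (u j choose 2)"
    have "(\<Sum>j\<le>m. gap_weight k (m - j) * (col_weight k (u k + j) * tail_value (Suc k) (u k + j)))
      = (\<Sum>j\<le>m. ?C / qq m * (q ^ (Suc j choose 2) * qbinom q m j * half_qq (m - j)))"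
      using True by (intro sum.cong) (auto simp: tail_value_mult gap_weight_def qbinom_def mult_ac)
    also have "\<dots> = ?C / qq m"
      unfolding sum_distrib_left[symmetric] sum_half_qq by simp
    finally show ?thesis using True by (simp add: tail_value_def A)
  next
    case False
    have "(\<Sum>j\<le>m. gap_weight k (m - j) * (col_weight k (u k + j) * tail_value (Suc k) (u k + j)))
      = (\<Sum>j\<le>m. 1 / qq m * (q ^ (j * (j + u k)) * qbinom q m j / qq (u k + j)))"
      using False by (intro sum.cong) (auto simp: tail_value_mult gap_weight_def qbinom_def mult_ac add.commute)
    also have "\<dots> = 1 / (qq m * qq (m + u k))"
      unfolding sum_distrib_left[symmetric] q_vandermonde by simp
    finally show ?thesis using False by (simp add: tail_value_def A add.commute)
  qed
  finally show ?thesis .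
qed

text \<open>Nonnegativity justifies iterated summation, over the tail first and then over the
  leading column.\<close>

lemma has_sum_Sigma_parts:
  fixes w :: "nat \<Rightarrow> real"
  assumes w: "\<And>b. b \<in> S \<Longrightarrow> w b \<ge> 0"
    and f: "\<And>a. a \<in> partitions \<Longrightarrow> a 0 \<in> S \<Longrightarrow> f a = w (a 0) * tail_weight k (a 0) (tail a)"
    and T: "\<And>b. b \<in> S \<Longrightarrow> w b \<noteq> 0 \<Longrightarrow> (tail_weight k b has_sum tail_value k b) (parts_le b)"
    and V: "((\<lambda>b. w b * tail_value k b) has_sum s) S"
  shows "(f has_sum s) {a \<in> partitions. a 0 \<in> S}"
proof -
  let ?g = "\<lambda>(b, a). w b * tail_weight k b a"
  have inner: "((\<lambda>a. ?g (b, a)) has_sum (w b * tail_value k b)) (parts_le b)" if "b \<in> S" for b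
  proof (cases "w b = 0")
    case False
    then show ?thesis using has_sum_cmult_right[OF T[OF that False], of "w b"] by simp
  qed simp
  have "?g summable_on (SIGMA b:S. parts_le b)"
    by (rule summable_on_SigmaI[OF inner has_sum_imp_summable[OF V]])
      (use w tail_weight_nonneg in \<open>auto intro: mult_nonneg_nonneg\<close>)
  then have "(?g has_sum s) (SIGMA b:S. parts_le b)"
    using has_sum_SigmaI[where f = ?g and g = "\<lambda>b. w b * tail_value k b" and A = S and B = parts_le and S = s] inner V by blast
  moreover have "?g p = f ((\<lambda>(b, a). case_nat b a) p)" if "p \<in> (SIGMA b:S. parts_le b)" for p
    using that f[OF case_nat_partitions] by auto
  ultimately have "((\<lambda>p. f ((\<lambda>(b, a). case_nat b a) p)) has_sum s) (SIGMA b:S. parts_le b)"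
    using has_sum_cong[of "SIGMA b:S. parts_le b" ?g "\<lambda>p. f ((\<lambda>(b, a). case_nat b a) p)"] by blast
  then show ?thesis using has_sum_reindex_bij_betw[OF bij_betw_tail[of S]] by blast
qed

text \<open>Here the weights are stationary, so the recursion expresses \<open>v A\<close> through
  the \<open>v b\<close> with \<open>b \<le> A\<close>, including \<open>v A\<close> itself. The
  truncated sums increase and stay below \<open>v\<close>. Their limit solves the same equation, and
  for \<open>A > 0\<close> the coefficient \<open>c A A = q ^ (A * A)\<close> is less than
  \<open>1\<close>, which forces equality by induction on \<open>A\<close>.\<close>

lemma tail_weight_base:
  assumes J: "J \<ge> n" "\<And>k. k \<ge> J \<Longrightarrow> u k = 0"
  shows "(tail_weight J A has_sum tail_value J A) (parts_le A)"
proof -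
  define c where "c A b = gap_weight J (A - b) * col_weight J b" for A b
  define trunc where "trunc L A = {a \<in> parts_le A. \<forall>i\<ge>L. a i = 0}" for L A
  define \<tau> where "\<tau> L A = (\<Sum>a\<in>trunc L A. tail_weight J A a)" for L A
  define v where "v = tail_value J"
  have c_nonneg: "c A b \<ge> 0" for A b
    by (simp add: c_def gap_weight_nonneg col_weight_nonneg)
  have w_eq: "tail_weight k A a = tail_weight J A a" if "k \<ge> J" for k A a
    unfolding tail_weight_def using J that by (simp add: gap_weight_def col_weight_def)
  have v_Suc: "tail_value (Suc J) = v" using J by (simp add: fun_eq_iff v_def tail_value_def)
  have v_rec: "v A = (\<Sum>b\<le>A. c A b * v b)" for A
    using sum_tail_value[where A = A and k = J] v_Suc by (simp add: v_def c_def)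
  have v_nonneg: "v A \<ge> 0" for A using J(1) by (simp add: v_def tail_value_def less_imp_le)
  have trunc_0: "trunc 0 A = {\<lambda>_. 0}" for A by (auto simp: trunc_def parts_le_def)
  have trunc_Suc: "bij_betw (\<lambda>(b, a). case_nat b a) (SIGMA b:{..A}. trunc L b) (trunc (Suc L) A)" for L A
  proof (rule bij_betw_byWitness[where f' = "\<lambda>a. (a 0, tail a)"])
    show "\<forall>a\<in>trunc (Suc L) A. (case (a 0, tail a) of (b, a) \<Rightarrow> case_nat b a) = a"
      by (auto simp: fun_eq_iff split: nat.split)
    show "(\<lambda>a. (a 0, tail a)) ` trunc (Suc L) A \<subseteq> (SIGMA b:{..A}. trunc L b)"
      using tail_parts_le by (auto simp: trunc_def parts_le_def)
    show "(\<lambda>(b, a). case_nat b a) ` (SIGMA b:{..A}. trunc L b) \<subseteq> trunc (Suc L) A"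
      using case_nat_partitions by (auto simp: trunc_def parts_le_def split: nat.split)
  qed auto
  have fin: "finite (trunc L A)" for L A
  proof (induction L arbitrary: A)
    case (Suc L) then show ?case using bij_betw_finite[OF trunc_Suc, of A L] by simp
  qed (simp add: trunc_0)
  have \<tau>_Suc: "\<tau> (Suc L) A = (\<Sum>b\<le>A. c A b * \<tau> L b)" for L A
  proof -
    have "\<tau> (Suc L) A = (\<Sum>(b, a)\<in>(SIGMA b:{..A}. trunc L b). tail_weight J A (case_nat b a))"
      unfolding \<tau>_def using sum.reindex_bij_betw[OF trunc_Suc, of "tail_weight J A" A L, symmetric]
      by (simp add: case_prod_beta')
    also have "\<dots> = (\<Sum>b\<le>A. \<Sum>a\<in>trunc L b. tail_weight J A (case_nat b a))"
      using fin by (subst sum.Sigma) auto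
    also have "\<dots> = (\<Sum>b\<le>A. \<Sum>a\<in>trunc L b. c A b * tail_weight J b a)"
    proof (intro sum.cong refl)
      fix b a assume "a \<in> trunc L b"
      then have "case_nat b a \<in> partitions" by (auto simp: trunc_def case_nat_partitions)
      from tail_weight_Suc[OF this, of J A]
      show "tail_weight J A (case_nat b a) = c A b * tail_weight J b a"
        using w_eq[of "Suc J"] by (simp add: c_def)
    qed
    finally show ?thesis by (simp add: \<tau>_def sum_distrib_left)
  qed
  have "case_nat 0 (\<lambda>_. 0 :: nat) = (\<lambda>_. 0)" by (auto split: nat.split)
  then have weight_0: "tail_weight J 0 (\<lambda>_. 0) = 1"
    using J by (simp add: tail_weight_def trivial_weight fprod_def)
  have \<tau>_mono: "\<tau> L A \<le> \<tau> (Suc L) A" for L A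
    unfolding \<tau>_def using fin by (intro sum_mono2) (auto simp: trunc_def tail_weight_nonneg)
  have \<tau>_le: "\<tau> L A \<le> v A" for L A
  proof (induction L arbitrary: A)
    case 0
    have "\<tau> 0 A = 1 / qq A"
      using tail_weight_Suc[of "\<lambda>_. 0" J A] J w_eq[of "Suc J"] weight_0
      by (simp add: \<tau>_def trunc_0 trivial_weight) (simp add: gap_weight_def)
    \<comment> \<open>In this range \<open>v A\<close> is \<open>1 / (qq A * qq A)\<close>, and
      \<open>qq A\<close> is at most \<open>1\<close>.\<close>
    also have "\<dots> \<le> v A"
      using J qq_antimono[of 0 A] by (simp add: v_def tail_value_def divide_simps mult_le_cancel_left1)
    finally show ?case .
  next
    case (Suc L)
    show ?case unfolding \<tau>_Suc v_rec[of A] using Suc c_nonneg by (intro sum_mono mult_left_mono)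
  qed
  have lim: "(\<lambda>L. \<tau> L A) \<longlonglongrightarrow> v A" for A
  proof (induction A rule: less_induct)
    case (less A)
    have "incseq (\<lambda>L. \<tau> L A)" by (intro incseq_SucI \<tau>_mono)
    moreover have "\<forall>L. \<tau> L A \<le> v A" by (simp add: \<tau>_le)
    ultimately obtain t where t: "(\<lambda>L. \<tau> L A) \<longlonglongrightarrow> t"
      by (rule incseq_convergent)
    show ?case
    proof (cases "A = 0")
      case True
      have "\<tau> L 0 = v 0" for L
      proof -
        have "a = (\<lambda>_. 0)" if "a \<in> trunc L 0" for a
        proof
          fix i show "a i = 0" using that partitions_mono[of a 0 i] by (simp add: trunc_def parts_le_def)
        qed
        then have "trunc L 0 = {\<lambda>_. 0}" by (auto simp: trunc_def parts_le_def)
        then have "\<tau> L 0 = \<tau> 0 0" by (simp add: \<tau>_def trunc_0)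
        also have "\<dots> = v 0" using J weight_0 by (simp add: \<tau>_def trunc_0 v_def tail_value_def)
        finally show ?thesis .
      qed
      then show ?thesis using True by simp
    next
      case False
      have split: "(\<Sum>b\<le>A. f b) = f A + (\<Sum>b<A. f b)" for f :: "nat \<Rightarrow> real"
        by (cases A) (auto simp: lessThan_Suc_atMost)
      have "(\<lambda>L. c A A * \<tau> L A + (\<Sum>b<A. c A b * \<tau> L b)) \<longlonglongrightarrow> c A A * t + (\<Sum>b<A. c A b * v b)"
        using less t by (intro tendsto_add tendsto_mult tendsto_sum tendsto_const) auto
      then have "(\<lambda>L. \<tau> (Suc L) A) \<longlonglongrightarrow> c A A * t + (\<Sum>b<A. c A b * v b)"
        unfolding \<tau>_Suc split .
      then have "t = c A A * t + (\<Sum>b<A. c A b * v b)"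
        using LIMSEQ_Suc[OF t] LIMSEQ_unique by blast
      moreover have "v A = c A A * v A + (\<Sum>b<A. c A b * v b)"
        using v_rec[of A] unfolding split .
      ultimately have "(t - v A) * (1 - c A A) = 0" by (simp add: algebra_simps)
      moreover have "c A A < 1"
        using J False q_power_less_1[of "A * A"] by (simp add: c_def gap_weight_def col_weight_def)
      ultimately have "t = v A" by simp
      then show ?thesis using t by simp
    qed
  qed
  show ?thesis
  proof (rule has_sum_exhaustion[where F = "\<lambda>L. trunc L A"])
    show "incseq (\<lambda>L. trunc L A)" by (auto simp: incseq_def trunc_def)
    show "(\<Union>L. trunc L A) = parts_le A"
    proof (intro equalityI subsetI)
      fix a assume a: "a \<in> parts_le A"
      then obtain L where "\<And>i. i \<ge> L \<Longrightarrow> a i = 0" using partitions_bound[of a] by (auto simp: parts_le_def)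
      then show "a \<in> (\<Union>L. trunc L A)" using a by (auto simp: trunc_def)
    qed (auto simp: trunc_def)
    show "(\<lambda>L. sum (tail_weight J A) (trunc L A)) \<longlonglongrightarrow> tail_value J A"
      using lim[of A] by (simp add: \<tau>_def v_def)
  qed (simp_all add: fin tail_weight_nonneg)
qed

theorem tail_weight_has_sum: "(tail_weight k A has_sum tail_value k A) (parts_le A)"
proof -
  obtain J where J: "J \<ge> n" "\<And>k. k \<ge> J \<Longrightarrow> u k = 0" using u_bound by blast
  show ?thesis
  proof (cases "k \<ge> J")
    case True
    then show ?thesis using J by (intro tail_weight_base) auto
  next
    case False
    then have "k \<le> J" by simp
    then show ?thesis
    proof (induction k arbitrary: A rule: inc_induct)
      case base
      then show ?case using J by (rule tail_weight_base)
    next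
      case (step k)
      have "{a \<in> partitions. a 0 \<in> {..A}} = parts_le A" by (simp add: parts_le_def)
      moreover have "(tail_weight k A has_sum tail_value k A) {a \<in> partitions. a 0 \<in> {..A}}"
      proof (rule has_sum_Sigma_parts[where k = "Suc k" and w = "\<lambda>b. gap_weight k (A - b) * col_weight k b"])
        show "((\<lambda>b. gap_weight k (A - b) * col_weight k b * tail_value (Suc k) b) has_sum tail_value k A) {..A}"
          by (subst sum_tail_value[where k = k and A = A, symmetric]) (rule has_sum_finite, simp)
      qed (simp_all add: gap_weight_nonneg col_weight_nonneg tail_weight_Suc step.IH)
      ultimately show ?case by simp
    qed
  qed
qed

text \<open>In the limiting distribution the first column is unbounded and has no gap factor, so its
  sum is Euler's sum instead of \<open>sum_half_qq\<close>.\<close>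

theorem infinite_weight_has_sum:
  "((\<lambda>a. col_weight 0 (a 0) * tail_weight 1 (a 0) (tail a)) has_sum
     ((\<Prod>j\<in>{0..<n}. 1 / q ^ (u j choose 2)) * (qpoch_inf (q\<^sup>2) (q\<^sup>2) / qpoch_inf q q))) partitions"
proof -
  let ?C = "\<Prod>j\<in>{0..<n}. 1 / q ^ (u j choose 2)"
  have "((\<lambda>k. q ^ (Suc k choose 2) / qq k) has_sum (qpoch_inf (q\<^sup>2) (q\<^sup>2) / qpoch_inf q q)) UNIV"
    by (rule sums_nonneg_imp_has_sum[OF euler_q_sum]) (use q_pos in \<open>simp add: less_imp_le\<close>)
  then have "((\<lambda>k. ?C * (q ^ (Suc k choose 2) / qq k)) has_sum (?C * (qpoch_inf (q\<^sup>2) (q\<^sup>2) / qpoch_inf q q))) UNIV"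
    by (rule has_sum_cmult_right)
  then have "((\<lambda>k. col_weight 0 (u 0 + k) * tail_value 1 (u 0 + k)) has_sum (?C * (qpoch_inf (q\<^sup>2) (q\<^sup>2) / qpoch_inf q q))) UNIV"
    using n tail_value_mult[of 0] by simp
  moreover have "bij_betw (\<lambda>k. u 0 + k) UNIV {u 0..}"
    by (rule bij_betw_byWitness[where f' = "\<lambda>b. b - u 0"]) auto
  ultimately have "((\<lambda>b. col_weight 0 b * tail_value 1 b) has_sum (?C * (qpoch_inf (q\<^sup>2) (q\<^sup>2) / qpoch_inf q q))) {u 0..}"
    using has_sum_reindex_bij_betw[of "\<lambda>k. u 0 + k" UNIV "{u 0..}" "\<lambda>b. col_weight 0 b * tail_value 1 b"] by simp
  moreover have "((\<lambda>b. col_weight 0 b * tail_value 1 b) has_sum s) {u 0..} \<longleftrightarrow> ((\<lambda>b. col_weight 0 b * tail_value 1 b) has_sum s) UNIV" for s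
    by (rule has_sum_cong_neutral) (auto simp: col_weight_def)
  ultimately have V: "((\<lambda>b. col_weight 0 b * tail_value 1 b) has_sum (?C * (qpoch_inf (q\<^sup>2) (q\<^sup>2) / qpoch_inf q q))) UNIV"
    by simp
  have "((\<lambda>a. col_weight 0 (a 0) * tail_weight 1 (a 0) (tail a)) has_sum (?C * (qpoch_inf (q\<^sup>2) (q\<^sup>2) / qpoch_inf q q))) {a \<in> partitions. a 0 \<in> UNIV}"
    by (rule has_sum_Sigma_parts[where k = 1 and w = "col_weight 0"])
      (simp_all add: V[simplified] col_weight_nonneg tail_weight_has_sum[of 1, simplified])
  then show ?thesis by simp
qed

section \<open>Moments\<close>

text \<open>The part common to both distributions. They differ by constants and by the gap factor
  between \<open>d\<close> and the first column.\<close>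

definition base_weight :: "(nat \<Rightarrow> nat) \<Rightarrow> real" where
  "base_weight a = q ^ (2 * part_n (conjugate a) + part_size (conjugate a)) / part_b q (conjugate a)
    * (q powi (- int (\<Sum>i=1..n. part_conj (conjugate a) i choose 2)) * qq (part_conj (conjugate a) n))
    * (\<Prod>i=1..<n. qpoch q (q\<^sup>2) (nat \<lceil>real (part_mult (conjugate a) i) / 2\<rceil>))"

lemma P_fin0_conjugate:
  assumes a: "a \<in> partitions"
  shows "P_fin0 q d n (conjugate a) = (if a 0 \<le> d then qq d * gap_weight 0 (d - a 0) * base_weight a else 0)"
proof (cases "a 0 \<le> d")
  case True
  then have "real d - real (a 0) = real (d - a 0)" by simp
  then have h: "qpoch q (q\<^sup>2) (nat \<lceil>(real d - real (a 0)) / 2\<rceil>) = half_qq (d - a 0)"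
    by (simp only: nat_ceiling_half half_qq_def)
  show ?thesis using True n
    by (simp add: P_fin0_def P_fin_def base_weight_def part_len_eq a h qbinom_def gap_weight_def mult_ac)
next
  case False
  then show ?thesis by (simp add: P_fin0_def P_fin_def part_len_eq a)
qed

lemma P_inf0_conjugate:
  "P_inf0 q n (conjugate a) = qpoch_inf q q / qpoch_inf (q\<^sup>2) (q\<^sup>2) * base_weight a"
  by (simp add: P_inf0_def P_inf_def base_weight_def mult_ac)

lemma sum_part_conj:
  assumes "l \<in> partitions"
  shows "(\<Sum>i=1..n. part_conj l i choose 2) = (\<Sum>k<n. conjugate l k choose 2)"
  by (simp add: sum.atLeast1_atMost_eq conjugate_def)

lemma powi_uminus_sum: "q powi (- int (\<Sum>k<n. f k)) = (\<Prod>k<n. 1 / q ^ f k)"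
proof -
  have "q powi (- int m) = 1 / q ^ m" for m by (simp add: power_int_minus field_simps)
  then show ?thesis by (simp only: power_sum prod_dividef prod.neutral_const)
qed

text \<open>All factors are distributed over the columns; the main exponent splits because
  \<open>2 * n(\<lambda>) + |\<lambda>|\<close> is the sum of the squares of the columns. The gaps
  \<open>1\<close> to \<open>M\<close> go with the columns \<open>0\<close> to \<open>M\<close>, the
  last of which has weight \<open>1\<close>.\<close>

lemma base_weight_Sur:
  assumes a: "a \<in> partitions"
  shows "base_weight a * Sur (1 / q) (conjugate a) (conjugate u) = col_weight 0 (a 0) * tail_weight 1 (a 0) (tail a)"
proof -
  obtain J where J: "J \<ge> n" "\<And>k. k \<ge> J \<Longrightarrow> u k = 0" using u_bound by blast
  obtain M0 where M0: "\<And>k. k \<ge> M0 \<Longrightarrow> a k = 0" using partitions_bound[OF a] by blast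
  define M where "M = max J M0"
  have M: "n \<le> M" "\<And>k. k \<ge> M \<Longrightarrow> a k = 0" "\<And>k. k \<ge> M \<Longrightarrow> u k = 0"
    using J M0 by (auto simp: M_def)
  have "tail_weight 1 (a 0) (tail a) = (\<Prod>k<M. gap_weight (Suc k) (a k - a (Suc k)) * col_weight (Suc k) (a (Suc k)))"
  proof -
    have "case_nat (a 0) (tail a) k = a k" for k by (cases k) auto
    then have "tail_weight 1 (a 0) (tail a) = fprod (\<lambda>k. gap_weight (Suc k) (a k - a (Suc k)) * col_weight (Suc k) (a (Suc k)))"
      by (simp add: tail_weight_def)
    also have "\<dots> = (\<Prod>k<M. gap_weight (Suc k) (a k - a (Suc k)) * col_weight (Suc k) (a (Suc k)))"
      by (rule fprod_eq) (simp add: M trivial_weight)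
    finally show ?thesis .
  qed
  then have rhs: "col_weight 0 (a 0) * tail_weight 1 (a 0) (tail a)
      = (\<Prod>k<M. gap_weight (Suc k) (a k - a (Suc k))) * (\<Prod>k<Suc M. col_weight k (a k))"
    by (simp add: prod.distrib prod.lessThan_Suc_shift del: prod.lessThan_Suc)
  show ?thesis
  proof (cases "\<forall>k. u k \<le> a k")
    case False
    then obtain k where k: "a k < u k" by (auto simp: not_le)
    then have "k < M" using M(3)[of k] by (cases "k < M") auto
    then have "(\<Prod>k<Suc M. col_weight k (a k)) = 0"
      using k by (intro prod_zero) (auto intro!: bexI[of _ k] simp: col_weight_def)
    then show ?thesis unfolding rhs Sur_eq[OF u a] if_not_P[OF False] by simp
  next
    case True
    have Sur: "Sur (1 / q) (conjugate a) (conjugate u) = (\<Prod>k<M. qq (a k - u (Suc k)) / qq (a k - u k) / q ^ (a k * u k))"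
      unfolding Sur_eq[OF u a] if_P[OF True] by (rule fprod_eq) (simp add: M)
    have size: "q ^ (2 * part_n (conjugate a) + part_size (conjugate a)) = (\<Prod>k<M. q ^ (a k * a k))"
    proof -
      have "part_n (conjugate a) = (\<Sum>k<M. a k choose 2)"
        using part_n_eq[of "conjugate a" M] a M(2) by simp
      moreover have "part_size (conjugate a) = (\<Sum>k<M. a k)"
        using part_size_eq[of M a] a M(2) by simp
      ultimately show ?thesis
        by (simp add: square_eq_choose_two sum_distrib_left sum.distrib flip: power_sum)
    qed
    have b: "part_b q (conjugate a) = (\<Prod>k<M. qq (a k - a (Suc k)))"
      using part_b_eq[of "conjugate a" q] a fprod_eq[of M "\<lambda>k. qq (a k - a (Suc k))"] M(2) by simp
    have minus: "q powi (- int (\<Sum>i=1..n. part_conj (conjugate a) i choose 2)) = (\<Prod>k<n. 1 / q ^ (a k choose 2))"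
      by (simp only: sum_part_conj[OF conjugate_partitions[OF a]] conjugate_conjugate[OF a] powi_uminus_sum)
    have restrict: "(\<Prod>k<M. if k < m then f k else 1) = (\<Prod>k<m. f k)" if "m \<le> M" for m and f :: "nat \<Rightarrow> real"
      by (rule prod.mono_neutral_cong_right) (use that in auto)
    \<comment> \<open>The gap before column index \<open>Suc k\<close> is the multiplicity of the
      part \<open>k + 1\<close>; it carries \<open>half_qq\<close> for \<open>Suc k < n\<close>,
      which gives the parts \<open>1\<close> to \<open>n - 1\<close>.\<close>
    have "(\<Prod>k<M. gap_weight (Suc k) (a k - a (Suc k)))
        = (\<Prod>k<M. if k < n - 1 then half_qq (a k - a (Suc k)) else 1) / part_b q (conjugate a)"
      unfolding b prod_dividef[symmetric] using n by (intro prod.cong) (auto simp: gap_weight_def)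
    also have "(\<Prod>k<M. if k < n - 1 then half_qq (a k - a (Suc k)) else 1) = (\<Prod>k<n - 1. half_qq (a k - a (Suc k)))"
      using M(1) by (intro restrict) simp
    also have "\<dots> = (\<Prod>i=1..<n. qpoch q (q\<^sup>2) (nat \<lceil>real (part_mult (conjugate a) i) / 2\<rceil>))"
      by (rule prod.reindex_bij_witness[of _ "\<lambda>i. i - 1" Suc])
        (auto simp: half_qq_def nat_ceiling_half part_mult_Suc a)
    finally have gap: "(\<Prod>k<M. gap_weight (Suc k) (a k - a (Suc k)))
      = (\<Prod>i=1..<n. qpoch q (q\<^sup>2) (nat \<lceil>real (part_mult (conjugate a) i) / 2\<rceil>)) / part_b q (conjugate a)" .
    have one: "col_weight M (a M) = 1" by (simp add: M trivial_weight)
    have col: "col_weight k (a k) = q ^ (a k * a k) * (qq (a k - u (Suc k)) / qq (a k - u k) / q ^ (a k * u k))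
        * (if k < n then 1 / q ^ (a k choose 2) else 1) * (if k = n - 1 then qq (a k) else 1)" for k
      using True n by (auto simp: col_weight_def)
    have "(\<Prod>k<Suc M. col_weight k (a k)) = (\<Prod>k<M. q ^ (a k * a k) * (qq (a k - u (Suc k)) / qq (a k - u k) / q ^ (a k * u k))
        * (if k < n then 1 / q ^ (a k choose 2) else 1) * (if k = n - 1 then qq (a k) else 1))"
      unfolding prod.lessThan_Suc one mult_1_right by (rule prod.cong[OF refl]) (rule col)
    also have "\<dots> = (\<Prod>k<M. q ^ (a k * a k)) * (\<Prod>k<M. qq (a k - u (Suc k)) / qq (a k - u k) / q ^ (a k * u k))
        * (\<Prod>k<n. 1 / q ^ (a k choose 2)) * qq (a (n - 1))"
      unfolding prod.distrib restrict[OF M(1)] using n M(1) by (simp add: prod.delta)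
    also have "qq (a (n - 1)) = qq (part_conj (conjugate a) n)"
      using n by (simp add: part_conj_eq a)
    finally show ?thesis
      unfolding rhs gap base_weight_def Sur size minus by (simp add: mult_ac)
  qed
qed

lemma has_sum_conjugate:
  "((\<lambda>a. f (conjugate a)) has_sum s) partitions \<longleftrightarrow> (f has_sum s) partitions"
  by (rule has_sum_reindex_bij_betw[OF bij_betw_conjugate])

theorem moment_fin:
  "((\<lambda>l. P_fin0 q d n l * Sur (1 / q) l (conjugate u)) has_sum (qq d * tail_value 0 d)) partitions"
proof -
  have eq: "P_fin0 q d n (conjugate a) * Sur (1 / q) (conjugate a) (conjugate u) = qq d * tail_weight 0 d a"
    if "a \<in> parts_le d" for a
  proof -
    have a: "a \<in> partitions" "a 0 \<le> d" using that by (auto simp: parts_le_def)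
    have "P_fin0 q d n (conjugate a) * Sur (1 / q) (conjugate a) (conjugate u)
        = qq d * gap_weight 0 (d - a 0) * (base_weight a * Sur (1 / q) (conjugate a) (conjugate u))"
      using a by (simp add: P_fin0_conjugate)
    then show ?thesis
      unfolding base_weight_Sur[OF a(1)] tail_weight_Suc[OF a(1)] by simp
  qed
  have "((\<lambda>a. qq d * tail_weight 0 d a) has_sum (qq d * tail_value 0 d)) (parts_le d)"
    by (rule has_sum_cmult_right[OF tail_weight_has_sum])
  moreover have "((\<lambda>a. qq d * tail_weight 0 d a) has_sum s) (parts_le d) \<longleftrightarrow>
      ((\<lambda>a. P_fin0 q d n (conjugate a) * Sur (1 / q) (conjugate a) (conjugate u)) has_sum s) partitions" for s
    by (rule has_sum_cong_neutral) (use eq in \<open>auto simp: parts_le_def P_fin0_conjugate\<close>)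
  ultimately show ?thesis
    using has_sum_conjugate[of "\<lambda>l. P_fin0 q d n l * Sur (1 / q) l (conjugate u)"] by simp
qed

theorem moment_inf:
  "((\<lambda>l. P_inf0 q n l * Sur (1 / q) l (conjugate u)) has_sum (\<Prod>j<n. 1 / q ^ (u j choose 2))) partitions"
proof -
  let ?c = "qpoch_inf q q / qpoch_inf (q\<^sup>2) (q\<^sup>2)"
  have "0 < q\<^sup>2" "q\<^sup>2 < 1" using q_pos q_less_1 by (auto simp: power_less_one_iff)
  then have "qpoch_inf (q\<^sup>2) (q\<^sup>2) \<noteq> 0" by (rule qpoch_inf_self_nonzero)
  then have "((\<lambda>a. ?c * (col_weight 0 (a 0) * tail_weight 1 (a 0) (tail a))) has_sum (\<Prod>j<n. 1 / q ^ (u j choose 2))) partitions"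
    using has_sum_cmult_right[OF infinite_weight_has_sum, of ?c] by (simp add: atLeast0LessThan)
  moreover have "?c * (col_weight 0 (a 0) * tail_weight 1 (a 0) (tail a))
      = P_inf0 q n (conjugate a) * Sur (1 / q) (conjugate a) (conjugate u)" if "a \<in> partitions" for a
    unfolding base_weight_Sur[OF that, symmetric] P_inf0_conjugate by (rule mult.assoc[symmetric])
  ultimately have "((\<lambda>a. P_inf0 q n (conjugate a) * Sur (1 / q) (conjugate a) (conjugate u)) has_sum
      (\<Prod>j<n. 1 / q ^ (u j choose 2))) partitions"
    by (simp cong: has_sum_cong)
  then show ?thesis
    using has_sum_conjugate[of "\<lambda>l. P_inf0 q n l * Sur (1 / q) l (conjugate u)"] by simp
qed

end

theorem theorem1p13:
  fixes n d :: nat and p q :: real and \<mu> :: "nat \<Rightarrow> nat"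
  assumes "n \<ge> 1" and "d \<ge> 1" and "p > 1" and "q = 1 / p" and "\<mu> \<in> partitions"
  shows "moment_converges p \<mu> (P_fin0 q d n) \<and>
         moment p \<mu> (P_fin0 q d n) =
           q powi (- int (\<Sum>i=1..n. part_conj \<mu> i choose 2))
             * (qpoch q q d * inv_qpoch q (int d - int (part_len \<mu>))) \<and>
         moment_converges p \<mu> (P_inf0 q n) \<and>
         moment p \<mu> (P_inf0 q n) = p ^ (\<Sum>i=1..n. part_conj \<mu> i choose 2)"
proof -
  define u where "u = conjugate \<mu>"
  interpret moment_sum q n u
    by unfold_locales (use assms in \<open>auto simp: u_def\<close>)
  have \<mu>: "conjugate u = \<mu>" and p: "p = 1 / q" using assms by (auto simp: u_def)
  have len: "part_len \<mu> = u 0" by (simp add: part_len_eq u_def)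
  have minus: "q powi (- int (\<Sum>i=1..n. part_conj \<mu> i choose 2)) = (\<Prod>j<n. 1 / q ^ (u j choose 2))"
    by (simp only: sum_part_conj[OF assms(5)] powi_uminus_sum u_def)
  have plus: "p ^ (\<Sum>i=1..n. part_conj \<mu> i choose 2) = (\<Prod>j<n. 1 / q ^ (u j choose 2))"
    by (simp only: sum_part_conj[OF assms(5)] p u_def power_sum power_one_over)
  \<comment> \<open>For \<open>u 0 > d\<close> the zero branch of \<open>tail_value\<close> agrees
    with the convention for \<open>inv_qpoch\<close> at negative integers.\<close>
  have val: "qq d * tail_value 0 d = (\<Prod>j<n. 1 / q ^ (u j choose 2)) * (qq d * inv_qpoch q (int d - int (u 0)))"
    using assms(1) by (auto simp: tail_value_def inv_qpoch_def atLeast0LessThan nat_diff_distrib)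
  show ?thesis
    unfolding moment_converges_def moment_def minus plus len
    using moment_fin[of d] moment_inf infsumI[OF moment_fin[of d]] infsumI[OF moment_inf]
    by (simp add: \<mu> val has_sum_imp_summable flip: p)
qed

end
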